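(* Let $f_1,\dots,f_n:\mathbb{R}^d\to\mathbb{R}$ be differentiable with $\|\nabla f_i(x)-\nabla f_i(y)\|\le \ell\|x-y\|$ for all $x,y$ ($\ell>0$), let $f=\frac1n\sum_{i=1}^n f_i$ satisfy $f^\ast=\inf f>-\infty$, and let a lower bound $f_{\rm low}\le f^\ast$ be known. Let the communication graph be undirected and connected. Let $\mathcal{C}:\mathbb{R}^d\to\mathbb{R}^d$ be a locally-bounded compressor: for some $p\ge1$, $r>0$, $C>0$, $\delta\in(0,1]$, $\big\|\frac{\mathcal{C}(x)}{r}-x\big\|_p\le C(1-\delta)$ for all $x$ with $\|x\|_p\le C$. Let $\{x_{i,k}\}$ be generated by the Unified Compression Algorithm with the initial inter-agent communication replaced by an uncompressed round (see context), and with $$\alpha=\frac{\tau_0}{n^{1/3}\tilde d^{2/3}T^{1/3}},\quad \beta=\tau_1\gamma,\quad \gamma>\kappa_2,\quad\omega\in(0,\tfrac1r],\quad T>\kappa_3,\quad s_0^2=\tau_4n\alpha^2,\quad \tau_0\le\kappa_0,\quad\tau_1\ge\kappa_1,\quad\tau_4\ge\kappa_4,$$ $$s_k^2=(1-\varepsilon_8)s_{k-1}^2+\tilde\kappa_4(T),\qquad k=1,\dots,T,$$ where the constants are those given in the context ($\tau_0>0$). Then, with $\bar x_k=\frac1n\sum_i x_{i,k}$, $$\frac1T\sum_{k=0}^{T-1}\Big(\|\nabla f(\bar x_k)\|^2+\frac1n\sum_{i=1}^n\|x_{i,k}-\bar x_k\|^2\Big)=\mathcal{O}\Big(\frac{n^{1/3}\tilde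 d^{2/3}}{T^{2/3}}\Big),\qquad f(\bar x_T)-f^\ast=\mathcal{O}(1).$$
   Context: Network: $n\ge2$ agents, weighted undirected connected graph with symmetric nonnegative adjacency matrix $A=[A_{ij}]$, $A_{ij}>0$ iff $(j,i)$ is an edge; Laplacian $L=\mathrm{diag}(\sum_jA_{1j},\dots,\sum_j A_{nj})-A=[L_{ij}]$. $\rho(L)$ is the spectral radius, $\rho_2(L)$ the smallest positive eigenvalue. $\|\cdot\|=\|\cdot\|_2$; $p\in[1,\infty]$. $\hat d=d^{1/p-1/2},\ \tilde d=1$ if $p\in[1,2]$; $\hat d=1,\ \tilde d=d^{1/2-1/p}$ if $p>2$. Unified Compression Algorithm with uncompressed first round: positive parameters $\alpha,\beta,\gamma,\omega$, positive sequence $\{s_k\}$; $x_{i,0}\in\mathbb{R}^d$ arbitrary, $v_{i,0}=\mathbf 0_d$, and (this is how the uncompressed first round is modelled) $\hat x_{i,-1}=x_{i,0}$, $y_{i,-1}=\sum_{j=1}^nL_{ij}x_{j,0}$. For $k=0,1,\dots$ and each $i$: $q_{i,k}=\mathcal{C}((x_{i,k}-\hat x_{i,k-1})/s_k)$, $\hat x_{i,k}=\hat x_{i,k-1}+\omega s_kq_{i,k}$, $y_{i,k}=y_{i,k-1}+\omega s_k\sum_{j=1}^nL_{ij}q_{j,k}$, $x_{i,k+1}=x_{i,k}-\alpha(\beta y_{i,k}+\gamma v_{i,k}+\nabla f_i(x_{i,k}))$, $v_{i,k+1}=v_{i,k}+\alpha\gamma y_{i,k}$. Lyapunov function: $\mathbf{x}_k=\mathrm{col}(x_{1,k},\dots,x_{n,k})$,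 $\mathbf{v}_k=\mathrm{col}(v_{1,k},\dots,v_{n,k})$, $\mathbf{g}_k^0=\mathrm{col}(\nabla f_1(\bar x_k),\dots,\nabla f_n(\bar x_k))$. $\mathbf{E}=(\mathbf{I}_n-\frac1n\mathbf 1_n\mathbf 1_n^\top)\otimes\mathbf{I}_d$. $\mathbf{F}=F\otimes \mathbf{I}_d$, $F=[q\ Q]\,\mathrm{diag}(\lambda_{n+1}^{-1},\Lambda_1^{-1})[q\ Q]^\top$, where $L=[q\ Q]\,\mathrm{diag}(0,\Lambda_1)[q\ Q]^\top$ is an orthogonal eigendecomposition, $q=\mathbf 1_n/\sqrt n$, $\Lambda_1=\mathrm{diag}(\lambda_2,\dots,\lambda_n)$, $0<\lambda_2\le\dots\le\lambda_n$, and $\lambda_{n+1}\in[\lambda_2,\lambda_n]$. $\|x\|_A^2=x^\top Ax$. $\mathcal{L}_{1,k}=\frac12\|\mathbf{x}_k\|_{\mathbf E}^2+\frac12\|\mathbf v_k+\frac1\gamma\mathbf g_k^0\|^2_{\frac{\beta+\gamma}{\gamma}\mathbf F}+\mathbf x_k^\top\mathbf E\mathbf F(\mathbf v_k+\frac1\gamma\mathbf g_k^0)+n(f(\bar x_k)-f^\ast)$. Constants (positive numbers divided by $0$ are $+\infty$): $\kappa_1=4/\rho_2(L)$; $\kappa_2=\max\{2+2\ell^2,\ 5/\rho_2(L),\ (16\ell^2(\kappa_1+1)^2/\rho_2(L))^{1/3},\ 2\sqrt2\,\ell/\rho_2(L)\}$; $\varphi_1=\frac12(\rho_2(L)\beta-(3\gamma+2+2\ell^2))$;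 $\varphi_2=3\rho^2(L)\beta^2-\rho_2(L)\beta\gamma+(\rho(L)+2)\gamma^2+1+\frac52\ell^2$; $\varphi_3=\frac\gamma2-\frac52\rho_2^{-1}(L)$; $\varphi_4=2\rho(L)\gamma^2+\frac12\rho(L)$; $\varphi_5=\frac18-\frac{(\beta+\gamma)^2}{\gamma^5}\rho_2^{-1}(L)\ell^2-\frac1{2\gamma^2}\rho_2^{-2}(L)\ell^2$; $\varphi_6=\frac{\beta+\gamma}{2\gamma^3}\rho_2^{-1}(L)\ell^2+\frac1{2\gamma^2}\rho_2^{-2}(L)\ell^2+\frac12\rho_2^{-2}(L)\ell^2+\frac{\ell^2}2+\frac\ell2$; $\varphi_7=(\rho(L)+1)\gamma+\frac12\rho(L)\beta$; $\varphi_8=3\rho^2(L)\beta^2+(\rho(L)-2\rho_2(L))\beta\gamma+(\rho(L)+2)\gamma^2+1$; $\hat\kappa_0=\min\{\varphi_1/\varphi_2,\varphi_3/\varphi_4,\varphi_5/\varphi_6\}$; $\kappa_7=\min\{\hat\kappa_0,1/(2\ell)\}$; $\varepsilon_1=\frac{\tau_1\rho_2(L)-1}{2\tau_1\rho_2(L)}$; $\varepsilon_5=\omega r(\delta-\delta^2/2)$; $\varepsilon_8=(\varepsilon_5+2\varepsilon_5^2)/2$; $\psi_2=\varphi_7+\alpha\varphi_8$; $\psi_3=4(1+\varepsilon_5^{-1})\hat d^2\beta^2\rho^2(L)$; $\psi_4=4(1+\varepsilon_5^{-1})\hat d^2\max\{\beta^2\rho^2(L)+\ell^2,\ \gamma^2\rho(L)\}/\varepsilon_1$;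 $\kappa_0=\big(\frac{\varepsilon_8}{2(1-2\varepsilon_5)\psi_2\psi_4}\big)^{1/3}$; $\kappa_3=\max\big\{\frac{\tau_0^3}{n\tilde d^2\kappa_7^3},\ \big(\frac{(1-2\varepsilon_5)\psi_3\tau_0^2}{\varepsilon_8}\big)^{3/2}n^{1/2}\tilde d\big\}$; $\kappa_4=\frac{2\psi_4\mathcal L_{1,0}}{C^2\varepsilon_8n}$; $\tilde\kappa_4(T)=\psi_4\mathcal L_{1,0}\alpha^2/C^2+(1-2\varepsilon_5)\psi_2\psi_4n\tilde d^2s_0^2\alpha^3T$. $\mathcal O(\cdot)$ hides factors that do not depend on $T$, $n$, $\tilde d$; they may depend on $\ell,\rho(L),\rho_2(L),\beta,\gamma,\tau_0,\tau_1,\tau_4,\omega,r,\delta,C,\hat d$ and on the normalized initial value $\mathcal L_{1,0}/n$ (the paper treats $\mathcal L_{1,0}=\mathcal O(n)$). $T$ is a positive integer fixed in advance.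
   Formalization: The formal theorem adds the hypothesis κ₇ > 0; for large τ₁ the constant φ₅, hence κ₇, can be negative, T > κ₃ then no longer bounds α, and the claim as written fails (e.g. n=2, ℓ=1, γ=5, τ₁=10, δ=1, ω=1/r, τ₀=20, T=4). *)

theory Defs
  imports
    "Jordan_Normal_Form.Spectral_Radius"
    "HOL-Library.Extended_Real"
begin

text \<open>
  The hidden constants of the main estimate have to be uniform in the number of agents n and in the
  dimension d, so n and d are quantified inside the statement.  Points of \<open>\<real>\<^sup>d\<close> are therefore elements
  of \<^term>\<open>carrier_vec d\<close> and matrices are elements of \<^term>\<open>carrier_mat n n\<close>.  Agents are
  numbered from 0 to n - 1.
\<close>

definition norm2 :: "real vec \<Rightarrow> real" where
  "norm2 z = sqrt (z \<bullet> z)"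

definition pnorm :: "ereal \<Rightarrow> real vec \<Rightarrow> real" where
  "pnorm p z =
     (if p = \<infinity> then Max ((\<lambda>i. \<bar>z $ i\<bar>) ` {..<dim_vec z})
      else (\<Sum>i<dim_vec z. \<bar>z $ i\<bar> powr real_of_ereal p) powr (1 / real_of_ereal p))"

text \<open>In the next two definitions \<open>1 / p\<close> is the extended-real quotient, so \<open>1 / \<infinity> = 0\<close>.\<close>

definition dhat :: "ereal \<Rightarrow> nat \<Rightarrow> real" where
  "dhat p d = (if p \<le> 2 then real d powr (real_of_ereal (1 / p) - 1/2) else 1)"

definition dtilde :: "ereal \<Rightarrow> nat \<Rightarrow> real" where
  "dtilde p d = (if p \<le> 2 then 1 else real d powr (1/2 - real_of_ereal (1 / p)))"

text \<open>Frechet differentiability at z; the type of vectors of arbitrary dimension is not an instance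
  of the normed-space classes, so \<^const>\<open>has_derivative\<close> is not applicable.\<close>

definition has_gradient :: "nat \<Rightarrow> (real vec \<Rightarrow> real) \<Rightarrow> real vec \<Rightarrow> real vec \<Rightarrow> bool" where
  "has_gradient d f z g \<longleftrightarrow> g \<in> carrier_vec d \<and>
     (\<forall>e>0. \<exists>h>0. \<forall>w\<in>carrier_vec d. norm2 (w - z) < h \<longrightarrow>
        \<bar>f w - f z - g \<bullet> (w - z)\<bar> \<le> e * norm2 (w - z))"

definition gradient :: "nat \<Rightarrow> (real vec \<Rightarrow> real) \<Rightarrow> real vec \<Rightarrow> real vec" where
  "gradient d f z = (THE g. has_gradient d f z g)"

lemma has_gradient_unique:
  assumes z: "z \<in> carrier_vec d" and g: "has_gradient d f z g" and g': "has_gradient d f z g'"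
  shows "g = g'"
proof (rule ccontr)
  assume ne: "g \<noteq> g'"
  have cg: "g \<in> carrier_vec d" and cg': "g' \<in> carrier_vec d"
    using g g' by (auto simp: has_gradient_def)
  define u where "u = g - g'"
  have cu: "u \<in> carrier_vec d" using cg cg' by (simp add: u_def)
  have "u \<noteq> 0\<^sub>v d"
  proof
    assume u0: "u = 0\<^sub>v d"
    have "g $ i = g' $ i" if "i < d" for i
    proof -
      have "u $ i = 0" using u0 that by simp
      then show ?thesis using that cg cg' by (simp add: u_def)
    qed
    then show False using ne cg cg' by (auto intro!: eq_vecI)
  qed
  then obtain i where i: "i < d" "u $ i \<noteq> 0"
    using cu by (metis carrier_vecD eq_vecI index_zero_vec)
  have upos: "u \<bullet> u > 0"
    unfolding scalar_prod_def
    by (rule sum_pos2[of _ i]) (use i cu in \<open>auto simp: zero_less_mult_iff not_less\<close>)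
  define N where "N = norm2 u"
  have N: "N > 0" "u \<bullet> u = N * N" using upos by (simp_all add: N_def norm2_def)
  define e where "e = N / 4"
  have e: "e > 0" using N by (simp add: e_def)
  obtain h where h: "h > 0" "\<And>w. w \<in> carrier_vec d \<Longrightarrow> norm2 (w - z) < h \<Longrightarrow>
      \<bar>f w - f z - g \<bullet> (w - z)\<bar> \<le> e * norm2 (w - z)"
    using g e unfolding has_gradient_def by metis
  obtain h' where h': "h' > 0" "\<And>w. w \<in> carrier_vec d \<Longrightarrow> norm2 (w - z) < h' \<Longrightarrow>
      \<bar>f w - f z - g' \<bullet> (w - z)\<bar> \<le> e * norm2 (w - z)"
    using g' e unfolding has_gradient_def by metis
  define t where "t = min h h' / (2 * N)"
  have t: "t > 0" using h(1) h'(1) N by (simp add: t_def)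
  define w where "w = z + t \<cdot>\<^sub>v u"
  have wz: "w - z = t \<cdot>\<^sub>v u" using z cu by (intro eq_vecI) (auto simp: w_def)
  have cw: "w \<in> carrier_vec d" using z cu by (simp add: w_def)
  have nw: "norm2 (w - z) = t * N"
    using t cu by (simp add: wz norm2_def N_def real_sqrt_mult)
  have tN: "t * N = min h h' / 2" using N by (simp add: t_def)
  have "t * N < h" "t * N < h'" unfolding tN using h(1) h'(1) by auto
  then have "\<bar>f w - f z - g \<bullet> (w - z)\<bar> \<le> e * (t * N)" "\<bar>f w - f z - g' \<bullet> (w - z)\<bar> \<le> e * (t * N)"
    using h(2)[OF cw] h'(2)[OF cw] nw by auto
  then have "\<bar>g \<bullet> (w - z) - g' \<bullet> (w - z)\<bar> \<le> 2 * (e * (t * N))" by linarith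
  moreover have "g \<bullet> (w - z) - g' \<bullet> (w - z) = u \<bullet> (w - z)"
    unfolding u_def using cg cg' cw z by (simp add: minus_scalar_prod_distrib[of _ d])
  moreover have "u \<bullet> (w - z) = t * (N * N)" using cu N(2) by (simp add: wz)
  ultimately have "t * (N * N) \<le> 2 * (e * (t * N))" by simp
  also have "\<dots> = t * (N * N) / 2" by (simp add: e_def)
  finally show False using t N(1) by simp
qed

definition laplacian :: "nat \<Rightarrow> real mat \<Rightarrow> real mat" where
  "laplacian n A = mat_diag n (\<lambda>i. \<Sum>j<n. A $$ (i, j)) - A"

definition undirected_connected :: "nat \<Rightarrow> real mat \<Rightarrow> bool" where
  "undirected_connected n A \<longleftrightarrow>
     A \<in> carrier_mat n n \<and> A\<^sup>T = A \<and> (\<forall>i<n. \<forall>j<n. 0 \<le> A $$ (i, j)) \<and>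
     (\<forall>i<n. \<forall>j<n. (j, i) \<in> {(j, i). j < n \<and> i < n \<and> 0 < A $$ (i, j)}\<^sup>*)"

definition rho :: "real mat \<Rightarrow> real" where
  "rho L = spectral_radius (map_mat complex_of_real L)"

definition rho2 :: "real mat \<Rightarrow> real" where
  "rho2 L = Min {e. eigenvalue L e \<and> 0 < e}"

text \<open>
  An orthogonal matrix U whose first column is \<open>q = 1 / sqrt n\<close>, with \<open>lam 2, \<dots>, lam n\<close> the positive
  eigenvalues in increasing order (column j of U belongs to \<open>lam (j + 1)\<close>).  The additional number
  \<open>lam (n + 1)\<close> replaces the eigenvalue 0 in \<open>F\<close>.
\<close>

definition laplacian_eigendecomposition :: "nat \<Rightarrow> real mat \<Rightarrow> real mat \<Rightarrow> (nat \<Rightarrow> real) \<Rightarrow> bool" where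
  "laplacian_eigendecomposition n L U lam \<longleftrightarrow>
     U \<in> carrier_mat n n \<and> U * U\<^sup>T = 1\<^sub>m n \<and> U\<^sup>T * U = 1\<^sub>m n \<and>
     col U 0 = vec n (\<lambda>_. 1 / sqrt (real n)) \<and>
     L = U * mat_diag n (\<lambda>j. if j = 0 then 0 else lam (j + 1)) * U\<^sup>T \<and>
     0 < lam 2 \<and> (\<forall>i j. 2 \<le> i \<and> i \<le> j \<and> j \<le> n \<longrightarrow> lam i \<le> lam j)"

definition F_mat :: "nat \<Rightarrow> real mat \<Rightarrow> (nat \<Rightarrow> real) \<Rightarrow> real mat" where
  "F_mat n U lam =
     U * mat_diag n (\<lambda>j. if j = 0 then inverse (lam (n + 1)) else inverse (lam (j + 1))) * U\<^sup>T"

definition E_mat :: "nat \<Rightarrow> real mat" where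
  "E_mat n = 1\<^sub>m n - mat n n (\<lambda>_. 1 / real n)"

definition kron :: "real mat \<Rightarrow> real mat \<Rightarrow> real mat" where
  "kron A B = mat (dim_row A * dim_row B) (dim_col A * dim_col B)
     (\<lambda>(i, j). A $$ (i div dim_row B, j div dim_col B) * B $$ (i mod dim_row B, j mod dim_col B))"

definition stack :: "nat \<Rightarrow> nat \<Rightarrow> (nat \<Rightarrow> real vec) \<Rightarrow> real vec" where
  "stack n d z = vec (n * d) (\<lambda>i. z (i div d) $ (i mod d))"

definition wnorm_sq :: "real mat \<Rightarrow> real vec \<Rightarrow> real" where
  "wnorm_sq M z = z \<bullet> (M *\<^sub>v z)"

definition lincomb_vec :: "nat \<Rightarrow> nat \<Rightarrow> (nat \<Rightarrow> real) \<Rightarrow> (nat \<Rightarrow> real vec) \<Rightarrow> real vec" where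
  "lincomb_vec d n c z = vec d (\<lambda>a. \<Sum>j<n. c j * z j $ a)"

definition mean_vec :: "nat \<Rightarrow> nat \<Rightarrow> (nat \<Rightarrow> real vec) \<Rightarrow> real vec" where
  "mean_vec d n z = lincomb_vec d n (\<lambda>_. 1 / real n) z"

definition mean_fun :: "nat \<Rightarrow> (nat \<Rightarrow> real vec \<Rightarrow> real) \<Rightarrow> real vec \<Rightarrow> real" where
  "mean_fun n f z = (\<Sum>i<n. f i z) / real n"

definition locally_bounded_compressor ::
    "nat \<Rightarrow> ereal \<Rightarrow> real \<Rightarrow> real \<Rightarrow> real \<Rightarrow> (real vec \<Rightarrow> real vec) \<Rightarrow> bool" where
  "locally_bounded_compressor d p r C \<delta> cmpr \<longleftrightarrow>
     (\<forall>z\<in>carrier_vec d. cmpr z \<in> carrier_vec d) \<and>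
     (\<forall>z\<in>carrier_vec d. pnorm p z \<le> C \<longrightarrow> pnorm p ((1 / r) \<cdot>\<^sub>v cmpr z - z) \<le> C * (1 - \<delta>))"

text \<open>
  The sequences \<open>xh\<close> and \<open>y\<close> start at time index -1, so \<open>xh i k\<close> and \<open>y i k\<close> stand for the iterates with
  index k - 1.  The initial values of \<open>xh\<close> and \<open>y\<close> model the uncompressed first round.
\<close>

definition uca_run ::
    "nat \<Rightarrow> nat \<Rightarrow> real mat \<Rightarrow> (nat \<Rightarrow> real vec \<Rightarrow> real) \<Rightarrow> (real vec \<Rightarrow> real vec) \<Rightarrow>
     real \<Rightarrow> real \<Rightarrow> real \<Rightarrow> real \<Rightarrow> (nat \<Rightarrow> real) \<Rightarrow>
     (nat \<Rightarrow> nat \<Rightarrow> real vec) \<Rightarrow> (nat \<Rightarrow> nat \<Rightarrow> real vec) \<Rightarrow> (nat \<Rightarrow> nat \<Rightarrow> real vec) \<Rightarrow>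
     (nat \<Rightarrow> nat \<Rightarrow> real vec) \<Rightarrow> (nat \<Rightarrow> nat \<Rightarrow> real vec) \<Rightarrow> bool" where
  "uca_run n d L f cmpr \<alpha> \<beta> \<gamma> \<omega> s x v xh y q \<longleftrightarrow>
     (\<forall>i<n. x i 0 \<in> carrier_vec d \<and> v i 0 = 0\<^sub>v d \<and> xh i 0 = x i 0 \<and>
        y i 0 = lincomb_vec d n (\<lambda>j. L $$ (i, j)) (\<lambda>j. x j 0)) \<and>
     (\<forall>k. \<forall>i<n.
        q i k = cmpr ((1 / s k) \<cdot>\<^sub>v (x i k - xh i k)) \<and>
        xh i (Suc k) = xh i k + (\<omega> * s k) \<cdot>\<^sub>v q i k \<and>
        y i (Suc k) = y i k + (\<omega> * s k) \<cdot>\<^sub>v lincomb_vec d n (\<lambda>j. L $$ (i, j)) (\<lambda>j. q j k) \<and>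
        x i (Suc k) = x i k - \<alpha> \<cdot>\<^sub>v (\<beta> \<cdot>\<^sub>v y i (Suc k) + \<gamma> \<cdot>\<^sub>v v i k + gradient d (f i) (x i k)) \<and>
        v i (Suc k) = v i k + (\<alpha> * \<gamma>) \<cdot>\<^sub>v y i (Suc k))"

definition lyapunov ::
    "nat \<Rightarrow> nat \<Rightarrow> real mat \<Rightarrow> (nat \<Rightarrow> real) \<Rightarrow> (nat \<Rightarrow> real vec \<Rightarrow> real) \<Rightarrow> real \<Rightarrow> real \<Rightarrow> real \<Rightarrow>
     (nat \<Rightarrow> nat \<Rightarrow> real vec) \<Rightarrow> (nat \<Rightarrow> nat \<Rightarrow> real vec) \<Rightarrow> nat \<Rightarrow> real" where
  "lyapunov n d U lam f fstar \<beta> \<gamma> x v k =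
     (let E = kron (E_mat n) (1\<^sub>m d);
          F = kron (F_mat n U lam) (1\<^sub>m d);
          xbar = mean_vec d n (\<lambda>i. x i k);
          X = stack n d (\<lambda>i. x i k);
          V = stack n d (\<lambda>i. v i k);
          G0 = stack n d (\<lambda>i. gradient d (f i) xbar);
          W = V + (1 / \<gamma>) \<cdot>\<^sub>v G0
      in 1/2 * wnorm_sq E X + 1/2 * wnorm_sq (((\<beta> + \<gamma>) / \<gamma>) \<cdot>\<^sub>m F) W
         + X \<bullet> (E *\<^sub>v (F *\<^sub>v W)) + real n * (mean_fun n f xbar - fstar))"

text \<open>Below \<open>\<rho>\<close> and \<open>\<rho>\<^sub>2\<close> are the values \<^term>\<open>rho L\<close> and \<^term>\<open>rho2 L\<close>.\<close>

definition kappa1 :: "real \<Rightarrow> real" where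
  "kappa1 \<rho>\<^sub>2 = 4 / \<rho>\<^sub>2"

definition kappa2 :: "real \<Rightarrow> real \<Rightarrow> real" where
  "kappa2 l \<rho>\<^sub>2 = Max {2 + 2 * l^2, 5 / \<rho>\<^sub>2, (16 * l^2 * (kappa1 \<rho>\<^sub>2 + 1)^2 / \<rho>\<^sub>2) powr (1/3),
     2 * sqrt 2 * l / \<rho>\<^sub>2}"

definition phi1 :: "real \<Rightarrow> real \<Rightarrow> real \<Rightarrow> real \<Rightarrow> real" where
  "phi1 l \<rho>\<^sub>2 \<beta> \<gamma> = 1/2 * (\<rho>\<^sub>2 * \<beta> - (3 * \<gamma> + 2 + 2 * l^2))"

definition phi2 :: "real \<Rightarrow> real \<Rightarrow> real \<Rightarrow> real \<Rightarrow> real \<Rightarrow> real" where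
  "phi2 l \<rho> \<rho>\<^sub>2 \<beta> \<gamma> = 3 * \<rho>^2 * \<beta>^2 - \<rho>\<^sub>2 * \<beta> * \<gamma> + (\<rho> + 2) * \<gamma>^2 + 1 + 5/2 * l^2"

definition phi3 :: "real \<Rightarrow> real \<Rightarrow> real" where
  "phi3 \<rho>\<^sub>2 \<gamma> = \<gamma> / 2 - 5/2 * inverse \<rho>\<^sub>2"

definition phi4 :: "real \<Rightarrow> real \<Rightarrow> real" where
  "phi4 \<rho> \<gamma> = 2 * \<rho> * \<gamma>^2 + 1/2 * \<rho>"

definition phi5 :: "real \<Rightarrow> real \<Rightarrow> real \<Rightarrow> real \<Rightarrow> real" where
  "phi5 l \<rho>\<^sub>2 \<beta> \<gamma> = 1/8 - (\<beta> + \<gamma>)^2 / \<gamma>^5 * inverse \<rho>\<^sub>2 * l^2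
     - 1 / (2 * \<gamma>^2) * (inverse \<rho>\<^sub>2)^2 * l^2"

definition phi6 :: "real \<Rightarrow> real \<Rightarrow> real \<Rightarrow> real \<Rightarrow> real" where
  "phi6 l \<rho>\<^sub>2 \<beta> \<gamma> = (\<beta> + \<gamma>) / (2 * \<gamma>^3) * inverse \<rho>\<^sub>2 * l^2
     + 1 / (2 * \<gamma>^2) * (inverse \<rho>\<^sub>2)^2 * l^2 + 1/2 * (inverse \<rho>\<^sub>2)^2 * l^2 + l^2 / 2 + l / 2"

definition phi7 :: "real \<Rightarrow> real \<Rightarrow> real \<Rightarrow> real" where
  "phi7 \<rho> \<beta> \<gamma> = (\<rho> + 1) * \<gamma> + 1/2 * \<rho> * \<beta>"

definition phi8 :: "real \<Rightarrow> real \<Rightarrow> real \<Rightarrow> real \<Rightarrow> real" where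
  "phi8 \<rho> \<rho>\<^sub>2 \<beta> \<gamma> =
     3 * \<rho>^2 * \<beta>^2 + (\<rho> - 2 * \<rho>\<^sub>2) * \<beta> * \<gamma> + (\<rho> + 2) * \<gamma>^2 + 1"

definition kappa0_hat :: "real \<Rightarrow> real \<Rightarrow> real \<Rightarrow> real \<Rightarrow> real \<Rightarrow> real" where
  "kappa0_hat l \<rho> \<rho>\<^sub>2 \<beta> \<gamma> =
     Min {phi1 l \<rho>\<^sub>2 \<beta> \<gamma> / phi2 l \<rho> \<rho>\<^sub>2 \<beta> \<gamma>, phi3 \<rho>\<^sub>2 \<gamma> / phi4 \<rho> \<gamma>,
       phi5 l \<rho>\<^sub>2 \<beta> \<gamma> / phi6 l \<rho>\<^sub>2 \<beta> \<gamma>}"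

text \<open>
  \<open>kappa7\<close> is an upper bound for the step size \<open>\<alpha>\<close>: the first entry of \<open>kappa3\<close> below is the bound on \<open>T\<close>
  that expresses \<open>\<alpha> < kappa7\<close>.  This only makes sense for \<open>kappa7 > 0\<close>, which holds when \<open>\<beta> / \<gamma>\<close> equals
  \<open>kappa1\<close> but can fail for larger \<open>\<beta> / \<gamma>\<close>, because \<open>phi5\<close> may then be negative.
\<close>

definition kappa7 :: "real \<Rightarrow> real \<Rightarrow> real \<Rightarrow> real \<Rightarrow> real \<Rightarrow> real" where
  "kappa7 l \<rho> \<rho>\<^sub>2 \<beta> \<gamma> = min (kappa0_hat l \<rho> \<rho>\<^sub>2 \<beta> \<gamma>) (1 / (2 * l))"

definition eps1 :: "real \<Rightarrow> real \<Rightarrow> real" where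
  "eps1 \<rho>\<^sub>2 \<tau>\<^sub>1 = (\<tau>\<^sub>1 * \<rho>\<^sub>2 - 1) / (2 * \<tau>\<^sub>1 * \<rho>\<^sub>2)"

definition eps5 :: "real \<Rightarrow> real \<Rightarrow> real \<Rightarrow> real" where
  "eps5 \<omega> r \<delta> = \<omega> * r * (\<delta> - \<delta>^2 / 2)"

definition eps8 :: "real \<Rightarrow> real" where
  "eps8 \<epsilon>\<^sub>5 = (\<epsilon>\<^sub>5 + 2 * \<epsilon>\<^sub>5^2) / 2"

definition psi2 :: "real \<Rightarrow> real \<Rightarrow> real \<Rightarrow> real \<Rightarrow> real \<Rightarrow> real" where
  "psi2 \<rho> \<rho>\<^sub>2 \<beta> \<gamma> \<alpha> = phi7 \<rho> \<beta> \<gamma> + \<alpha> * phi8 \<rho> \<rho>\<^sub>2 \<beta> \<gamma>"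

definition psi3 :: "real \<Rightarrow> real \<Rightarrow> real \<Rightarrow> real \<Rightarrow> real" where
  "psi3 \<rho> \<beta> \<epsilon>\<^sub>5 dh = 4 * (1 + inverse \<epsilon>\<^sub>5) * dh^2 * \<beta>^2 * \<rho>^2"

definition psi4 :: "real \<Rightarrow> real \<Rightarrow> real \<Rightarrow> real \<Rightarrow> real \<Rightarrow> real \<Rightarrow> real \<Rightarrow> real" where
  "psi4 l \<rho> \<beta> \<gamma> \<epsilon>\<^sub>1 \<epsilon>\<^sub>5 dh =
     4 * (1 + inverse \<epsilon>\<^sub>5) * dh^2 * max (\<beta>^2 * \<rho>^2 + l^2) (\<gamma>^2 * \<rho>) / \<epsilon>\<^sub>1"

text \<open>\<open>1 - 2 \<epsilon>\<^sub>5\<close> vanishes if \<open>\<omega> r = \<delta> = 1\<close>; then \<open>kappa0\<close> is infinite.\<close>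

definition kappa0 :: "real \<Rightarrow> real \<Rightarrow> real \<Rightarrow> real \<Rightarrow> ereal" where
  "kappa0 \<epsilon>\<^sub>5 \<epsilon>\<^sub>8 \<psi>\<^sub>2 \<psi>\<^sub>4 =
     (if 2 * (1 - 2 * \<epsilon>\<^sub>5) * \<psi>\<^sub>2 * \<psi>\<^sub>4 = 0 then \<infinity>
      else ereal ((\<epsilon>\<^sub>8 / (2 * (1 - 2 * \<epsilon>\<^sub>5) * \<psi>\<^sub>2 * \<psi>\<^sub>4)) powr (1/3)))"

definition kappa3 :: "real \<Rightarrow> nat \<Rightarrow> real \<Rightarrow> real \<Rightarrow> real \<Rightarrow> real \<Rightarrow> real \<Rightarrow> real" where
  "kappa3 \<tau>\<^sub>0 n dt \<kappa>\<^sub>7 \<epsilon>\<^sub>5 \<epsilon>\<^sub>8 \<psi>\<^sub>3 =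
     max (\<tau>\<^sub>0^3 / (real n * dt^2 * \<kappa>\<^sub>7^3))
         (((1 - 2 * \<epsilon>\<^sub>5) * \<psi>\<^sub>3 * \<tau>\<^sub>0^2 / \<epsilon>\<^sub>8) powr (3/2) * real n powr (1/2) * dt)"

definition kappa4 :: "nat \<Rightarrow> real \<Rightarrow> real \<Rightarrow> real \<Rightarrow> real \<Rightarrow> real" where
  "kappa4 n C \<epsilon>\<^sub>8 \<psi>\<^sub>4 L10 = 2 * \<psi>\<^sub>4 * L10 / (C^2 * \<epsilon>\<^sub>8 * real n)"

definition kappa4_tilde ::
    "nat \<Rightarrow> real \<Rightarrow> real \<Rightarrow> real \<Rightarrow> real \<Rightarrow> real \<Rightarrow> real \<Rightarrow> real \<Rightarrow> real \<Rightarrow> nat \<Rightarrow> real" where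
  "kappa4_tilde n dt C \<alpha> \<epsilon>\<^sub>5 \<psi>\<^sub>2 \<psi>\<^sub>4 L10 s0 T =
     \<psi>\<^sub>4 * L10 * \<alpha>^2 / C^2 + (1 - 2 * \<epsilon>\<^sub>5) * \<psi>\<^sub>2 * \<psi>\<^sub>4 * real n * dt^2 * s0^2 * \<alpha>^3 * real T"

end

theory Submission
  imports Defs "HOL-Analysis.Convex" "HOL-Analysis.L2_Norm"
begin

text \<open>
  In the orthonormal eigenbasis of the Laplacian the Lyapunov function splits into a sum of scalar
  quadratic forms, one for each coordinate and each positive eigenvalue, plus a term for the
  consensus direction and the optimality gap.  Its decrease per step is therefore a scalar
  inequality, in which the eigenvalues are coupled only through the Lipschitz bounds on
  the gradients.  The error term of that decrease is the compression error, which is bounded as long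
  as the compressor inputs stay in its ball of radius C; the recursion for the scaling factors is
  exactly what preserves this, given that the Lyapunov function grows at most linearly.  Summing
  the decrease over the iterations gives both bounds.
\<close>

section \<open>Norms\<close>

text \<open>The constants may depend on n only through the initial Lyapunov value divided by n, so
  every estimate is kept proportional to n. The compression error costs at most a multiple of
  \<open>\<alpha> * n * dt\<^sup>2 * (s 0)\<^sup>2\<close> per step, where
  \<open>(s 0)\<^sup>2\<close> is a multiple of \<open>n * \<alpha>\<^sup>2\<close>. The step size
  is the one for which T such costs, divided by n, stay bounded; it also gives the initial value and
  the accumulated errors the same order in the averaged decrease. The consensus direction is the
  obstacle: it has no dissipation, while F is positive there. Since the dual variables sum to zero,
  the shifted dual coordinate in this direction is the averaged gradient up to the factor \<gamma>,
  and its growth can be charged to the decrease of the objective. The contraction of the compressor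
  is spent twice: \<open>1 - 2 * eps8\<close> remains after Young's inequality, one
  \<open>eps8\<close> absorbs the error that re-enters through the update direction, and the other
  one is the decay rate of the scaling factors.\<close>

lemma powr_ge_tangent:
  fixes t r :: real
  assumes "0 \<le> t" "1 \<le> r"
  shows "1 + r * (t - 1) \<le> t powr r"
proof (cases "t = 0")
  case True
  then show ?thesis using assms by simp
next
  case False
  \<comment> \<open>Weighted AM-GM for \<open>t powr r\<close> and 1 with weights 1/r and 1 - 1/r.
    The resulting tangent at 1 is the only convexity fact behind the norm inequalities.\<close>
  have "(t powr r) powr (1 / r) * 1 powr (1 - 1 / r) \<le> 1 / r * t powr r + (1 - 1 / r) * 1"
    by (rule Youngs_inequality_0) (use assms False in auto)
  then have "t \<le> t powr r / r + 1 - 1 / r" using assms by (simp add: powr_powr)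
  then have "r * t \<le> r * (t powr r / r + 1 - 1 / r)" using assms by (intro mult_left_mono) auto
  also have "\<dots> = t powr r + r - 1" using assms by (simp add: field_simps)
  finally show ?thesis by (simp add: algebra_simps)
qed

text \<open>Jensen by tangents: after division by the mean m the two points average to 1, so the
  linear parts of the tangent inequalities at 1 cancel.\<close>

lemma powr_convex_combination:
  fixes a b \<theta> r :: real
  assumes "0 \<le> a" "0 \<le> b" "0 \<le> \<theta>" "\<theta> \<le> 1" "1 \<le> r"
  shows "(\<theta> * a + (1 - \<theta>) * b) powr r \<le> \<theta> * a powr r + (1 - \<theta>) * b powr r"
proof (cases "\<theta> * a + (1 - \<theta>) * b = 0")
  case True
  then show ?thesis using assms by simp
next
  case False
  define m where "m = \<theta> * a + (1 - \<theta>) * b"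
  have m: "0 < m" using assms False by (simp add: m_def less_le)
  have "1 = \<theta> * (1 + r * (a / m - 1)) + (1 - \<theta>) * (1 + r * (b / m - 1))"
  proof -
    have "\<theta> * (a / m) + (1 - \<theta>) * (b / m) = 1" using m by (simp add: m_def flip: add_divide_distrib)
    then have "r * (\<theta> * (a / m) + (1 - \<theta>) * (b / m)) = r" by simp
    then show ?thesis by (simp add: algebra_simps)
  qed
  also have "\<dots> \<le> \<theta> * (a / m) powr r + (1 - \<theta>) * (b / m) powr r"
    using assms m by (intro add_mono mult_left_mono powr_ge_tangent) auto
  also have "\<dots> = (\<theta> * a powr r + (1 - \<theta>) * b powr r) / m powr r"
    using assms m by (simp add: powr_divide add_divide_distrib)
  finally show ?thesis using m by (simp add: field_simps m_def)
qed

section \<open>Minkowski, monotonicity and power-mean inequalities for finite p-norms\<close>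

definition lp_norm :: "real \<Rightarrow> nat \<Rightarrow> (nat \<Rightarrow> real) \<Rightarrow> real" where
  "lp_norm a d h = (\<Sum>i<d. \<bar>h i\<bar> powr a) powr (1 / a)"

lemma lp_norm_nonneg: "0 \<le> lp_norm a d h"
  by (simp add: lp_norm_def)

lemma lp_norm_powr: "0 < a \<Longrightarrow> lp_norm a d h powr a = (\<Sum>i<d. \<bar>h i\<bar> powr a)"
  by (simp add: lp_norm_def powr_powr sum_nonneg)

lemma lp_norm_leI:
  assumes "0 < a" "0 \<le> R" "(\<Sum>i<d. \<bar>h i\<bar> powr a) \<le> R powr a"
  shows "lp_norm a d h \<le> R"
proof -
  have "lp_norm a d h \<le> (R powr a) powr (1 / a)"
    unfolding lp_norm_def using assms by (intro powr_mono2 sum_nonneg) auto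
  then show ?thesis using assms by (simp add: powr_powr)
qed

lemma lp_norm_eq_0:
  assumes "lp_norm a d h = 0" "i < d"
  shows "h i = 0"
proof -
  have "(\<Sum>i<d. \<bar>h i\<bar> powr a) = 0" using assms by (simp add: lp_norm_def)
  then have "\<bar>h i\<bar> powr a = 0" using assms by (subst (asm) sum_nonneg_eq_0_iff) auto
  then show ?thesis by simp
qed

lemma lp_norm_unit_sum:
  assumes "0 < a" "lp_norm a d h \<noteq> 0"
  shows "(\<Sum>i<d. (\<bar>h i\<bar> / lp_norm a d h) powr a) = 1"
proof -
  have "(\<Sum>i<d. (\<bar>h i\<bar> / lp_norm a d h) powr a) = (\<Sum>i<d. \<bar>h i\<bar> powr a) / lp_norm a d h powr a"
    using lp_norm_nonneg[of a d h] by (simp add: powr_divide sum_divide_distrib)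
  then show ?thesis using assms lp_norm_powr[of a d h] by auto
qed

lemma lp_norm_scale:
  assumes "0 < a"
  shows "lp_norm a d (\<lambda>i. c * h i) = \<bar>c\<bar> * lp_norm a d h"
proof -
  have "(\<Sum>i<d. \<bar>c * h i\<bar> powr a) = \<bar>c\<bar> powr a * (\<Sum>i<d. \<bar>h i\<bar> powr a)"
    by (simp add: abs_mult powr_mult sum_distrib_left)
  then show ?thesis using assms by (simp add: lp_norm_def powr_mult powr_powr sum_nonneg)
qed

text \<open>Minkowski by normalization: divided by A + B, the sum is a convex combination of two
  families of unit norm with weights A/(A + B) and B/(A + B). Convexity of the power is applied
  entrywise and the entries are summed.\<close>

lemma lp_norm_triangle:
  assumes a: "1 \<le> a"
  shows "lp_norm a d (\<lambda>i. h i + h' i) \<le> lp_norm a d h + lp_norm a d h'"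
proof (cases "lp_norm a d h = 0 \<or> lp_norm a d h' = 0")
  case True
  then show ?thesis
  proof
    assume 0: "lp_norm a d h = 0"
    then have "lp_norm a d (\<lambda>i. h i + h' i) = lp_norm a d h'"
      by (simp add: lp_norm_def lp_norm_eq_0[OF 0])
    then show ?thesis using 0 by simp
  next
    assume 0: "lp_norm a d h' = 0"
    then have "lp_norm a d (\<lambda>i. h i + h' i) = lp_norm a d h"
      by (simp add: lp_norm_def lp_norm_eq_0[OF 0])
    then show ?thesis using 0 by simp
  qed
next
  case False
  define A B where "A = lp_norm a d h" and "B = lp_norm a d h'"
  have AB: "0 < A" "0 < B"
    using False lp_norm_nonneg[of a d h] lp_norm_nonneg[of a d h'] by (auto simp: A_def B_def)
  define \<theta> where "\<theta> = A / (A + B)"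
  have \<theta>: "0 \<le> \<theta>" "\<theta> \<le> 1" "1 - \<theta> = B / (A + B)" using AB by (auto simp: \<theta>_def field_simps)
  have pointwise: "\<bar>h i + h' i\<bar> powr a \<le> (A + B) powr a * (\<theta> * (\<bar>h i\<bar> / A) powr a + (1 - \<theta>) * (\<bar>h' i\<bar> / B) powr a)" for i
  proof -
    have "(A + B) * (\<theta> * (\<bar>h i\<bar> / A)) = \<bar>h i\<bar>" "(A + B) * ((1 - \<theta>) * (\<bar>h' i\<bar> / B)) = \<bar>h' i\<bar>"
      using AB unfolding \<theta>(3) by (simp_all add: \<theta>_def)
    then have "(A + B) * (\<theta> * (\<bar>h i\<bar> / A) + (1 - \<theta>) * (\<bar>h' i\<bar> / B)) = \<bar>h i\<bar> + \<bar>h' i\<bar>"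
      by (simp only: distrib_left)
    then have "\<bar>h i + h' i\<bar> \<le> (A + B) * (\<theta> * (\<bar>h i\<bar> / A) + (1 - \<theta>) * (\<bar>h' i\<bar> / B))" by simp
    then have "\<bar>h i + h' i\<bar> powr a \<le> ((A + B) * (\<theta> * (\<bar>h i\<bar> / A) + (1 - \<theta>) * (\<bar>h' i\<bar> / B))) powr a"
      using a by (intro powr_mono2) auto
    also have "\<dots> = (A + B) powr a * (\<theta> * (\<bar>h i\<bar> / A) + (1 - \<theta>) * (\<bar>h' i\<bar> / B)) powr a"
      using AB \<theta> by (simp add: powr_mult)
    also have "\<dots> \<le> (A + B) powr a * (\<theta> * (\<bar>h i\<bar> / A) powr a + (1 - \<theta>) * (\<bar>h' i\<bar> / B) powr a)"
      using AB \<theta> a by (intro mult_left_mono powr_convex_combination) auto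
    finally show ?thesis .
  qed
  have "(\<Sum>i<d. \<bar>h i + h' i\<bar> powr a)
      \<le> (\<Sum>i<d. (A + B) powr a * (\<theta> * (\<bar>h i\<bar> / A) powr a + (1 - \<theta>) * (\<bar>h' i\<bar> / B) powr a))"
    by (intro sum_mono pointwise)
  also have "\<dots> = (A + B) powr a * (\<theta> * (\<Sum>i<d. (\<bar>h i\<bar> / A) powr a) + (1 - \<theta>) * (\<Sum>i<d. (\<bar>h' i\<bar> / B) powr a))"
    by (simp add: sum_distrib_left sum.distrib distrib_left mult_ac)
  also have "\<dots> = (A + B) powr a"
    using a False by (simp add: A_def B_def lp_norm_unit_sum)
  finally show ?thesis using a AB by (intro lp_norm_leI) (auto simp: A_def B_def)
qed

text \<open>Scaled to unit a-norm, every entry is at most 1, and raising the exponent can only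
  decrease its power.\<close>

lemma lp_norm_antimono:
  assumes "0 < a" "a \<le> b"
  shows "lp_norm b d h \<le> lp_norm a d h"
proof (cases "lp_norm a d h = 0")
  case True
  then show ?thesis using lp_norm_eq_0[OF True] by (simp add: lp_norm_def)
next
  case False
  define S where "S = lp_norm a d h"
  have S: "0 < S" using False lp_norm_nonneg[of a d h] by (simp add: S_def)
  have le1: "\<bar>h i\<bar> / S \<le> 1" if "i < d" for i
  proof -
    have "(\<bar>h i\<bar> / S) powr a \<le> (\<Sum>i<d. (\<bar>h i\<bar> / S) powr a)"
      using that by (intro member_le_sum) auto
    also have "\<dots> = 1" using lp_norm_unit_sum[OF assms(1) False] by (simp add: S_def)
    finally have "\<not> 1 powr a < (\<bar>h i\<bar> / S) powr a" by simp
    then show ?thesis using assms(1) powr_less_mono2[of a 1 "\<bar>h i\<bar> / S"] by fastforce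
  qed
  have "(\<Sum>i<d. \<bar>h i\<bar> powr b) = S powr b * (\<Sum>i<d. (\<bar>h i\<bar> / S) powr b)"
    using S by (simp add: sum_distrib_left powr_divide)
  also have "\<dots> \<le> S powr b * (\<Sum>i<d. (\<bar>h i\<bar> / S) powr a)"
    using S assms le1 by (intro mult_left_mono sum_mono powr_mono') auto
  also have "\<dots> = S powr b" using lp_norm_unit_sum[OF assms(1) False] by (simp add: S_def)
  finally show ?thesis using assms S by (intro lp_norm_leI) (auto simp: S_def)
qed

text \<open>Jensen for the exponent b/a at the mean M of the a-th powers; the dimension enters
  because M is an average and not a sum.\<close>

lemma lp_norm_power_mean:
  assumes "0 < a" "a \<le> b" "0 < d"
  shows "lp_norm a d h \<le> real d powr (1 / a - 1 / b) * lp_norm b d h"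
proof (cases "lp_norm a d h = 0")
  case True
  then show ?thesis by (simp add: lp_norm_nonneg)
next
  case False
  define M where "M = (\<Sum>i<d. \<bar>h i\<bar> powr a) / real d"
  have "0 \<le> (\<Sum>i<d. \<bar>h i\<bar> powr a)" by (simp add: sum_nonneg)
  moreover have "(\<Sum>i<d. \<bar>h i\<bar> powr a) \<noteq> 0" using False by (auto simp: lp_norm_def)
  ultimately have M: "0 < M" "(\<Sum>i<d. \<bar>h i\<bar> powr a) = real d * M" using assms by (auto simp: M_def)
  have "real d = (\<Sum>i<d. 1 + (b / a) * (\<bar>h i\<bar> powr a / M - 1))"
  proof -
    have "(\<Sum>i<d. \<bar>h i\<bar> powr a / M) = real d" using M by (simp flip: sum_divide_distrib)
    then have "(\<Sum>i<d. \<bar>h i\<bar> powr a / M - 1) = 0" by (simp add: sum_subtractf)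
    then show ?thesis by (simp only: sum.distrib flip: sum_distrib_left) simp
  qed
  also have "\<dots> \<le> (\<Sum>i<d. (\<bar>h i\<bar> powr a / M) powr (b / a))"
    using assms M by (intro sum_mono powr_ge_tangent) auto
  also have "\<dots> = (\<Sum>i<d. \<bar>h i\<bar> powr b) / M powr (b / a)"
    using assms M by (simp add: powr_divide powr_powr sum_divide_distrib)
  finally have "real d * M powr (b / a) \<le> (\<Sum>i<d. \<bar>h i\<bar> powr b)" using M by (simp add: field_simps)
  then have "(real d * M powr (b / a)) powr (1 / b) \<le> lp_norm b d h"
    unfolding lp_norm_def using assms by (intro powr_mono2) auto
  then have "real d powr (1 / b) * M powr (1 / a) \<le> lp_norm b d h"
    using assms M by (simp add: powr_mult powr_powr)
  moreover have "lp_norm a d h = real d powr (1 / a) * M powr (1 / a)"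
    using M by (simp add: lp_norm_def powr_mult)
  moreover have "real d powr (1 / a) = real d powr (1 / a - 1 / b) * real d powr (1 / b)"
    using assms by (simp flip: powr_add)
  ultimately show ?thesis by (simp add: mult.assoc mult_left_mono)
qed

section \<open>The Euclidean norm and its comparison with p-norms\<close>

lemma norm2_sq: "z \<in> carrier_vec d \<Longrightarrow> (norm2 z)\<^sup>2 = (\<Sum>a<d. (z $ a)\<^sup>2)"
  by (simp add: norm2_def scalar_prod_def sum_nonneg power2_eq_square lessThan_atLeast0)

lemma norm2_nonneg: "0 \<le> norm2 z"
  by (auto simp: norm2_def scalar_prod_def intro: sum_nonneg)

lemma norm2_eq_L2_set: "z \<in> carrier_vec d \<Longrightarrow> norm2 z = L2_set (\<lambda>a. z $ a) {..<d}"
  unfolding L2_set_def by (simp flip: norm2_sq add: norm2_nonneg)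

lemma norm2_eq_lp_norm: "z \<in> carrier_vec d \<Longrightarrow> norm2 z = lp_norm 2 d (\<lambda>a. z $ a)"
  by (simp add: norm2_eq_L2_set L2_set_def lp_norm_def powr_half_sqrt sum_nonneg)

lemma norm2_scale: "norm2 (c \<cdot>\<^sub>v z) = \<bar>c\<bar> * norm2 z"
  by (simp add: norm2_def real_sqrt_mult)

lemma scalar_prod_le_norm2:
  assumes "z \<in> carrier_vec d" "w \<in> carrier_vec d"
  shows "z \<bullet> w \<le> norm2 z * norm2 w"
proof -
  have "z \<bullet> w \<le> (\<Sum>a<d. \<bar>z $ a\<bar> * \<bar>w $ a\<bar>)"
    using assms by (auto simp: scalar_prod_def lessThan_atLeast0 simp flip: abs_mult intro!: sum_mono)
  also have "\<dots> \<le> norm2 z * norm2 w"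
    using assms by (simp add: norm2_eq_L2_set L2_set_mult_ineq)
  finally show ?thesis .
qed

lemma pnorm_cases:
  assumes "1 \<le> p"
  obtains a where "1 \<le> a" "p = ereal a" | "p = \<infinity>"
  using assms by (cases p) auto

lemma pnorm_ereal: "z \<in> carrier_vec d \<Longrightarrow> pnorm (ereal a) z = lp_norm a d (\<lambda>i. z $ i)"
  by (simp add: pnorm_def lp_norm_def)

lemma pnorm_infinity_le:
  assumes "z \<in> carrier_vec d" "0 < d"
  shows "pnorm \<infinity> z \<le> R \<longleftrightarrow> (\<forall>i<d. \<bar>z $ i\<bar> \<le> R)"
proof -
  have "{..<d} \<noteq> {}" using assms(2) by auto
  then show ?thesis using assms(1) by (auto simp: pnorm_def)
qed

lemma pnorm_nonneg:
  assumes "1 \<le> p" "z \<in> carrier_vec d" "0 < d"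
  shows "0 \<le> pnorm p z"
  using assms(1)
proof (cases rule: pnorm_cases)
  case 2
  then have "\<bar>z $ 0\<bar> \<le> pnorm p z" using pnorm_infinity_le[OF assms(2,3), of "pnorm p z"] assms(3) by auto
  then show ?thesis by linarith
qed (use assms in \<open>simp add: pnorm_ereal lp_norm_nonneg\<close>)

lemma pnorm_triangle:
  assumes p: "1 \<le> p" and z: "z \<in> carrier_vec d" "w \<in> carrier_vec d" and d: "0 < d"
  shows "pnorm p (z + w) \<le> pnorm p z + pnorm p w"
  using p
proof (cases rule: pnorm_cases)
  case (1 a)
  have "lp_norm a d (\<lambda>i. (z + w) $ i) = lp_norm a d (\<lambda>i. z $ i + w $ i)"
    using z by (simp add: lp_norm_def)
  then show ?thesis using 1 z lp_norm_triangle[of a d "\<lambda>i. z $ i" "\<lambda>i. w $ i"]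
    by (simp add: pnorm_ereal[of _ d])
next
  case 2
  have "\<bar>z $ i\<bar> \<le> pnorm \<infinity> z" "\<bar>w $ i\<bar> \<le> pnorm \<infinity> w" if "i < d" for i
    using pnorm_infinity_le[OF z(1) d] pnorm_infinity_le[OF z(2) d] that by blast+
  then have "\<bar>z $ i + w $ i\<bar> \<le> pnorm \<infinity> z + pnorm \<infinity> w" if "i < d" for i
    using that by (fastforce intro: order.trans[OF abs_triangle_ineq] add_mono)
  then have "\<bar>(z + w) $ i\<bar> \<le> pnorm \<infinity> z + pnorm \<infinity> w" if "i < d" for i
    using z that by simp
  then show ?thesis using z d 2 by (simp add: pnorm_infinity_le[of _ d])
qed

lemma pnorm_scale_le:
  assumes p: "1 \<le> p" and z: "z \<in> carrier_vec d" and d: "0 < d"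
  shows "pnorm p (c \<cdot>\<^sub>v z) \<le> \<bar>c\<bar> * pnorm p z"
  using p
proof (cases rule: pnorm_cases)
  case (1 a)
  have "lp_norm a d (\<lambda>i. (c \<cdot>\<^sub>v z) $ i) = lp_norm a d (\<lambda>i. c * z $ i)"
    using z by (simp add: lp_norm_def)
  then show ?thesis using 1 z by (simp add: pnorm_ereal lp_norm_scale)
next
  case 2
  have "\<bar>z $ i\<bar> \<le> pnorm \<infinity> z" if "i < d" for i
    using pnorm_infinity_le[OF z d] that by blast
  then show ?thesis using z d 2
    by (simp add: pnorm_infinity_le[of _ d] abs_mult mult_left_mono)
qed

text \<open>\<open>dhat\<close> and \<open>dtilde\<close> are the two equivalence constants between
  the p-norm and the Euclidean norm. On either side of p = 2, one of the two comparisons is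
  monotonicity with constant 1 and the other one is the power-mean inequality.\<close>

lemma pnorm_le_dhat_norm2:
  assumes p: "1 \<le> p" and z: "z \<in> carrier_vec d" and d: "0 < d"
  shows "pnorm p z \<le> dhat p d * norm2 z"
  using p
proof (cases rule: pnorm_cases)
  case (1 a)
  show ?thesis
  proof (cases "a \<le> 2")
    case True
    then have "dhat p d = real d powr (1 / a - 1/2)" using 1 by (simp add: dhat_def one_ereal_def)
    then show ?thesis using 1 True z d lp_norm_power_mean[of a 2 d "\<lambda>i. z $ i"]
      by (simp add: pnorm_ereal norm2_eq_lp_norm)
  next
    case False
    then have "dhat p d = 1" using 1 by (simp add: dhat_def)
    then show ?thesis using 1 False z lp_norm_antimono[of 2 a d "\<lambda>i. z $ i"]
      by (simp add: pnorm_ereal norm2_eq_lp_norm)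
  qed
next
  case 2
  have "\<bar>z $ i\<bar> \<le> norm2 z" if "i < d" for i
  proof -
    have "(z $ i)\<^sup>2 \<le> (norm2 z)\<^sup>2" unfolding norm2_sq[OF z]
      using that by (intro member_le_sum) auto
    then show ?thesis using norm2_nonneg[of z] by (metis abs_le_square_iff abs_of_nonneg)
  qed
  then show ?thesis using 2 z d by (simp add: pnorm_infinity_le dhat_def)
qed

lemma norm2_le_dtilde_pnorm:
  assumes p: "1 \<le> p" and z: "z \<in> carrier_vec d" and d: "0 < d"
  shows "norm2 z \<le> dtilde p d * pnorm p z"
  using p
proof (cases rule: pnorm_cases)
  case (1 a)
  show ?thesis
  proof (cases "a \<le> 2")
    case True
    then have "dtilde p d = 1" using 1 by (simp add: dtilde_def)
    then show ?thesis using 1 True z lp_norm_antimono[of a 2 d "\<lambda>i. z $ i"]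
      by (simp add: pnorm_ereal norm2_eq_lp_norm)
  next
    case False
    then have "dtilde p d = real d powr (1/2 - 1 / a)" using 1 by (simp add: dtilde_def one_ereal_def)
    then show ?thesis using 1 False z d lp_norm_power_mean[of 2 a d "\<lambda>i. z $ i"]
      by (simp add: pnorm_ereal norm2_eq_lp_norm)
  qed
next
  case 2
  have "(z $ i)\<^sup>2 \<le> (pnorm \<infinity> z)\<^sup>2" if "i < d" for i
    using pnorm_infinity_le[OF z d] that by (metis abs_le_square_iff abs_of_nonneg abs_ge_zero order.trans order.refl)
  then have "(norm2 z)\<^sup>2 \<le> (\<Sum>a<d. (pnorm \<infinity> z)\<^sup>2)"
    unfolding norm2_sq[OF z] by (intro sum_mono) auto
  also have "\<dots> = (sqrt (real d) * pnorm \<infinity> z)\<^sup>2" by (simp add: power_mult_distrib)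
  finally have "norm2 z \<le> sqrt (real d) * pnorm \<infinity> z"
    by (rule power2_le_imp_le) (use pnorm_nonneg[OF p z d] 2 in auto)
  then show ?thesis using 2 by (simp add: dtilde_def powr_half_sqrt)
qed

lemma dhat_pos: "0 < d \<Longrightarrow> 0 < dhat p d"
  by (simp add: dhat_def)

lemma dtilde_pos: "0 < d \<Longrightarrow> 0 < dtilde p d"
  by (simp add: dtilde_def)

section \<open>Gradients\<close>

lemma has_gradient_gradient:
  assumes z: "z \<in> carrier_vec d" and ex: "\<exists>g. has_gradient d f z g"
  shows "has_gradient d f z (gradient d f z)"
  unfolding gradient_def
  using ex has_gradient_unique[OF z] by (auto intro: theI2)

lemma gradient_eqI: "z \<in> carrier_vec d \<Longrightarrow> has_gradient d f z g \<Longrightarrow> gradient d f z = g"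
  unfolding gradient_def using has_gradient_unique by blast

lemma has_gradient_carrier: "has_gradient d f z g \<Longrightarrow> g \<in> carrier_vec d"
  by (simp add: has_gradient_def)

lemma mean_vec_carrier [simp]: "mean_vec d n z \<in> carrier_vec d"
  by (simp add: mean_vec_def lincomb_vec_def)

lemma dim_mean_vec [simp]: "dim_vec (mean_vec d n z) = d"
  by (simp add: mean_vec_def lincomb_vec_def)

lemma mean_vec_index: "a < d \<Longrightarrow> mean_vec d n z $ a = (\<Sum>i<n. z i $ a) / real n"
  by (simp add: mean_vec_def lincomb_vec_def sum_divide_distrib)

lemma mean_vec_scalar_prod:
  assumes "w \<in> carrier_vec d" "\<And>i. i < n \<Longrightarrow> z i \<in> carrier_vec d"
  shows "mean_vec d n z \<bullet> w = (\<Sum>i<n. z i \<bullet> w) / real n"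
proof -
  have "mean_vec d n z \<bullet> w = (\<Sum>a<d. (\<Sum>i<n. z i $ a) / real n * w $ a)"
    using assms(1) by (auto simp: scalar_prod_def lessThan_atLeast0 mean_vec_index intro!: sum.cong)
  also have "\<dots> = (\<Sum>a<d. \<Sum>i<n. z i $ a * w $ a) / real n"
    by (simp add: sum_distrib_right sum_divide_distrib)
  also have "(\<Sum>a<d. \<Sum>i<n. z i $ a * w $ a) = (\<Sum>i<n. z i \<bullet> w)"
    using assms(1) by (subst sum.swap) (simp add: scalar_prod_def lessThan_atLeast0)
  finally show ?thesis .
qed

lemma has_gradient_mean_fun:
  assumes n: "0 < n" and z: "z \<in> carrier_vec d"
    and g: "\<And>i. i < n \<Longrightarrow> has_gradient d (f i) z (g i)"
  shows "has_gradient d (mean_fun n f) z (mean_vec d n g)"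
  unfolding has_gradient_def
proof (intro conjI allI impI)
  fix e :: real assume e: "0 < e"
  have "\<forall>i<n. \<exists>h>0. \<forall>w\<in>carrier_vec d. norm2 (w - z) < h \<longrightarrow>
        \<bar>f i w - f i z - g i \<bullet> (w - z)\<bar> \<le> e * norm2 (w - z)"
    using g e by (auto simp: has_gradient_def)
  then obtain h where h: "\<And>i. i < n \<Longrightarrow> 0 < h i" "\<And>i w. i < n \<Longrightarrow> w \<in> carrier_vec d \<Longrightarrow>
      norm2 (w - z) < h i \<Longrightarrow> \<bar>f i w - f i z - g i \<bullet> (w - z)\<bar> \<le> e * norm2 (w - z)"
    by metis
  have ne: "h ` {..<n} \<noteq> {}" using n by auto
  show "\<exists>h>0. \<forall>w\<in>carrier_vec d. norm2 (w - z) < h \<longrightarrow>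
      \<bar>mean_fun n f w - mean_fun n f z - mean_vec d n g \<bullet> (w - z)\<bar> \<le> e * norm2 (w - z)"
  proof (intro exI[of _ "Min (h ` {..<n})"] conjI ballI impI)
    show "0 < Min (h ` {..<n})" using h(1) ne by (subst Min_gr_iff) auto
    fix w assume w: "w \<in> carrier_vec d" "norm2 (w - z) < Min (h ` {..<n})"
    have lt: "norm2 (w - z) < h i" if "i < n" for i using w(2) ne that by (subst (asm) Min_gr_iff) auto
    have "mean_fun n f w - mean_fun n f z - mean_vec d n g \<bullet> (w - z)
        = (\<Sum>i<n. f i w - f i z - g i \<bullet> (w - z)) / real n"
      using w z g by (subst mean_vec_scalar_prod)
        (auto simp: mean_fun_def sum_subtractf diff_divide_distrib dest: has_gradient_carrier)
    then have "\<bar>mean_fun n f w - mean_fun n f z - mean_vec d n g \<bullet> (w - z)\<bar>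
        \<le> (\<Sum>i<n. \<bar>f i w - f i z - g i \<bullet> (w - z)\<bar>) / real n"
      by (simp add: divide_right_mono sum_abs)
    also have "\<dots> \<le> (\<Sum>i<n. e * norm2 (w - z)) / real n"
      using h(2)[OF _ w(1) lt] by (intro divide_right_mono sum_mono) auto
    also have "\<dots> = e * norm2 (w - z)" using n by simp
    finally show "\<bar>mean_fun n f w - mean_fun n f z - mean_vec d n g \<bullet> (w - z)\<bar> \<le> e * norm2 (w - z)" .
  qed
qed simp

text \<open>Restriction to a line turns the hand-made gradient into an ordinary real derivative, to
  which the one-variable calculus applies.\<close>

lemma has_gradient_line_derivative:
  assumes z: "z \<in> carrier_vec d" and u: "u \<in> carrier_vec d"
    and g: "has_gradient d f (z + t \<cdot>\<^sub>v u) g"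
  shows "((\<lambda>t. f (z + t \<cdot>\<^sub>v u)) has_real_derivative g \<bullet> u) (at t)"
  unfolding DERIV_def
proof (rule LIM_I)
  fix e :: real assume e: "0 < e"
  define N where "N = norm2 u"
  have N: "0 \<le> N" by (simp add: N_def norm2_nonneg)
  \<comment> \<open>The summand 1 keeps the quotient meaningful for u = 0, and the factor 2 makes
    the final inequality strict.\<close>
  define e' where "e' = e / (2 * (N + 1))"
  have "0 < N * e + e * 2" using e N by (intro add_nonneg_pos) auto
  then have e': "0 < e'" "e' * N < e" using e N by (auto simp: e'_def field_simps)
  obtain h where h: "0 < h" "\<And>w. w \<in> carrier_vec d \<Longrightarrow> norm2 (w - (z + t \<cdot>\<^sub>v u)) < h \<Longrightarrow>
      \<bar>f w - f (z + t \<cdot>\<^sub>v u) - g \<bullet> (w - (z + t \<cdot>\<^sub>v u))\<bar> \<le> e' * norm2 (w - (z + t \<cdot>\<^sub>v u))"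
    using g e' by (auto simp: has_gradient_def)
  show "\<exists>s>0. \<forall>x. x \<noteq> 0 \<and> norm (x - 0) < s \<longrightarrow>
      norm ((f (z + (t + x) \<cdot>\<^sub>v u) - f (z + t \<cdot>\<^sub>v u)) / x - g \<bullet> u) < e"
  proof (intro exI[of _ "h / (N + 1)"] conjI allI impI)
    show "0 < h / (N + 1)" using h N by simp
    fix x :: real assume x: "x \<noteq> 0 \<and> norm (x - 0) < h / (N + 1)"
    have diff: "z + (t + x) \<cdot>\<^sub>v u - (z + t \<cdot>\<^sub>v u) = x \<cdot>\<^sub>v u"
      using z u by (intro eq_vecI) (auto simp: algebra_simps)
    have "\<bar>x\<bar> * N \<le> \<bar>x\<bar> * (N + 1)" by (simp add: mult_left_mono)
    also have "\<dots> < h" using x N by (simp add: field_simps)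
    finally have "\<bar>f (z + (t + x) \<cdot>\<^sub>v u) - f (z + t \<cdot>\<^sub>v u) - g \<bullet> (x \<cdot>\<^sub>v u)\<bar> \<le> e' * (\<bar>x\<bar> * N)"
      using h(2)[of "z + (t + x) \<cdot>\<^sub>v u"] z u by (simp add: diff norm2_scale N_def)
    also have "g \<bullet> (x \<cdot>\<^sub>v u) = x * (g \<bullet> u)"
      using u has_gradient_carrier[OF g] by simp
    also have "f (z + (t + x) \<cdot>\<^sub>v u) - f (z + t \<cdot>\<^sub>v u) - x * (g \<bullet> u)
        = x * ((f (z + (t + x) \<cdot>\<^sub>v u) - f (z + t \<cdot>\<^sub>v u)) / x - g \<bullet> u)"
      using x by (simp add: field_simps)
    finally have "\<bar>(f (z + (t + x) \<cdot>\<^sub>v u) - f (z + t \<cdot>\<^sub>v u)) / x - g \<bullet> u\<bar> \<le> e' * N"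
      using x by (simp add: abs_mult mult.left_commute)
    then show "norm ((f (z + (t + x) \<cdot>\<^sub>v u) - f (z + t \<cdot>\<^sub>v u)) / x - g \<bullet> u) < e"
      using e' by simp
  qed
qed

text \<open>The remainder is controlled without integration: along the segment, f minus its linear
  part and minus the quadratic bound has a nonpositive derivative, by Cauchy-Schwarz and the
  Lipschitz condition.\<close>

lemma descent_lemma:
  assumes z: "z \<in> carrier_vec d" and u: "u \<in> carrier_vec d"
    and g: "\<And>w. w \<in> carrier_vec d \<Longrightarrow> has_gradient d f w (g w)"
    and lip: "\<And>w w'. w \<in> carrier_vec d \<Longrightarrow> w' \<in> carrier_vec d \<Longrightarrow> norm2 (g w - g w') \<le> l * norm2 (w - w')"
  shows "f (z + u) \<le> f z + g z \<bullet> u + l / 2 * (norm2 u)\<^sup>2"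
proof -
  define \<phi> where "\<phi> = (\<lambda>t. f (z + t \<cdot>\<^sub>v u) - t * (g z \<bullet> u) - l / 2 * (norm2 u)\<^sup>2 * t\<^sup>2)"
  have "\<phi> 1 \<le> \<phi> 0"
  proof (rule DERIV_nonpos_imp_nonincreasing[of 0 1 \<phi>])
    fix t :: real assume t: "0 \<le> t" "t \<le> 1"
    have c: "z + t \<cdot>\<^sub>v u \<in> carrier_vec d" using z u by simp
    have "(\<phi> has_real_derivative g (z + t \<cdot>\<^sub>v u) \<bullet> u - g z \<bullet> u - l * (norm2 u)\<^sup>2 * t) (at t)"
      unfolding \<phi>_def
      by (auto intro!: derivative_eq_intros has_gradient_line_derivative[OF z u g[OF c]])
    moreover have "g (z + t \<cdot>\<^sub>v u) \<bullet> u - g z \<bullet> u \<le> l * (norm2 u)\<^sup>2 * t"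
    proof -
      have cg: "g (z + t \<cdot>\<^sub>v u) \<in> carrier_vec d" "g z \<in> carrier_vec d"
        using g c z by (auto intro: has_gradient_carrier)
      have "g (z + t \<cdot>\<^sub>v u) \<bullet> u - g z \<bullet> u = (g (z + t \<cdot>\<^sub>v u) - g z) \<bullet> u"
        using cg u by (simp add: minus_scalar_prod_distrib[of _ d])
      also have "\<dots> \<le> norm2 (g (z + t \<cdot>\<^sub>v u) - g z) * norm2 u"
        using cg u by (intro scalar_prod_le_norm2[of _ d]) auto
      also have "\<dots> \<le> l * norm2 (z + t \<cdot>\<^sub>v u - z) * norm2 u"
        using lip[OF c z] by (intro mult_right_mono norm2_nonneg)
      also have "z + t \<cdot>\<^sub>v u - z = t \<cdot>\<^sub>v u" using z u by (intro eq_vecI) auto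
      finally show ?thesis using t by (simp add: norm2_scale power2_eq_square mult_ac)
    qed
    ultimately show "\<exists>D. (\<phi> has_real_derivative D) (at t) \<and> D \<le> 0" by (intro exI conjI) auto
  qed simp
  moreover have "z + 1 \<cdot>\<^sub>v u = z + u" "z + 0 \<cdot>\<^sub>v u = z" using z u by (auto intro!: eq_vecI)
  ultimately show ?thesis by (simp add: \<phi>_def)
qed

section \<open>Spectral coordinates\<close>

text \<open>Entry j of \<open>U\<^sup>T\<close> applied to z. The argument is a function of the
  agent, so that one coordinate of a family of vectors can be inserted directly.\<close>

definition modal :: "nat \<Rightarrow> real mat \<Rightarrow> (nat \<Rightarrow> real) \<Rightarrow> nat \<Rightarrow> real" where
  "modal n U z j = (\<Sum>i<n. U $$ (i, j) * z i)"

lemma modal_add: "modal n U (\<lambda>i. z i + z' i) j = modal n U z j + modal n U z' j"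
  by (simp add: modal_def distrib_left sum.distrib)

lemma modal_diff: "modal n U (\<lambda>i. z i - z' i) j = modal n U z j - modal n U z' j"
  by (simp add: modal_def right_diff_distrib sum_subtractf)

lemma modal_scale: "modal n U (\<lambda>i. c * z i) j = c * modal n U z j"
  by (simp add: modal_def sum_distrib_left mult_ac)

lemma modal_cong: "(\<And>i. i < n \<Longrightarrow> z i = z' i) \<Longrightarrow> modal n U z j = modal n U z' j"
  by (simp add: modal_def)

lemma matrix_diag_entry:
  fixes U :: "real mat"
  assumes U: "U \<in> carrier_mat n n" and "i < n" "k < n"
  shows "(U * mat_diag n m * U\<^sup>T) $$ (i, k) = (\<Sum>j<n. U $$ (i, j) * m j * U $$ (k, j))"
proof -
  have "U * mat_diag n m = mat n n (\<lambda>(i, j). U $$ (i, j) * m j)"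
    by (rule mat_diag_mult_right[OF U])
  then show ?thesis using assms by (simp add: scalar_prod_def lessThan_atLeast0)
qed

lemma modal_parseval:
  assumes U: "U \<in> carrier_mat n n" "U * U\<^sup>T = 1\<^sub>m n"
  shows "(\<Sum>j<n. modal n U z j * modal n U z' j) = (\<Sum>i<n. z i * z' i)"
proof -
  have orth: "(\<Sum>j<n. U $$ (i, j) * U $$ (k, j)) = (if i = k then 1 else 0)" if "i < n" "k < n" for i k
  proof -
    have "(U * U\<^sup>T) $$ (i, k) = (\<Sum>j<n. U $$ (i, j) * U $$ (k, j))"
      using U(1) that by (simp add: scalar_prod_def lessThan_atLeast0)
    then show ?thesis using U(2) that by simp
  qed
  have "(\<Sum>j<n. modal n U z j * modal n U z' j)
      = (\<Sum>j<n. \<Sum>i<n. \<Sum>k<n. z i * z' k * (U $$ (i, j) * U $$ (k, j)))"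
    by (simp add: modal_def sum_product mult_ac)
  also have "\<dots> = (\<Sum>i<n. \<Sum>j<n. \<Sum>k<n. z i * z' k * (U $$ (i, j) * U $$ (k, j)))"
    by (rule sum.swap)
  also have "\<dots> = (\<Sum>i<n. \<Sum>k<n. z i * z' k * (\<Sum>j<n. U $$ (i, j) * U $$ (k, j)))"
    unfolding sum_distrib_left by (intro sum.cong refl sum.swap)
  also have "\<dots> = (\<Sum>i<n. \<Sum>k<n. if k = i then z i * z' k else 0)"
    by (intro sum.cong refl) (auto simp: orth)
  also have "\<dots> = (\<Sum>i<n. z i * z' i)" by simp
  finally show ?thesis .
qed

text \<open>Orthonormality of the columns is used here, that of the rows in
  \<open>modal_parseval\<close>; together they reduce every quadratic form of a matrix diagonalized
  by U to a weighted sum.\<close>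

lemma modal_diagonalizes:
  assumes U: "U \<in> carrier_mat n n" "U\<^sup>T * U = 1\<^sub>m n" and j: "j < n"
  shows "modal n U (\<lambda>i. \<Sum>k<n. (U * mat_diag n m * U\<^sup>T) $$ (i, k) * z k) j = m j * modal n U z j"
proof -
  have orth: "(\<Sum>i<n. U $$ (i, j) * U $$ (i, k)) = (if j = k then 1 else 0)" if "k < n" for k
  proof -
    have "(U\<^sup>T * U) $$ (j, k) = (\<Sum>i<n. U $$ (i, j) * U $$ (i, k))"
      using U(1) j that by (simp add: scalar_prod_def lessThan_atLeast0)
    then show ?thesis using U(2) j that by simp
  qed
  have "(\<Sum>k<n. (U * mat_diag n m * U\<^sup>T) $$ (i, k) * z k) = (\<Sum>h<n. U $$ (i, h) * (m h * modal n U z h))"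
    if "i < n" for i
  proof -
    have "(\<Sum>k<n. (U * mat_diag n m * U\<^sup>T) $$ (i, k) * z k)
        = (\<Sum>k<n. \<Sum>h<n. U $$ (i, h) * (m h * (U $$ (k, h) * z k)))"
      using that by (intro sum.cong refl) (simp add: matrix_diag_entry[OF U(1)] sum_distrib_left mult_ac)
    also have "\<dots> = (\<Sum>h<n. \<Sum>k<n. U $$ (i, h) * (m h * (U $$ (k, h) * z k)))" by (rule sum.swap)
    finally show ?thesis by (simp add: modal_def sum_distrib_left)
  qed
  then have "modal n U (\<lambda>i. \<Sum>k<n. (U * mat_diag n m * U\<^sup>T) $$ (i, k) * z k) j
      = (\<Sum>i<n. U $$ (i, j) * (\<Sum>h<n. U $$ (i, h) * (m h * modal n U z h)))"
    by (subst modal_def) (intro sum.cong refl, simp)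
  also have "\<dots> = (\<Sum>i<n. \<Sum>h<n. (U $$ (i, j) * U $$ (i, h)) * (m h * modal n U z h))"
    by (simp add: sum_distrib_left mult_ac)
  also have "\<dots> = (\<Sum>h<n. \<Sum>i<n. (U $$ (i, j) * U $$ (i, h)) * (m h * modal n U z h))" by (rule sum.swap)
  also have "\<dots> = (\<Sum>h<n. (\<Sum>i<n. U $$ (i, j) * U $$ (i, h)) * (m h * modal n U z h))"
    by (simp add: sum_distrib_right)
  also have "\<dots> = (\<Sum>h<n. if h = j then m h * modal n U z h else 0)"
    by (intro sum.cong refl) (auto simp: orth)
  also have "\<dots> = m j * modal n U z j" using j by simp
  finally show ?thesis .
qed

lemma modal_quadratic_form:
  assumes U: "U \<in> carrier_mat n n" "U * U\<^sup>T = 1\<^sub>m n" "U\<^sup>T * U = 1\<^sub>m n"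
  shows "(\<Sum>i<n. z i * (\<Sum>k<n. (U * mat_diag n m * U\<^sup>T) $$ (i, k) * z' k))
     = (\<Sum>j<n. m j * modal n U z j * modal n U z' j)"
  by (subst modal_parseval[OF U(1,2), symmetric], intro sum.cong refl)
     (simp add: modal_diagonalizes[OF U(1,3)])

text \<open>Connects the numbers in the decomposition with the eigenvalues in terms of which
  \<open>rho\<close> and \<open>rho2\<close> are defined.\<close>

lemma laplacian_eigendecomposition_eigenvalue:
  assumes dec: "laplacian_eigendecomposition n L U lam" and j: "2 \<le> j" "j \<le> n"
  shows "eigenvalue L (lam j)"
proof -
  define m where "m = (\<lambda>j. if j = 0 then 0 else lam (j + 1))"
  have U: "U \<in> carrier_mat n n" "U * U\<^sup>T = 1\<^sub>m n" "U\<^sup>T * U = 1\<^sub>m n" and L: "L = U * mat_diag n m * U\<^sup>T"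
    using dec by (auto simp: laplacian_eigendecomposition_def m_def)
  have j': "j - 1 < n" using j by auto
  have "L *\<^sub>v col U (j - 1) = (U * mat_diag n m * U\<^sup>T) *\<^sub>v col U (j - 1)" by (simp add: L)
  also have "\<dots> = (U * mat_diag n m) *\<^sub>v (U\<^sup>T *\<^sub>v col U (j - 1))"
    using U(1) j' by (intro assoc_mult_mat_vec[of _ n n _ n]) (auto intro: mult_carrier_mat[of _ _ n])
  also have "U\<^sup>T *\<^sub>v col U (j - 1) = col (U\<^sup>T * U) (j - 1)"
    using U(1) j' by (intro eq_vecI) auto
  also have "\<dots> = unit_vec n (j - 1)" using j' by (simp add: U(3))
  also have "(U * mat_diag n m) *\<^sub>v unit_vec n (j - 1) = m (j - 1) \<cdot>\<^sub>v col U (j - 1)"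
    using U(1) j' by (intro eq_vecI) (auto simp: mat_diag_mult_right[OF U(1)])
  \<comment> \<open>Column j - 1 carries \<open>lam j\<close>; the condition 2 \<le> j keeps away
    from the consensus column, where m is 0.\<close>
  also have "m (j - 1) = lam j" using j by (simp add: m_def)
  finally have ev: "L *\<^sub>v col U (j - 1) = lam j \<cdot>\<^sub>v col U (j - 1)" .
  have "col U (j - 1) \<noteq> 0\<^sub>v n"
  proof
    assume "col U (j - 1) = 0\<^sub>v n"
    then have "(U\<^sup>T * U) $$ (j - 1, j - 1) = 0" using U(1) j' by simp
    then show False using U(3) j' by simp
  qed
  moreover have "L \<in> carrier_mat n n" using U(1) by (auto simp: L intro!: mult_carrier_mat[of _ n n _ n])
  ultimately have "eigenvector L (col U (j - 1)) (lam j)"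
    using ev U(1) by (auto simp: eigenvector_def)
  then show ?thesis by (auto simp: eigenvalue_def)
qed

lemma laplacian_eigendecomposition_bounds:
  assumes dec: "laplacian_eigendecomposition n L U lam" and n: "2 \<le> n"
  shows "0 < rho2 L" and "\<And>j. 2 \<le> j \<Longrightarrow> j \<le> n \<Longrightarrow> rho2 L \<le> lam j \<and> lam j \<le> rho L"
proof -
  have L: "L \<in> carrier_mat n n"
    using dec by (auto simp: laplacian_eigendecomposition_def intro!: mult_carrier_mat[of _ n n _ n])
  have pos: "0 < lam j" if "2 \<le> j" "j \<le> n" for j
  proof -
    have "0 < lam 2" "lam 2 \<le> lam j"
      using dec that by (auto simp: laplacian_eigendecomposition_def)
    then show ?thesis by linarith
  qed
  \<comment> \<open>\<open>Min\<close> needs a finite nonempty set: finiteness comes from the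
    spectrum, nonemptiness from \<open>lam 2\<close>, which is present because n is at least
    2.\<close>
  have fin: "finite {e. eigenvalue L e \<and> 0 < e}"
    using card_finite_spectrum(1)[OF L] by (rule rev_finite_subset) (auto simp: spectrum_def)
  have mem: "lam j \<in> {e. eigenvalue L e \<and> 0 < e}" if "2 \<le> j" "j \<le> n" for j
    using laplacian_eigendecomposition_eigenvalue[OF dec that] pos[OF that] by simp
  have "rho2 L \<in> {e. eigenvalue L e \<and> 0 < e}"
    unfolding rho2_def using Min_in[OF fin] mem[of 2] n by blast
  then show "0 < rho2 L" by simp
  fix j assume j: "2 \<le> j" "j \<le> n"
  have "rho2 L \<le> lam j" unfolding rho2_def using Min_le[OF fin mem[OF j]] .
  moreover have "lam j \<le> rho L"
  proof -
    have "eigenvalue (map_mat complex_of_real L) (complex_of_real (lam j))"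
      by (rule of_real_hom.eigenvalue_hom[OF L laplacian_eigendecomposition_eigenvalue[OF dec j]])
    then have "complex_of_real (lam j) \<in> spectrum (map_mat complex_of_real L)"
      by (simp add: spectrum_def)
    then have "norm (complex_of_real (lam j)) \<in> norm ` spectrum (map_mat complex_of_real L)"
      by (rule imageI)
    then have "norm (complex_of_real (lam j)) \<le> spectral_radius (map_mat complex_of_real L)"
      using L n by (intro spectral_radius_mem_max(2)[of _ n]) auto
    then show ?thesis by (simp add: rho_def)
  qed
  ultimately show "rho2 L \<le> lam j \<and> lam j \<le> rho L" ..
qed

lemma modal_mean:
  assumes U: "U \<in> carrier_mat n n" "col U 0 = vec n (\<lambda>_. 1 / sqrt (real n))" and n: "0 < n"
  shows "modal n U z 0 = (\<Sum>i<n. z i) / sqrt (real n)"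
proof -
  have "U $$ (i, 0) = 1 / sqrt (real n)" if "i < n" for i
  proof -
    have "U $$ (i, 0) = col U 0 $ i" using U(1) n that by simp
    then show ?thesis using that by (simp add: U(2))
  qed
  then show ?thesis by (simp add: modal_def sum_divide_distrib)
qed

text \<open>Removing the contribution of the first column from \<open>U * U\<^sup>T = 1\<close>
  subtracts exactly 1/n from every entry. Hence L, E and F are diagonal in one common basis.\<close>

lemma E_mat_eigendecomposition:
  assumes U: "U \<in> carrier_mat n n" "U * U\<^sup>T = 1\<^sub>m n" "col U 0 = vec n (\<lambda>_. 1 / sqrt (real n))" and n: "0 < n"
  shows "E_mat n = U * mat_diag n (\<lambda>j. if j = 0 then 0 else 1) * U\<^sup>T"
proof (rule eq_matI)
  fix i k assume "i < dim_row (U * mat_diag n (\<lambda>j. if j = 0 then 0 else 1) * U\<^sup>T)"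
    "k < dim_col (U * mat_diag n (\<lambda>j. if j = 0 then 0 else 1) * U\<^sup>T)"
  then have ik: "i < n" "k < n" using U(1) by auto
  have q: "U $$ (i, 0) = 1 / sqrt (real n)" if "i < n" for i
  proof -
    have "U $$ (i, 0) = col U 0 $ i" using U(1) n that by simp
    then show ?thesis using that by (simp add: U(3))
  qed
  have "(U * U\<^sup>T) $$ (i, k) = (\<Sum>j<n. U $$ (i, j) * U $$ (k, j))"
    using U(1) ik by (simp add: scalar_prod_def lessThan_atLeast0)
  also have "\<dots> = U $$ (i, 0) * U $$ (k, 0) + (\<Sum>j\<in>{..<n} - {0}. U $$ (i, j) * U $$ (k, j))"
    using n by (subst sum.remove[of _ 0]) auto
  also have "U $$ (i, 0) * U $$ (k, 0) = 1 / real n" using ik q by simp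
  also have "(\<Sum>j\<in>{..<n} - {0}. U $$ (i, j) * U $$ (k, j))
      = (\<Sum>j<n. U $$ (i, j) * (if j = 0 then 0 else 1) * U $$ (k, j))"
    using n by (subst (2) sum.remove[of _ 0]) (auto intro!: sum.cong)
  finally have "(\<Sum>j<n. U $$ (i, j) * (if j = 0 then 0 else 1) * U $$ (k, j)) = (if i = k then 1 else 0) - 1 / real n"
    using ik by (simp add: U(2))
  then show "E_mat n $$ (i, k) = (U * mat_diag n (\<lambda>j. if j = 0 then 0 else 1) * U\<^sup>T) $$ (i, k)"
    using ik by (simp add: matrix_diag_entry[OF U(1)] E_mat_def)
qed (use U(1) in \<open>auto simp: E_mat_def\<close>)

section \<open>Stacked vectors and Kronecker products with the identity\<close>

lemma sum_stack:
  fixes h :: "nat \<Rightarrow> real"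
  shows "(\<Sum>k<n * d. h k) = (\<Sum>i<n. \<Sum>a<d. h (i * d + a))"
proof -
  have "sum h {i * d..<i * d + d} = (\<Sum>a<d. h (i * d + a))" for i
    using sum.shift_bounds_nat_ivl[of h 0 "i * d" d] by (simp add: lessThan_atLeast0 add.commute)
  then show ?thesis by (simp flip: sum.nat_group)
qed

lemma stack_scalar_prod:
  assumes "0 < d"
  shows "stack n d z \<bullet> stack n d z' = (\<Sum>a<d. \<Sum>i<n. z i $ a * z' i $ a)"
proof -
  have "stack n d z \<bullet> stack n d z'
      = (\<Sum>k<n * d. z (k div d) $ (k mod d) * z' (k div d) $ (k mod d))"
    unfolding scalar_prod_def stack_def dim_vec lessThan_atLeast0 by (intro sum.cong) auto
  also have "\<dots> = (\<Sum>i<n. \<Sum>a<d. z i $ a * z' i $ a)"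
    unfolding sum_stack by (intro sum.cong refl) auto
  finally show ?thesis by (subst sum.swap)
qed

text \<open>Entry r of a stack belongs to agent r div d and coordinate r mod d; the identity factor
  retains only the entries with equal remainder, so the matrix acts on each coordinate
  separately.\<close>

lemma kron_mult_stack:
  assumes M: "M \<in> carrier_mat n n" and d: "0 < d"
  shows "kron M (1\<^sub>m d) *\<^sub>v stack n d z = stack n d (\<lambda>i. vec d (\<lambda>a. \<Sum>k<n. M $$ (i, k) * z k $ a))"
proof (rule eq_vecI)
  fix r assume "r < dim_vec (stack n d (\<lambda>i. vec d (\<lambda>a. \<Sum>k<n. M $$ (i, k) * z k $ a)))"
  then have r: "r < n * d" by (simp add: stack_def)
  have rd: "r div d < n" "r mod d < d" using r d by (auto simp: less_mult_imp_div_less)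
  have "(kron M (1\<^sub>m d) *\<^sub>v stack n d z) $ r
      = (\<Sum>k<n * d. M $$ (r div d, k div d) * (if r mod d = k mod d then 1 else 0) * z (k div d) $ (k mod d))"
    using r M rd d by (auto simp: kron_def stack_def scalar_prod_def lessThan_atLeast0 intro!: sum.cong)
  also have "\<dots> = (\<Sum>k<n. \<Sum>a<d. if a = r mod d then M $$ (r div d, k) * z k $ a else 0)"
    unfolding sum_stack by (intro sum.cong refl) auto
  also have "\<dots> = (\<Sum>k<n. M $$ (r div d, k) * z k $ (r mod d))" using rd by simp
  finally show "(kron M (1\<^sub>m d) *\<^sub>v stack n d z) $ r
      = stack n d (\<lambda>i. vec d (\<lambda>a. \<Sum>k<n. M $$ (i, k) * z k $ a)) $ r"
    using r rd by (simp add: stack_def)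
qed (use M in \<open>simp add: kron_def stack_def\<close>)

section \<open>The Lyapunov function along one eigenvector\<close>

text \<open>The share of one coordinate and one positive eigenvalue \<mu> in the Lyapunov function:
  along that eigenvector E has eigenvalue 1 and F has eigenvalue 1/\<mu>. The weight of the F-norm
  is c.\<close>

definition mode_energy :: "real \<Rightarrow> real \<Rightarrow> real \<Rightarrow> real \<Rightarrow> real" where
  "mode_energy c \<mu> x w = x\<^sup>2 / 2 + c * w\<^sup>2 / (2 * \<mu>) + x * w / \<mu>"

lemma young:
  fixes a b t :: real
  assumes "0 < t"
  shows "a * b \<le> t * a\<^sup>2 / 2 + b\<^sup>2 / (2 * t)"
proof -
  have "0 \<le> (t * a - b)\<^sup>2 / (2 * t)" using assms by simp
  also have "\<dots> = t * a\<^sup>2 / 2 + b\<^sup>2 / (2 * t) - a * b"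
    using assms by (simp add: power2_eq_square field_simps)
  finally show ?thesis by simp
qed

lemma young_minus:
  fixes a b t :: real
  assumes "0 < t"
  shows "- (a * b) \<le> t * a\<^sup>2 / 2 + b\<^sup>2 / (2 * t)"
  using young[OF assms, of "-a" b] by simp

lemma mode_descent_identity:
  fixes x w e h D \<alpha> \<beta> \<gamma> \<mu> \<rho> \<rho>\<^sub>2 :: real
  assumes "0 < \<mu>" "0 < \<gamma>"
  defines "u \<equiv> \<beta> * (\<mu> * (x - e)) + \<gamma> * w + h"
  shows "mode_energy ((\<beta> + \<gamma>) / \<gamma>) \<mu> (x - \<alpha> * u) (w + \<alpha> * (\<gamma> * (\<mu> * (x - e)) + D / \<gamma>)) =
     mode_energy ((\<beta> + \<gamma>) / \<gamma>) \<mu> x w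
     + \<alpha> * (- \<beta> * \<mu> * x * (x - e) + \<gamma> * x * (x - e) - x * h - \<gamma> * (w * e) - \<gamma> * w\<^sup>2 / \<mu> - h * (w / \<mu>)
            + (\<beta> + \<gamma>) / \<gamma>\<^sup>2 * (w * D / \<mu>) + x * (D / (\<gamma> * \<mu>)))
     + \<alpha>\<^sup>2 * (u\<^sup>2 / 2 + (\<gamma>\<^sup>2 * \<mu> - \<beta> * \<gamma> * \<mu>) * (x - e)\<^sup>2 / 2 + (x - e) * D
            - (\<gamma> * w) * (\<gamma> * (x - e)) - h * (\<gamma> * (x - e)) - w * (D / \<mu>) - h * (D / (\<gamma> * \<mu>))
            + (\<beta> + \<gamma>) / (2 * \<gamma> ^ 3) * (D\<^sup>2 / \<mu>))"
  using assms(1,2) unfolding u_def mode_energy_def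
  by (simp add: field_simps power2_eq_square power3_eq_cube)

text \<open>Every mixed product of the identity is split by Young's inequality, with parameters such
  that all terms in w are covered by the dissipation \<open>\<gamma> * w\<^sup>2 / \<mu>\<close>;
  therefore no term in w occurs in the increment.\<close>

lemma mode_descent:
  fixes x w e h D \<alpha> \<beta> \<gamma> \<mu> \<rho> \<rho>\<^sub>2 :: real
  assumes \<alpha>: "0 < \<alpha>" and \<gamma>: "0 < \<gamma>" and \<rho>\<^sub>2: "0 < \<rho>\<^sub>2" "\<rho>\<^sub>2 \<le> \<mu>" "\<mu> \<le> \<rho>"
    and \<beta>: "4 * \<gamma> \<le> \<rho>\<^sub>2 * \<beta>" and small: "\<alpha> * phi4 \<rho> \<gamma> \<le> phi3 \<rho>\<^sub>2 \<gamma>"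
  defines "u \<equiv> \<beta> * (\<mu> * (x - e)) + \<gamma> * w + h"
    and "Q1 \<equiv> (\<beta> + \<gamma>)\<^sup>2 / \<gamma>^5 * inverse \<rho>\<^sub>2 + 1 / (2 * \<gamma>\<^sup>2) * (inverse \<rho>\<^sub>2)\<^sup>2"
    and "Q2 \<equiv> (\<beta> + \<gamma>) / (2 * \<gamma>^3) * inverse \<rho>\<^sub>2 + 1 / (2 * \<gamma>\<^sup>2) * (inverse \<rho>\<^sub>2)\<^sup>2
              + 1/2 * (inverse \<rho>\<^sub>2)\<^sup>2 + 1/2"
    and "P \<equiv> 3 * \<rho>\<^sup>2 * \<beta>\<^sup>2 - \<rho> * \<beta> * \<gamma> + (\<rho> + 2) * \<gamma>\<^sup>2 + 1"
  shows "mode_energy ((\<beta> + \<gamma>) / \<gamma>) \<mu> (x - \<alpha> * u) (w + \<alpha> * (\<gamma> * (\<mu> * (x - e)) + D / \<gamma>)) \<le>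
     mode_energy ((\<beta> + \<gamma>) / \<gamma>) \<mu> x w
     + \<alpha> * ((- (\<rho>\<^sub>2 * \<beta> / 2 - 5/4 * \<gamma> - 1) + \<alpha> * P) * x\<^sup>2 + (phi7 \<rho> \<beta> \<gamma> + \<alpha> * P) * e\<^sup>2
            + (1 + 5/2 * \<alpha>) * h\<^sup>2 + (Q1 + \<alpha> * Q2) * D\<^sup>2)"
proof -
  have pos: "0 < \<mu>" "0 < \<rho>" using \<rho>\<^sub>2 by auto
  have \<beta>pos: "0 < \<beta>" proof -
    have "0 < \<rho>\<^sub>2 * \<beta>" using \<beta> \<gamma> by linarith
    then show ?thesis using \<rho>\<^sub>2 by (simp add: zero_less_mult_iff)
  qed
  have inv: "inverse \<mu> \<le> inverse \<rho>\<^sub>2" "0 < inverse \<mu>" using \<rho>\<^sub>2 pos by (auto intro: le_imp_inverse_le)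
  have inv2: "(inverse \<mu>)\<^sup>2 \<le> (inverse \<rho>\<^sub>2)\<^sup>2" using inv by (intro power_mono) auto
  \<comment> \<open>All estimates of w go through this weighted square: \<mu> \<le> \<rho> bounds
    \<open>w\<^sup>2\<close> by it, and the lower bound on \<mu> bounds
    \<open>w\<^sup>2 / \<mu>\<^sup>2\<close>.\<close>
  define m where "m = w\<^sup>2 / \<mu>"
  have m: "0 \<le> m" using pos by (simp add: m_def)
  have w2: "w\<^sup>2 \<le> \<rho> * m"
  proof -
    have "w\<^sup>2 = \<mu> * m" using pos by (simp add: m_def)
    then show ?thesis using \<rho>\<^sub>2(3) m by (simp add: mult_right_mono)
  qed
  have f1: "- \<beta> * \<mu> * x * (x - e) \<le> - (\<rho>\<^sub>2 * \<beta> / 2) * x\<^sup>2 + \<rho> * \<beta> / 2 * e\<^sup>2"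
  proof -
    have "0 \<le> \<beta> * \<mu> / 2 * (x - e)\<^sup>2" using \<beta>pos pos by simp
    also have "\<dots> = \<beta> * \<mu> / 2 * x\<^sup>2 + \<beta> * \<mu> / 2 * e\<^sup>2 - \<beta> * \<mu> * x * e"
      by (simp add: power2_eq_square field_simps)
    finally have "- \<beta> * \<mu> * x * (x - e) \<le> - (\<beta> * \<mu> / 2 * x\<^sup>2) + \<beta> * \<mu> / 2 * e\<^sup>2"
      by (simp add: power2_eq_square field_simps)
    moreover have "\<beta> * \<rho>\<^sub>2 / 2 * x\<^sup>2 \<le> \<beta> * \<mu> / 2 * x\<^sup>2" "\<beta> * \<mu> / 2 * e\<^sup>2 \<le> \<beta> * \<rho> / 2 * e\<^sup>2"
      using \<beta>pos \<rho>\<^sub>2 by (auto intro!: mult_right_mono)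
    ultimately show ?thesis by (simp add: mult.commute)
  qed
  \<comment> \<open>Young with parameter 1/2 gives 5/4 instead of the 3/2 that is built into
    \<open>phi1\<close>; the difference is the surplus \<gamma>/4 in the final decrease.\<close>
  have f2: "\<gamma> * x * (x - e) \<le> 5/4 * \<gamma> * x\<^sup>2 + \<gamma> * e\<^sup>2"
    using mult_left_mono[OF young_minus[of "1/2" x e], of \<gamma>] \<gamma>
    by (simp add: algebra_simps power2_eq_square)
  have f3: "- x * h \<le> x\<^sup>2 / 2 + h\<^sup>2 / 2" using young_minus[of 1 x h] by simp
  have f4: "- \<gamma> * (w * e) \<le> \<gamma> * m / 4 + \<rho> * \<gamma> * e\<^sup>2"
  proof -
    have "\<gamma> * - (w * e) \<le> \<gamma> * (w\<^sup>2 / (4 * \<mu>) + \<mu> * e\<^sup>2)"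
      using young_minus[of "1 / (2 * \<mu>)" w e] pos \<gamma> by (intro mult_left_mono) (auto simp: field_simps)
    moreover have "\<gamma> * \<mu> * e\<^sup>2 \<le> \<gamma> * \<rho> * e\<^sup>2" using \<gamma> \<rho>\<^sub>2 by (intro mult_right_mono) auto
    ultimately show ?thesis by (simp add: m_def algebra_simps)
  qed
  have w2l: "w\<^sup>2 / \<mu>\<^sup>2 \<le> inverse \<rho>\<^sub>2 * m"
  proof -
    have "w\<^sup>2 / \<mu>\<^sup>2 = inverse \<mu> * m" by (simp add: m_def power2_eq_square field_simps)
    then show ?thesis using inv m by (simp add: mult_right_mono)
  qed
  have f5: "- h * (w / \<mu>) \<le> h\<^sup>2 / 2 + inverse \<rho>\<^sub>2 / 2 * m"
    using young_minus[of 1 h "w / \<mu>"] w2l by (simp add: power_divide)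
  \<comment> \<open>The parameter \<gamma>/2 is chosen so that the cost in m is exactly \<gamma>/4;
    together with \<open>f4\<close> this consumes half of the dissipation.\<close>
  have f6: "(\<beta> + \<gamma>) / \<gamma>\<^sup>2 * (w * D / \<mu>) \<le> \<gamma> / 4 * m + (\<beta> + \<gamma>)\<^sup>2 / \<gamma>^5 * inverse \<rho>\<^sub>2 * D\<^sup>2"
  proof -
    have "(\<beta> + \<gamma>) / \<gamma>\<^sup>2 * (w * D / \<mu>) = inverse \<mu> * (w * ((\<beta> + \<gamma>) / \<gamma>\<^sup>2 * D))"
      by (simp add: field_simps)
    also have "\<dots> \<le> inverse \<mu> * (\<gamma> / 2 * w\<^sup>2 / 2 + ((\<beta> + \<gamma>) / \<gamma>\<^sup>2 * D)\<^sup>2 / (2 * (\<gamma> / 2)))"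
      using inv \<gamma> by (intro mult_left_mono young) auto
    also have "\<dots> = \<gamma> / 4 * m + inverse \<mu> * ((\<beta> + \<gamma>)\<^sup>2 / \<gamma>^5 * D\<^sup>2)"
      using \<gamma> pos by (simp add: m_def field_simps power2_eq_square eval_nat_numeral)
    also have "\<dots> \<le> \<gamma> / 4 * m + inverse \<rho>\<^sub>2 * ((\<beta> + \<gamma>)\<^sup>2 / \<gamma>^5 * D\<^sup>2)"
      using inv \<gamma> by (intro add_left_mono mult_right_mono) auto
    finally show ?thesis by (simp add: mult_ac)
  qed
  have Dl: "(D / (\<gamma> * \<mu>))\<^sup>2 \<le> 1 / \<gamma>\<^sup>2 * (inverse \<rho>\<^sub>2)\<^sup>2 * D\<^sup>2"
  proof -
    have "(D / (\<gamma> * \<mu>))\<^sup>2 = (inverse \<mu>)\<^sup>2 * (1 / \<gamma>\<^sup>2 * D\<^sup>2)"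
      by (simp add: field_simps power_mult_distrib)
    also have "\<dots> \<le> (inverse \<rho>\<^sub>2)\<^sup>2 * (1 / \<gamma>\<^sup>2 * D\<^sup>2)" using inv2 by (intro mult_right_mono) auto
    finally show ?thesis by (simp add: mult_ac)
  qed
  have f7: "x * (D / (\<gamma> * \<mu>)) \<le> x\<^sup>2 / 2 + 1 / (2 * \<gamma>\<^sup>2) * (inverse \<rho>\<^sub>2)\<^sup>2 * D\<^sup>2"
    using young[of 1 x "D / (\<gamma> * \<mu>)"] Dl by simp
  have x2: "(x - e)\<^sup>2 \<le> 2 * (x\<^sup>2 + e\<^sup>2)"
    using zero_le_power2[of "x + e"] by (simp add: power2_eq_square algebra_simps)
  have s1: "u\<^sup>2 / 2 \<le> 3/2 * (\<beta> * (\<mu> * (x - e)))\<^sup>2 + 3/2 * \<gamma>\<^sup>2 * w\<^sup>2 + 3/2 * h\<^sup>2"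
  proof -
    have "(a + b + c)\<^sup>2 \<le> 3 * (a\<^sup>2 + b\<^sup>2 + c\<^sup>2)" for a b c :: real
      using zero_le_power2[of "a - b"] zero_le_power2[of "a - c"] zero_le_power2[of "b - c"]
      by (simp add: power2_eq_square algebra_simps)
    from this[of "\<beta> * (\<mu> * (x - e))" "\<gamma> * w" h] show ?thesis
      by (simp add: u_def power_mult_distrib)
  qed
  \<comment> \<open>The contribution of \<open>u\<^sup>2\<close> is combined with the other
    \<open>(x - e)\<^sup>2\<close> term in order to keep the negative part with \<beta> \<gamma>
    \<mu>. Replacing \<mu> by \<rho> is legitimate because \<mu> \<beta> (3 \<mu> \<beta> -
    \<gamma>) is a product of two factors that are nonnegative and increasing in \<mu>, by the lower
    bound on \<beta>.\<close>
  have s2: "(3/2 * \<beta>\<^sup>2 * \<mu>\<^sup>2 + (\<gamma>\<^sup>2 * \<mu> - \<beta> * \<gamma> * \<mu>) / 2) * (x - e)\<^sup>2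
      \<le> (3 * \<rho>\<^sup>2 * \<beta>\<^sup>2 - \<rho> * \<beta> * \<gamma> + \<rho> * \<gamma>\<^sup>2) * (x\<^sup>2 + e\<^sup>2)"
  proof -
    have "4 * \<gamma> \<le> \<mu> * \<beta>" using \<beta> mult_right_mono[OF \<rho>\<^sub>2(2), of \<beta>] \<beta>pos by linarith
    moreover have "\<mu> * \<beta> \<le> \<rho> * \<beta>" using \<rho>\<^sub>2 \<beta>pos by (simp add: mult_right_mono)
    ultimately have b: "0 \<le> 3 * \<mu> * \<beta> - \<gamma>" "3 * \<mu> * \<beta> - \<gamma> \<le> 3 * \<rho> * \<beta> - \<gamma>" using \<gamma> by auto
    have "\<mu> * \<beta> * (3 * \<mu> * \<beta> - \<gamma>) \<le> \<rho> * \<beta> * (3 * \<rho> * \<beta> - \<gamma>)"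
      using b \<beta>pos \<rho>\<^sub>2 pos by (intro mult_mono) auto
    moreover have "\<mu> * \<gamma>\<^sup>2 \<le> \<rho> * \<gamma>\<^sup>2" using \<rho>\<^sub>2 by (simp add: mult_right_mono)
    moreover have "2 * (3/2 * \<beta>\<^sup>2 * \<mu>\<^sup>2 + (\<gamma>\<^sup>2 * \<mu> - \<beta> * \<gamma> * \<mu>) / 2)
        = \<mu> * \<beta> * (3 * \<mu> * \<beta> - \<gamma>) + \<mu> * \<gamma>\<^sup>2"
      by (simp add: power2_eq_square field_simps)
    ultimately have "2 * (3/2 * \<beta>\<^sup>2 * \<mu>\<^sup>2 + (\<gamma>\<^sup>2 * \<mu> - \<beta> * \<gamma> * \<mu>) / 2)
        \<le> 3 * \<rho>\<^sup>2 * \<beta>\<^sup>2 - \<rho> * \<beta> * \<gamma> + \<rho> * \<gamma>\<^sup>2"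
      by (simp add: power2_eq_square algebra_simps)
    moreover have "0 \<le> 3/2 * \<beta>\<^sup>2 * \<mu>\<^sup>2 + (\<gamma>\<^sup>2 * \<mu> - \<beta> * \<gamma> * \<mu>) / 2"
    proof -
      have "0 \<le> \<mu> * \<beta> * (3 * \<mu> * \<beta> - \<gamma>) + \<mu> * \<gamma>\<^sup>2" using b \<beta>pos pos by simp
      then show ?thesis by (simp add: power2_eq_square field_simps)
    qed
    ultimately show ?thesis using mult_left_mono[OF x2, of "3/2 * \<beta>\<^sup>2 * \<mu>\<^sup>2 + (\<gamma>\<^sup>2 * \<mu> - \<beta> * \<gamma> * \<mu>) / 2"]
        mult_right_mono[of "2 * (3/2 * \<beta>\<^sup>2 * \<mu>\<^sup>2 + (\<gamma>\<^sup>2 * \<mu> - \<beta> * \<gamma> * \<mu>) / 2)" _ "x\<^sup>2 + e\<^sup>2"]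
      by (auto simp only: mult.assoc mult.left_commute[of 2] sum_power2_ge_zero intro: order.trans)
  qed
  have s3: "(x - e) * D \<le> (x - e)\<^sup>2 / 2 + D\<^sup>2 / 2" using young[of 1 "x - e" D] by simp
  have s4: "- (\<gamma> * w) * (\<gamma> * (x - e)) \<le> \<gamma>\<^sup>2 * w\<^sup>2 / 2 + \<gamma>\<^sup>2 * (x - e)\<^sup>2 / 2"
    using young_minus[of 1 "\<gamma> * w" "\<gamma> * (x - e)"] by (simp add: power_mult_distrib)
  have s5: "- h * (\<gamma> * (x - e)) \<le> h\<^sup>2 / 2 + \<gamma>\<^sup>2 * (x - e)\<^sup>2 / 2"
    using young_minus[of 1 h "\<gamma> * (x - e)"] by (simp add: power_mult_distrib)
  have s6: "- w * (D / \<mu>) \<le> w\<^sup>2 / 2 + 1/2 * (inverse \<rho>\<^sub>2)\<^sup>2 * D\<^sup>2"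
  proof -
    have "(D / \<mu>)\<^sup>2 = (inverse \<mu>)\<^sup>2 * D\<^sup>2" by (simp add: field_simps)
    also have "\<dots> \<le> (inverse \<rho>\<^sub>2)\<^sup>2 * D\<^sup>2" using inv2 by (intro mult_right_mono) auto
    finally show ?thesis using young_minus[of 1 w "D / \<mu>"] by simp
  qed
  have s7: "- h * (D / (\<gamma> * \<mu>)) \<le> h\<^sup>2 / 2 + 1 / (2 * \<gamma>\<^sup>2) * (inverse \<rho>\<^sub>2)\<^sup>2 * D\<^sup>2"
    using young_minus[of 1 h "D / (\<gamma> * \<mu>)"] Dl by simp
  have s8: "(\<beta> + \<gamma>) / (2 * \<gamma> ^ 3) * (D\<^sup>2 / \<mu>) \<le> (\<beta> + \<gamma>) / (2 * \<gamma>^3) * inverse \<rho>\<^sub>2 * D\<^sup>2"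
  proof -
    have "D\<^sup>2 / \<mu> \<le> inverse \<rho>\<^sub>2 * D\<^sup>2" using inv by (simp add: divide_inverse mult.commute mult_right_mono)
    then show ?thesis using \<beta>pos \<gamma> by (simp only: mult.assoc) (intro mult_left_mono, auto)
  qed
  have first: "- \<beta> * \<mu> * x * (x - e) + \<gamma> * x * (x - e) - x * h - \<gamma> * (w * e) - \<gamma> * w\<^sup>2 / \<mu> - h * (w / \<mu>)
            + (\<beta> + \<gamma>) / \<gamma>\<^sup>2 * (w * D / \<mu>) + x * (D / (\<gamma> * \<mu>)) \<le>
        - (\<rho>\<^sub>2 * \<beta> / 2 - 5/4 * \<gamma> - 1) * x\<^sup>2 + phi7 \<rho> \<beta> \<gamma> * e\<^sup>2 + h\<^sup>2 - phi3 \<rho>\<^sub>2 \<gamma> * m + Q1 * D\<^sup>2" (is "?F \<le> _")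
  proof -
    have "\<gamma> * w\<^sup>2 / \<mu> = \<gamma> * m" by (simp add: m_def)
    \<comment> \<open>The dissipation that remains has coefficient
      \<open>\<gamma> / 2 - inverse \<rho>\<^sub>2 / 2\<close>; it exceeds \<open>phi3\<close> by
      twice \<open>inverse \<rho>\<^sub>2\<close>, and that part is dropped.\<close>
    moreover have "0 \<le> 2 * (inverse \<rho>\<^sub>2 * m)" using m \<rho>\<^sub>2 by simp
    ultimately show ?thesis using f1 f2 f3 f4 f5 f6 f7
      by (simp add: phi7_def phi3_def Q1_def algebra_simps)
  qed
  have second: "u\<^sup>2 / 2 + (\<gamma>\<^sup>2 * \<mu> - \<beta> * \<gamma> * \<mu>) * (x - e)\<^sup>2 / 2 + (x - e) * D
            - (\<gamma> * w) * (\<gamma> * (x - e)) - h * (\<gamma> * (x - e)) - w * (D / \<mu>) - h * (D / (\<gamma> * \<mu>))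
            + (\<beta> + \<gamma>) / (2 * \<gamma> ^ 3) * (D\<^sup>2 / \<mu>) \<le>
        P * x\<^sup>2 + P * e\<^sup>2 + 5/2 * h\<^sup>2 + phi4 \<rho> \<gamma> * m + Q2 * D\<^sup>2" (is "?S \<le> _")
  proof -
    have "(1/2 + \<gamma>\<^sup>2) * (x - e)\<^sup>2 \<le> (1/2 + \<gamma>\<^sup>2) * (2 * (x\<^sup>2 + e\<^sup>2))"
      using x2 by (intro mult_left_mono) auto
    moreover have "(2 * \<gamma>\<^sup>2 + 1/2) * w\<^sup>2 \<le> (2 * \<gamma>\<^sup>2 + 1/2) * (\<rho> * m)"
      using w2 by (intro mult_left_mono) auto
    moreover have "3/2 * (\<beta> * (\<mu> * (x - e)))\<^sup>2 = 3/2 * \<beta>\<^sup>2 * \<mu>\<^sup>2 * (x - e)\<^sup>2"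
      by (simp add: power_mult_distrib)
    ultimately have "?thesis \<longleftrightarrow> True" using s1 s2 s3 s4 s5 s6 s7 s8
      unfolding phi4_def P_def Q2_def
      by (simp add: distrib_right distrib_left left_diff_distrib right_diff_distrib add_divide_distrib diff_divide_distrib mult_ac)
    then show ?thesis by simp
  qed
  \<comment> \<open>The remaining first-order dissipation pays for the second-order multiple of m,
    which removes w from the bound.\<close>
  have "\<alpha> * phi4 \<rho> \<gamma> * m \<le> phi3 \<rho>\<^sub>2 \<gamma> * m" using small m by (rule mult_right_mono)
  then have "?F + \<alpha> * ?S \<le> (- (\<rho>\<^sub>2 * \<beta> / 2 - 5/4 * \<gamma> - 1) + \<alpha> * P) * x\<^sup>2
      + (phi7 \<rho> \<beta> \<gamma> + \<alpha> * P) * e\<^sup>2 + (1 + 5/2 * \<alpha>) * h\<^sup>2 + (Q1 + \<alpha> * Q2) * D\<^sup>2"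
    using first mult_left_mono[OF second, of \<alpha>] \<alpha> by (simp add: algebra_simps)
  from mult_left_mono[OF this, of \<alpha>] show ?thesis
    using \<alpha> unfolding u_def mode_descent_identity[OF pos(1) \<gamma>]
    by (simp add: distrib_left power2_eq_square mult.assoc)
qed

text \<open>Young with parameter \<tau> on the cross term: its w-part cancels \<tau>/2 of the weight
  (\<tau> + 1)/2, and its x-part reduces 1/2 to
  \<open>1/2 - 1 / (2 * \<tau> * \<rho>\<^sub>2)\<close>, which is \<open>eps1\<close>.\<close>

lemma mode_energy_lower:
  assumes "0 < \<rho>\<^sub>2" "\<rho>\<^sub>2 \<le> \<mu>" "0 < \<tau>" "1 < \<tau> * \<rho>\<^sub>2"
  shows "eps1 \<rho>\<^sub>2 \<tau> * (x\<^sup>2 + w\<^sup>2 / \<mu>) \<le> mode_energy (\<tau> + 1) \<mu> x w"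
proof -
  have pos: "0 < \<mu>" using assms by simp
  have "- (x * w) / \<mu> \<le> (x\<^sup>2 / \<tau> + \<tau> * w\<^sup>2) / (2 * \<mu>)"
    using young_minus[of \<tau> w x] assms pos by (simp add: field_simps)
  also have "\<dots> = (1 / (2 * \<tau> * \<mu>)) * x\<^sup>2 + \<tau> / 2 * (w\<^sup>2 / \<mu>)"
    using pos assms by (simp add: field_simps)
  also have "\<dots> \<le> (1 / (2 * \<tau> * \<rho>\<^sub>2)) * x\<^sup>2 + \<tau> / 2 * (w\<^sup>2 / \<mu>)"
    using assms pos by (intro add_right_mono mult_right_mono divide_left_mono mult_left_mono) auto
  finally have *: "- (x * w) / \<mu> \<le> (1 / (2 * \<tau> * \<rho>\<^sub>2)) * x\<^sup>2 + \<tau> / 2 * (w\<^sup>2 / \<mu>)" .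
  have e1: "eps1 \<rho>\<^sub>2 \<tau> = 1/2 - 1 / (2 * \<tau> * \<rho>\<^sub>2)"
    using assms by (simp add: eps1_def field_simps)
  have "1/2 * (w\<^sup>2 / \<mu>) \<ge> eps1 \<rho>\<^sub>2 \<tau> * (w\<^sup>2 / \<mu>)"
    using pos assms by (intro mult_right_mono) (auto simp: e1)
  moreover have "mode_energy (\<tau> + 1) \<mu> x w = x\<^sup>2 / 2 + \<tau> / 2 * (w\<^sup>2 / \<mu>) + 1/2 * (w\<^sup>2 / \<mu>) - (- (x * w) / \<mu>)"
    using pos by (simp add: mode_energy_def field_simps)
  moreover have "eps1 \<rho>\<^sub>2 \<tau> * x\<^sup>2 = x\<^sup>2 / 2 - (1 / (2 * \<tau> * \<rho>\<^sub>2)) * x\<^sup>2"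
    by (simp add: e1 left_diff_distrib)
  ultimately show ?thesis using * unfolding distrib_left by linarith
qed

section \<open>The Lyapunov function of the network\<close>

text \<open>The consensus direction, where the Laplacian vanishes and w moves only with the
  gradients. With no dissipation available, the Young term in w is converted into
  \<open>(\<gamma> * w)\<^sup>2 / 4\<close>, using that \<gamma> times the smallest positive
  eigenvalue is at least 1; this is later a quarter of the squared averaged gradient.\<close>

lemma mode0_growth:
  fixes w D \<alpha> \<beta> \<gamma> \<mu> \<rho>\<^sub>2 :: real
  assumes \<alpha>: "0 < \<alpha>" and \<gamma>: "0 < \<gamma>" and \<beta>: "0 < \<beta>" and \<rho>\<^sub>2: "0 < \<rho>\<^sub>2" "\<rho>\<^sub>2 \<le> \<mu>" "5 \<le> \<gamma> * \<rho>\<^sub>2"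
  defines "Q1 \<equiv> (\<beta> + \<gamma>)\<^sup>2 / \<gamma>^5 * inverse \<rho>\<^sub>2 + 1 / (2 * \<gamma>\<^sup>2) * (inverse \<rho>\<^sub>2)\<^sup>2"
    and "Q2 \<equiv> (\<beta> + \<gamma>) / (2 * \<gamma>^3) * inverse \<rho>\<^sub>2 + 1 / (2 * \<gamma>\<^sup>2) * (inverse \<rho>\<^sub>2)\<^sup>2
              + 1/2 * (inverse \<rho>\<^sub>2)\<^sup>2 + 1/2"
  shows "(\<beta> + \<gamma>) / \<gamma> * (w + \<alpha> * (D / \<gamma>))\<^sup>2 / (2 * \<mu>)
     \<le> (\<beta> + \<gamma>) / \<gamma> * w\<^sup>2 / (2 * \<mu>) + \<alpha> * ((\<gamma> * w)\<^sup>2 / 4 + (Q1 + \<alpha> * Q2) * D\<^sup>2)"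
proof -
  have pos: "0 < \<mu>" using \<rho>\<^sub>2 by simp
  have inv: "inverse \<mu> \<le> inverse \<rho>\<^sub>2" "0 < inverse \<mu>" using \<rho>\<^sub>2 pos by (auto intro: le_imp_inverse_le)
  have "(\<beta> + \<gamma>) / \<gamma>\<^sup>2 * (w * D / \<mu>) = inverse \<mu> * (w * ((\<beta> + \<gamma>) / \<gamma>\<^sup>2 * D))"
    by (simp add: field_simps)
  also have "\<dots> \<le> inverse \<mu> * (\<gamma> / 2 * w\<^sup>2 / 2 + ((\<beta> + \<gamma>) / \<gamma>\<^sup>2 * D)\<^sup>2 / (2 * (\<gamma> / 2)))"
    using inv \<gamma> by (intro mult_left_mono young) auto
  also have "\<dots> = inverse \<mu> * (\<gamma> / 4 * w\<^sup>2 + (\<beta> + \<gamma>)\<^sup>2 / \<gamma>^5 * D\<^sup>2)"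
    using \<gamma> by (simp add: field_simps power2_eq_square eval_nat_numeral)
  also have "\<dots> \<le> inverse \<rho>\<^sub>2 * (\<gamma> / 4 * w\<^sup>2 + (\<beta> + \<gamma>)\<^sup>2 / \<gamma>^5 * D\<^sup>2)"
    using inv \<gamma> by (intro mult_right_mono) auto
  also have "\<dots> = inverse \<rho>\<^sub>2 * (\<gamma> / 4 * w\<^sup>2) + (\<beta> + \<gamma>)\<^sup>2 / \<gamma>^5 * inverse \<rho>\<^sub>2 * D\<^sup>2"
    by (simp add: algebra_simps)
  also have "inverse \<rho>\<^sub>2 * (\<gamma> / 4 * w\<^sup>2) \<le> (\<gamma> * w)\<^sup>2 / 4"
  proof -
    have "\<gamma> * 1 \<le> \<gamma> * (\<gamma> * \<rho>\<^sub>2)" using \<rho>\<^sub>2 \<gamma> by (intro mult_left_mono) auto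
    then have "inverse \<rho>\<^sub>2 * \<gamma> \<le> \<gamma>\<^sup>2" using \<rho>\<^sub>2 by (simp add: field_simps power2_eq_square)
    from mult_right_mono[OF this, of "w\<^sup>2 / 4"] show ?thesis by (simp add: power_mult_distrib)
  qed
  finally have "(\<beta> + \<gamma>) / \<gamma>\<^sup>2 * (w * D / \<mu>) \<le> (\<gamma> * w)\<^sup>2 / 4 + (\<beta> + \<gamma>)\<^sup>2 / \<gamma>^5 * inverse \<rho>\<^sub>2 * D\<^sup>2"
    by simp
  also have "\<dots> \<le> (\<gamma> * w)\<^sup>2 / 4 + Q1 * D\<^sup>2" by (simp add: Q1_def distrib_right)
  finally have first: "(\<beta> + \<gamma>) / \<gamma>\<^sup>2 * (w * D / \<mu>) \<le> (\<gamma> * w)\<^sup>2 / 4 + Q1 * D\<^sup>2" .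
  have "D\<^sup>2 / \<mu> \<le> inverse \<rho>\<^sub>2 * D\<^sup>2"
    using inv by (simp add: divide_inverse mult.commute mult_right_mono)
  then have "(\<beta> + \<gamma>) / (2 * \<gamma> ^ 3) * (D\<^sup>2 / \<mu>) \<le> (\<beta> + \<gamma>) / (2 * \<gamma> ^ 3) * (inverse \<rho>\<^sub>2 * D\<^sup>2)"
    using \<beta> \<gamma> by (intro mult_left_mono) auto
  also have "\<dots> \<le> Q2 * D\<^sup>2" by (simp add: Q2_def distrib_right mult.assoc)
  finally have second: "(\<beta> + \<gamma>) / (2 * \<gamma> ^ 3) * (D\<^sup>2 / \<mu>) \<le> Q2 * D\<^sup>2" .
  have "(\<beta> + \<gamma>) / \<gamma> * (w + \<alpha> * (D / \<gamma>))\<^sup>2 / (2 * \<mu>) = (\<beta> + \<gamma>) / \<gamma> * w\<^sup>2 / (2 * \<mu>)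
      + \<alpha> * ((\<beta> + \<gamma>) / \<gamma>\<^sup>2 * (w * D / \<mu>) + \<alpha> * ((\<beta> + \<gamma>) / (2 * \<gamma> ^ 3) * (D\<^sup>2 / \<mu>)))"
    using \<gamma> pos by (simp add: field_simps power2_eq_square eval_nat_numeral)
  moreover have "\<alpha> * ((\<beta> + \<gamma>) / \<gamma>\<^sup>2 * (w * D / \<mu>) + \<alpha> * ((\<beta> + \<gamma>) / (2 * \<gamma> ^ 3) * (D\<^sup>2 / \<mu>)))
      \<le> \<alpha> * (((\<gamma> * w)\<^sup>2 / 4 + Q1 * D\<^sup>2) + \<alpha> * (Q2 * D\<^sup>2))"
    using first second \<alpha> by (intro mult_left_mono add_mono) auto
  ultimately show ?thesis by (simp add: algebra_simps)
qed

lemma sum_lessThan_split0: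
  fixes h :: "nat \<Rightarrow> real"
  assumes "0 < n"
  shows "(\<Sum>j<n. h j) = h 0 + (\<Sum>j=1..<n. h j)"
  using assms by (simp add: lessThan_atLeast0 sum.atLeast_Suc_lessThan)

lemma index_minus_carrier:
  fixes z w :: "real vec"
  shows "a < d \<Longrightarrow> w \<in> carrier_vec d \<Longrightarrow> (z - w) $ a = z $ a - w $ a"
  by simp

lemma wnorm_sq_smult:
  assumes "M \<in> carrier_mat m m" "z \<in> carrier_vec m"
  shows "wnorm_sq (c \<cdot>\<^sub>m M) z = c * (z \<bullet> (M *\<^sub>v z))"
proof -
  have "(c \<cdot>\<^sub>m M) *\<^sub>v z = c \<cdot>\<^sub>v (M *\<^sub>v z)" using assms by (intro eq_vecI) auto
  then show ?thesis using assms by (simp add: wnorm_sq_def)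
qed

text \<open>Collects what does not depend on the run. The conditions on \<beta> and \<gamma> are the
  consequences of the thresholds \<open>kappa1\<close> and \<open>kappa2\<close> in the form used by
  the estimates, and \<open>fstar\<close> is any lower bound of the objective.\<close>

locale network =
  fixes n d :: nat and L U :: "real mat" and lam :: "nat \<Rightarrow> real"
    and f :: "nat \<Rightarrow> real vec \<Rightarrow> real" and fstar l \<beta> \<gamma> \<rho> \<rho>\<^sub>2 :: real
  assumes n: "2 \<le> n" and d: "0 < d"
    and dec: "laplacian_eigendecomposition n L U lam"
    and lam_extra: "lam 2 \<le> lam (n + 1)" "lam (n + 1) \<le> lam n"
    and \<rho>: "\<rho> = rho L" and \<rho>\<^sub>2: "\<rho>\<^sub>2 = rho2 L"
    and gradients: "\<And>i z. i < n \<Longrightarrow> z \<in> carrier_vec d \<Longrightarrow> \<exists>g. has_gradient d (f i) z g"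
    and lipschitz: "\<And>i z w. i < n \<Longrightarrow> z \<in> carrier_vec d \<Longrightarrow> w \<in> carrier_vec d \<Longrightarrow>
         norm2 (gradient d (f i) z - gradient d (f i) w) \<le> l * norm2 (z - w)"
    and fstar: "\<And>z. z \<in> carrier_vec d \<Longrightarrow> fstar \<le> mean_fun n f z"
    and l: "0 < l" and \<gamma>: "0 < \<gamma>" and \<beta>: "4 * \<gamma> \<le> \<rho>\<^sub>2 * \<beta>" and \<gamma>\<rho>\<^sub>2: "5 \<le> \<gamma> * \<rho>\<^sub>2"
begin

definition coord :: "(nat \<Rightarrow> real vec) \<Rightarrow> nat \<Rightarrow> nat \<Rightarrow> real" where
  "coord z j a = modal n U (\<lambda>i. z i $ a) j"

definition eig :: "nat \<Rightarrow> real" where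
  "eig j = (if j = 0 then 0 else lam (j + 1))"

text \<open>The reciprocals of the eigenvalues of F; they differ from \<open>eig\<close> only in the
  consensus direction, where 0 is replaced so that F is positive definite.\<close>

definition eigF :: "nat \<Rightarrow> real" where
  "eigF j = (if j = 0 then lam (n + 1) else lam (j + 1))"

text \<open>The squared E-seminorm in spectral coordinates: E annihilates the consensus direction,
  hence the sum starts at 1, whereas the F-norm keeps that direction.\<close>

definition sqE :: "(nat \<Rightarrow> real vec) \<Rightarrow> real" where
  "sqE z = (\<Sum>a<d. \<Sum>j=1..<n. (coord z j a)\<^sup>2)"

definition sqF :: "(nat \<Rightarrow> real vec) \<Rightarrow> real" where
  "sqF z = (\<Sum>a<d. \<Sum>j<n. (coord z j a)\<^sup>2 / eigF j)"

definition sqnorm :: "(nat \<Rightarrow> real vec) \<Rightarrow> real" where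
  "sqnorm z = (\<Sum>i<n. (norm2 (z i))\<^sup>2)"

lemma U: "U \<in> carrier_mat n n" "U * U\<^sup>T = 1\<^sub>m n" "U\<^sup>T * U = 1\<^sub>m n"
    "col U 0 = vec n (\<lambda>_. 1 / sqrt (real n))"
  and L_eq: "L = U * mat_diag n eig * U\<^sup>T"
  using dec by (auto simp: laplacian_eigendecomposition_def eig_def[abs_def])

lemma \<rho>\<^sub>2_pos: "0 < \<rho>\<^sub>2"
  using laplacian_eigendecomposition_bounds(1)[OF dec n] by (simp add: \<rho>\<^sub>2)

lemma lam_bounds: "2 \<le> j \<Longrightarrow> j \<le> n + 1 \<Longrightarrow> \<rho>\<^sub>2 \<le> lam j \<and> lam j \<le> \<rho>"
  using laplacian_eigendecomposition_bounds(2)[OF dec n, of j]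
    laplacian_eigendecomposition_bounds(2)[OF dec n, of 2]
    laplacian_eigendecomposition_bounds(2)[OF dec n, of n] lam_extra n
  by (cases "j = n + 1") (auto simp: \<rho> \<rho>\<^sub>2)

lemma \<rho>\<^sub>2_le_\<rho>: "\<rho>\<^sub>2 \<le> \<rho>"
  using lam_bounds[of 2] n by auto

lemma \<rho>_pos: "0 < \<rho>"
  using \<rho>\<^sub>2_pos \<rho>\<^sub>2_le_\<rho> by simp

lemma \<beta>_pos: "0 < \<beta>"
proof -
  have "0 < \<rho>\<^sub>2 * \<beta>" using \<beta> \<gamma> by linarith
  then show ?thesis using \<rho>\<^sub>2_pos by (simp add: zero_less_mult_iff)
qed

lemma eig_bounds: "j \<in> {1..<n} \<Longrightarrow> \<rho>\<^sub>2 \<le> eig j \<and> eig j \<le> \<rho>"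
  using lam_bounds[of "j + 1"] by (simp add: eig_def)

lemma eigF_bounds: "j < n \<Longrightarrow> \<rho>\<^sub>2 \<le> eigF j \<and> eigF j \<le> \<rho>"
  using lam_bounds[of "j + 1"] lam_bounds[of "n + 1"] n by (simp add: eigF_def)

lemma eigF_eq_eig: "0 < j \<Longrightarrow> eigF j = eig j"
  by (simp add: eigF_def eig_def)

lemma sqE_nonneg: "0 \<le> sqE z"
  by (simp add: sqE_def sum_nonneg)

lemma sqF_nonneg: "0 \<le> sqF z"
proof -
  have "0 \<le> eigF j" if "j < n" for j using eigF_bounds[OF that] \<rho>\<^sub>2_pos by simp
  then show ?thesis unfolding sqF_def by (intro sum_nonneg) auto
qed

lemma sqnorm_eq:
  assumes "\<forall>i<n. z i \<in> carrier_vec d"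
  shows "sqnorm z = (\<Sum>a<d. \<Sum>j<n. (coord z j a)\<^sup>2)"
proof -
  have "sqnorm z = (\<Sum>i<n. \<Sum>a<d. (z i $ a)\<^sup>2)"
    unfolding sqnorm_def using assms by (intro sum.cong refl norm2_sq) simp
  also have "\<dots> = (\<Sum>a<d. \<Sum>i<n. z i $ a * z i $ a)"
    by (subst sum.swap) (simp add: power2_eq_square)
  also have "\<dots> = (\<Sum>a<d. \<Sum>j<n. (coord z j a)\<^sup>2)"
    by (simp add: coord_def power2_eq_square modal_parseval[OF U(1,2)])
  finally show ?thesis .
qed

lemma sqnorm_split:
  assumes "\<forall>i<n. z i \<in> carrier_vec d"
  shows "sqnorm z = (\<Sum>a<d. (coord z 0 a)\<^sup>2) + sqE z"
  using sum_lessThan_split0[of n] n by (simp add: sqnorm_eq[OF assms] sqE_def sum.distrib)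

text \<open>The first column is the unit vector along the all-ones vector; the factor sqrt n makes n
  times the squared norm of the mean the consensus part of the joint squared norm.\<close>

lemma coord_0: "a < d \<Longrightarrow> coord z 0 a = sqrt (real n) * mean_vec d n z $ a"
proof -
  assume "a < d"
  then have "coord z 0 a = (real n / sqrt (real n)) * mean_vec d n z $ a"
    using n modal_mean[OF U(1,4)] by (simp add: coord_def mean_vec_index)
  then show ?thesis by (simp add: real_div_sqrt)
qed

lemma sum_coord_0: "(\<Sum>a<d. coord z 0 a * coord z' 0 a) = real n * (mean_vec d n z \<bullet> mean_vec d n z')"
proof -
  have "(\<Sum>a<d. coord z 0 a * coord z' 0 a) = (\<Sum>a<d. real n * (mean_vec d n z $ a * mean_vec d n z' $ a))"
    by (intro sum.cong refl) (simp add: coord_0)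
  also have "\<dots> = real n * (mean_vec d n z \<bullet> mean_vec d n z')"
    by (simp add: scalar_prod_def lessThan_atLeast0 sum_distrib_left)
  finally show ?thesis .
qed

lemma sum_coord_0_sq: "(\<Sum>a<d. (coord z 0 a)\<^sup>2) = real n * (norm2 (mean_vec d n z))\<^sup>2"
  using sum_coord_0[of z z] by (simp add: power2_eq_square[of "coord z 0 _"] norm2_def scalar_prod_def sum_nonneg)

text \<open>Subtracting the mean removes coordinate 0 and changes no other one, the remaining
  columns being orthogonal to constants. This identifies the seminorm with the consensus error to be
  bounded.\<close>

lemma sqE_eq:
  assumes z: "\<forall>i<n. z i \<in> carrier_vec d"
  shows "sqE z = sqnorm (\<lambda>i. z i - mean_vec d n z)"
proof -
  have c: "\<forall>i<n. z i - mean_vec d n z \<in> carrier_vec d" using z by auto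
  have coord0: "coord (\<lambda>i. z i - mean_vec d n z) 0 a = 0" if "a < d" for a
  proof -
    have "(\<Sum>i<n. (z i - mean_vec d n z) $ a) = (\<Sum>i<n. z i $ a - mean_vec d n z $ a)"
      using that by (intro sum.cong refl index_minus_carrier) auto
    also have "\<dots> = 0" using n that by (simp add: sum_subtractf mean_vec_index)
    finally show ?thesis using n by (simp add: coord_def modal_mean[OF U(1,4)])
  qed
  have "sqE (\<lambda>i. z i - mean_vec d n z) = sqE z"
  proof -
    have "coord (\<lambda>i. z i - mean_vec d n z) j a = coord z j a" if a: "a < d" and j: "j \<in> {1..<n}" for a j
    proof -
      have "coord (\<lambda>i. z i - mean_vec d n z) j a = modal n U (\<lambda>i. z i $ a - mean_vec d n z $ a) j"
        unfolding coord_def using a by (intro modal_cong index_minus_carrier) auto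
      also have "\<dots> = coord z j a - mean_vec d n z $ a * modal n U (\<lambda>i. 1) j"
        using modal_scale[of n U "mean_vec d n z $ a" "\<lambda>i. 1" j] by (simp add: modal_diff coord_def)
      also have "modal n U (\<lambda>i. 1) j = 0"
      proof -
        have "(U\<^sup>T * U) $$ (0, j) = (\<Sum>i<n. U $$ (i, 0) * U $$ (i, j))"
          using U(1) j by (simp add: scalar_prod_def lessThan_atLeast0)
        also have "\<dots> = (\<Sum>i<n. (1 / sqrt (real n)) * U $$ (i, j))"
        proof (intro sum.cong refl)
          fix i assume "i \<in> {..<n}"
          then have "U $$ (i, 0) = col U 0 $ i" using U(1) n by simp
          then show "U $$ (i, 0) * U $$ (i, j) = (1 / sqrt (real n)) * U $$ (i, j)"
            using \<open>i \<in> {..<n}\<close> by (simp add: U(4))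
        qed
        finally have "(1 / sqrt (real n)) * (\<Sum>i<n. U $$ (i, j)) = 0"
          using U(3) j by (simp add: sum_distrib_left)
        then show ?thesis using n by (simp add: modal_def)
      qed
      finally show ?thesis by simp
    qed
    then show ?thesis by (simp add: sqE_def)
  qed
  then show ?thesis using sqnorm_split[OF c] coord0 by simp
qed

lemma coord_lincomb:
  assumes "a < d" "j < n"
  shows "coord (\<lambda>i. lincomb_vec d n (\<lambda>k. L $$ (i, k)) z) j a = eig j * coord z j a"
proof -
  have "coord (\<lambda>i. lincomb_vec d n (\<lambda>k. L $$ (i, k)) z) j a
      = modal n U (\<lambda>i. \<Sum>k<n. (U * mat_diag n eig * U\<^sup>T) $$ (i, k) * z k $ a) j"
    using assms(1) by (simp add: coord_def lincomb_vec_def L_eq)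
  then show ?thesis using modal_diagonalizes[OF U(1,3) assms(2)] by (simp add: coord_def)
qed

definition grad :: "nat \<Rightarrow> real vec \<Rightarrow> real vec" where
  "grad i z = gradient d (f i) z"

text \<open>The dual variable measured from its equilibrium: at consensus with y = 0 an agent stays
  at rest exactly if \<gamma> v is minus its gradient.\<close>

definition shifted :: "(nat \<Rightarrow> real vec) \<Rightarrow> (nat \<Rightarrow> real vec) \<Rightarrow> nat \<Rightarrow> real vec" where
  "shifted x v i = v i + (1 / \<gamma>) \<cdot>\<^sub>v grad i (mean_vec d n x)"

lemma grad_has_gradient: "i < n \<Longrightarrow> z \<in> carrier_vec d \<Longrightarrow> has_gradient d (f i) z (grad i z)"
  unfolding grad_def by (rule has_gradient_gradient) (auto intro: gradients)

lemma grad_carrier: "i < n \<Longrightarrow> z \<in> carrier_vec d \<Longrightarrow> grad i z \<in> carrier_vec d"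
  using grad_has_gradient by (blast intro: has_gradient_carrier)

lemma gradient_mean_fun:
  assumes "z \<in> carrier_vec d"
  shows "has_gradient d (mean_fun n f) z (mean_vec d n (\<lambda>i. grad i z))"
    and "gradient d (mean_fun n f) z = mean_vec d n (\<lambda>i. grad i z)"
proof -
  show *: "has_gradient d (mean_fun n f) z (mean_vec d n (\<lambda>i. grad i z))"
    using n assms grad_has_gradient by (intro has_gradient_mean_fun) auto
  show "gradient d (mean_fun n f) z = mean_vec d n (\<lambda>i. grad i z)"
    by (rule gradient_eqI[OF assms *])
qed

lemma sqnorm_grad_diff_le:
  assumes "\<forall>i<n. z i \<in> carrier_vec d" "\<forall>i<n. w i \<in> carrier_vec d"
  shows "sqnorm (\<lambda>i. grad i (z i) - grad i (w i)) \<le> l\<^sup>2 * sqnorm (\<lambda>i. z i - w i)"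
proof -
  have "(norm2 (grad i (z i) - grad i (w i)))\<^sup>2 \<le> l\<^sup>2 * (norm2 (z i - w i))\<^sup>2" if "i < n" for i
    using power_mono[OF lipschitz[OF that assms(1)[rule_format, OF that] assms(2)[rule_format, OF that]] norm2_nonneg, of 2]
    by (simp add: grad_def power_mult_distrib)
  then show ?thesis unfolding sqnorm_def sum_distrib_left by (intro sum_mono) auto
qed

text \<open>Averaging is the projection onto the consensus direction, so n times the squared mean is
  at most the joint squared norm of the gradient differences.\<close>

lemma mean_gradient_lipschitz:
  assumes z: "z \<in> carrier_vec d" and w: "w \<in> carrier_vec d"
  shows "norm2 (mean_vec d n (\<lambda>i. grad i z) - mean_vec d n (\<lambda>i. grad i w)) \<le> l * norm2 (z - w)"
proof -
  let ?h = "\<lambda>i. grad i z - grad i w"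
  have c: "\<forall>i<n. ?h i \<in> carrier_vec d" using grad_carrier z w by auto
  have "mean_vec d n (\<lambda>i. grad i z) - mean_vec d n (\<lambda>i. grad i w) = mean_vec d n ?h"
  proof (rule eq_vecI)
    fix a assume "a < dim_vec (mean_vec d n ?h)"
    then have a: "a < d" by (simp add: mean_vec_def lincomb_vec_def)
    have "(\<Sum>i<n. (grad i z - grad i w) $ a) = (\<Sum>i<n. grad i z $ a - grad i w $ a)"
      using a grad_carrier[OF _ w] by (intro sum.cong refl index_minus_carrier) auto
    then show "(mean_vec d n (\<lambda>i. grad i z) - mean_vec d n (\<lambda>i. grad i w)) $ a = mean_vec d n ?h $ a"
      using a by (simp add: mean_vec_index sum_subtractf diff_divide_distrib
          carrier_vecD[OF mean_vec_carrier])
  qed (simp add: mean_vec_def lincomb_vec_def)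
  moreover have "real n * (norm2 (mean_vec d n ?h))\<^sup>2 \<le> real n * (l * norm2 (z - w))\<^sup>2"
  proof -
    have "real n * (norm2 (mean_vec d n ?h))\<^sup>2 \<le> sqnorm ?h"
      using sqnorm_split[OF c] sqE_nonneg[of ?h] by (simp add: sum_coord_0_sq)
    also have "\<dots> \<le> l\<^sup>2 * sqnorm (\<lambda>i. z - w)"
      using sqnorm_grad_diff_le[of "\<lambda>i. z" "\<lambda>i. w"] z w by simp
    finally show ?thesis by (simp add: sqnorm_def power_mult_distrib mult_ac)
  qed
  ultimately have "(norm2 (mean_vec d n (\<lambda>i. grad i z) - mean_vec d n (\<lambda>i. grad i w)))\<^sup>2
      \<le> (l * norm2 (z - w))\<^sup>2"
    using n by simp
  then show ?thesis
    by (rule power2_le_imp_le) (use l norm2_nonneg[of "z - w"] in simp)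
qed

text \<open>The Lyapunov function without the optimality gap. In the consensus direction only the
  F-norm contributes, since E removes both x and the cross term there.\<close>

definition energy :: "(nat \<Rightarrow> real vec) \<Rightarrow> (nat \<Rightarrow> real vec) \<Rightarrow> real" where
  "energy x w = (\<Sum>a<d. (\<beta> + \<gamma>) / \<gamma> * (coord w 0 a)\<^sup>2 / (2 * eigF 0)
     + (\<Sum>j=1..<n. mode_energy ((\<beta> + \<gamma>) / \<gamma>) (eig j) (coord x j a) (coord w j a)))"

lemma stack_add_smult:
  assumes "\<forall>i<n. z i \<in> carrier_vec d" "\<forall>i<n. w i \<in> carrier_vec d"
  shows "stack n d z + c \<cdot>\<^sub>v stack n d w = stack n d (\<lambda>i. z i + c \<cdot>\<^sub>v w i)"
proof (rule eq_vecI)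
  fix k assume "k < dim_vec (stack n d (\<lambda>i. z i + c \<cdot>\<^sub>v w i))"
  then have k: "k < n * d" by (simp add: stack_def)
  then have "k div d < n" "k mod d < d" using d by (auto simp: less_mult_imp_div_less)
  then show "(stack n d z + c \<cdot>\<^sub>v stack n d w) $ k = stack n d (\<lambda>i. z i + c \<cdot>\<^sub>v w i) $ k"
    using k assms(1)[rule_format, of "k div d"] assms(2)[rule_format, of "k div d"]
    by (simp add: stack_def)
qed (simp add: stack_def)

text \<open>E and F are diagonal in the eigenbasis of L, and the Kronecker factor only repeats this
  for each of the d coordinates; so each of the three quadratic terms becomes a weighted sum of
  products of coordinates.\<close>

lemma lyapunov_eq_energy:
  assumes "\<forall>i<n. x i k \<in> carrier_vec d" "\<forall>i<n. v i k \<in> carrier_vec d"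
  shows "lyapunov n d U lam f fstar \<beta> \<gamma> x v k = energy (\<lambda>i. x i k) (shifted (\<lambda>i. x i k) (\<lambda>i. v i k))
      + real n * (mean_fun n f (mean_vec d n (\<lambda>i. x i k)) - fstar)"
proof -
  let ?x = "\<lambda>i. x i k" and ?v = "\<lambda>i. v i k"
  let ?w = "shifted ?x ?v"
  let ?E = "\<lambda>j::nat. if j = 0 then 0 else 1 :: real"
  let ?F = "\<lambda>j. inverse (eigF j)"
  have E: "E_mat n = U * mat_diag n ?E * U\<^sup>T" using n U by (intro E_mat_eigendecomposition) auto
  have F: "F_mat n U lam = U * mat_diag n ?F * U\<^sup>T"
    unfolding F_mat_def eigF_def by (rule arg_cong[where f = "\<lambda>m. U * mat_diag n m * U\<^sup>T"]) auto
  have M: "U * mat_diag n m * U\<^sup>T \<in> carrier_mat n n" for m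
    using U(1) by (auto intro!: mult_carrier_mat[of _ n n _ n])
  have W: "stack n d ?v + (1 / \<gamma>) \<cdot>\<^sub>v stack n d (\<lambda>i. gradient d (f i) (mean_vec d n ?x)) = stack n d ?w"
    unfolding shifted_def grad_def[symmetric] using assms grad_carrier
    by (intro stack_add_smult) auto
  have quad: "stack n d z \<bullet> (kron (U * mat_diag n m * U\<^sup>T) (1\<^sub>m d) *\<^sub>v stack n d z')
      = (\<Sum>a<d. \<Sum>j<n. m j * coord z j a * coord z' j a)" for z z' m
    unfolding kron_mult_stack[OF M d] stack_scalar_prod[OF d]
    by (simp add: modal_quadratic_form[OF U(1-3)] coord_def)
  define c where "c = (\<beta> + \<gamma>) / \<gamma>"
  have t1: "1/2 * wnorm_sq (kron (E_mat n) (1\<^sub>m d)) (stack n d ?x) = (\<Sum>a<d. \<Sum>j=1..<n. (coord ?x j a)\<^sup>2 / 2)"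
    unfolding wnorm_sq_def E quad using n
    by (simp add: sum_lessThan_split0 power2_eq_square sum_divide_distrib)
  have t2: "1/2 * wnorm_sq (c \<cdot>\<^sub>m kron (F_mat n U lam) (1\<^sub>m d)) (stack n d ?w)
      = (\<Sum>a<d. c * (coord ?w 0 a)\<^sup>2 / (2 * eigF 0)) + (\<Sum>a<d. \<Sum>j=1..<n. c * (coord ?w j a)\<^sup>2 / (2 * eig j))"
  proof -
    have "kron (U * mat_diag n ?F * U\<^sup>T) (1\<^sub>m d) \<in> carrier_mat (n * d) (n * d)"
      using carrier_matD[OF U(1)] by (simp add: kron_def)
    moreover have "stack n d ?w \<in> carrier_vec (n * d)" by (simp add: stack_def)
    ultimately have "1/2 * wnorm_sq (c \<cdot>\<^sub>m kron (F_mat n U lam) (1\<^sub>m d)) (stack n d ?w)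
        = 1/2 * (c * (\<Sum>a<d. \<Sum>j<n. ?F j * coord ?w j a * coord ?w j a))"
      unfolding F quad[symmetric] by (subst wnorm_sq_smult) auto
    also have "\<dots> = (\<Sum>a<d. \<Sum>j<n. c * (coord ?w j a)\<^sup>2 / (2 * eigF j))"
      unfolding sum_distrib_left by (intro sum.cong refl) (simp add: inverse_eq_divide power2_eq_square mult_ac)
    also have "\<dots> = (\<Sum>a<d. c * (coord ?w 0 a)\<^sup>2 / (2 * eigF 0)) + (\<Sum>a<d. \<Sum>j=1..<n. c * (coord ?w j a)\<^sup>2 / (2 * eig j))"
      using n by (simp add: sum_lessThan_split0 sum.distrib eigF_eq_eig)
    finally show ?thesis .
  qed
  define Fw where "Fw = (\<lambda>i. vec d (\<lambda>a. \<Sum>k<n. (U * mat_diag n ?F * U\<^sup>T) $$ (i, k) * ?w k $ a))"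
  have Fw: "kron (F_mat n U lam) (1\<^sub>m d) *\<^sub>v stack n d ?w = stack n d Fw"
    unfolding F Fw_def by (rule kron_mult_stack[OF M d])
  have coord_Fw: "coord Fw j a = inverse (eigF j) * coord ?w j a" if "a < d" "j < n" for a j
    using that modal_diagonalizes[OF U(1,3) that(2), of ?F] by (simp add: coord_def Fw_def)
  have t3: "stack n d ?x \<bullet> (kron (E_mat n) (1\<^sub>m d) *\<^sub>v (kron (F_mat n U lam) (1\<^sub>m d) *\<^sub>v stack n d ?w))
      = (\<Sum>a<d. \<Sum>j=1..<n. coord ?x j a * coord ?w j a / eig j)"
    unfolding Fw E quad using n
    by (simp add: sum_lessThan_split0 coord_Fw eigF_eq_eig divide_inverse mult_ac)
  show ?thesis
    unfolding lyapunov_def Let_def W t1 t2[unfolded c_def] t3 energy_def mode_energy_def sum.distrib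
    by (simp only: ac_simps)
qed

text \<open>A function of two families of vectors instead of a run, so that a single step can be
  studied from arbitrary states.\<close>

definition lyap :: "(nat \<Rightarrow> real vec) \<Rightarrow> (nat \<Rightarrow> real vec) \<Rightarrow> real" where
  "lyap x v = energy x (shifted x v) + real n * (mean_fun n f (mean_vec d n x) - fstar)"

definition lap :: "(nat \<Rightarrow> real vec) \<Rightarrow> nat \<Rightarrow> real vec" where
  "lap z i = lincomb_vec d n (\<lambda>k. L $$ (i, k)) z"

text \<open>The auxiliary y is replaced by the Laplacian of x - e, because the estimates known to
  the neighbours are x minus the compression error e.\<close>

definition direction :: "(nat \<Rightarrow> real vec) \<Rightarrow> (nat \<Rightarrow> real vec) \<Rightarrow> (nat \<Rightarrow> real vec) \<Rightarrow> nat \<Rightarrow> real vec" where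
  "direction x v e i = \<beta> \<cdot>\<^sub>v lap (\<lambda>k. x k - e k) i + \<gamma> \<cdot>\<^sub>v v i + grad i (x i)"

definition deviation :: "(nat \<Rightarrow> real vec) \<Rightarrow> nat \<Rightarrow> real vec" where
  "deviation x i = grad i (x i) - grad i (mean_vec d n x)"

lemma lap_carrier [simp]: "lap z i \<in> carrier_vec d"
  by (simp add: lap_def lincomb_vec_def)

lemma dim_lap [simp]: "dim_vec (lap z i) = d"
  by (simp add: lap_def lincomb_vec_def)

lemma coord_lap:
  assumes "a < d" "j < n" "\<forall>i<n. e i \<in> carrier_vec d"
  shows "coord (lap (\<lambda>k. x k - e k)) j a = eig j * (coord x j a - coord e j a)"
proof -
  have "coord (\<lambda>k. x k - e k) j a = coord x j a - coord e j a"
    unfolding coord_def modal_diff[symmetric] using assms by (intro modal_cong index_minus_carrier) auto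
  then show ?thesis using coord_lincomb[OF assms(1,2)] by (simp add: lap_def[abs_def])
qed

lemma coord_shifted:
  assumes a: "a < d" and x: "\<forall>i<n. x i \<in> carrier_vec d" and v: "\<forall>i<n. v i \<in> carrier_vec d"
  shows "coord (shifted x v) j a = coord v j a + 1 / \<gamma> * coord (\<lambda>i. grad i (mean_vec d n x)) j a"
proof -
  have "coord (shifted x v) j a = modal n U (\<lambda>i. v i $ a + 1 / \<gamma> * grad i (mean_vec d n x) $ a) j"
    unfolding coord_def shifted_def
  proof (rule modal_cong)
    fix i assume i: "i < n"
    show "(v i + (1 / \<gamma>) \<cdot>\<^sub>v grad i (mean_vec d n x)) $ a = v i $ a + 1 / \<gamma> * grad i (mean_vec d n x) $ a"
      using a v[rule_format, OF i] grad_carrier[OF i mean_vec_carrier[of d n x]] by simp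
  qed
  then show ?thesis by (simp only: coord_def modal_add modal_scale)
qed

lemma coord_deviation:
  assumes a: "a < d"
  shows "coord (deviation x) j a = coord (\<lambda>i. grad i (x i)) j a - coord (\<lambda>i. grad i (mean_vec d n x)) j a"
  unfolding coord_def modal_diff[symmetric] deviation_def
  using a grad_carrier by (intro modal_cong index_minus_carrier) auto

lemma direction_carrier:
  assumes "i < n" "\<forall>i<n. x i \<in> carrier_vec d" "\<forall>i<n. v i \<in> carrier_vec d"
  shows "direction x v e i \<in> carrier_vec d"
  using assms grad_carrier by (auto simp: direction_def)

lemma coord_direction:
  assumes a: "a < d" and j: "j < n" and x: "\<forall>i<n. x i \<in> carrier_vec d"
    and v: "\<forall>i<n. v i \<in> carrier_vec d" and e: "\<forall>i<n. e i \<in> carrier_vec d"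
  shows "coord (direction x v e) j a = \<beta> * (eig j * (coord x j a - coord e j a)) + \<gamma> * coord (shifted x v) j a
     + coord (deviation x) j a"
proof -
  have "coord (direction x v e) j a
      = modal n U (\<lambda>i. \<beta> * lap (\<lambda>k. x k - e k) i $ a + \<gamma> * v i $ a + grad i (x i) $ a) j"
    unfolding coord_def
  proof (rule modal_cong)
    fix i assume i: "i < n"
    show "direction x v e i $ a = \<beta> * lap (\<lambda>k. x k - e k) i $ a + \<gamma> * v i $ a + grad i (x i) $ a"
      using a v[rule_format, OF i] grad_carrier[OF i x[rule_format, OF i]]
      by (simp add: direction_def)
  qed
  also have "\<dots> = \<beta> * coord (lap (\<lambda>k. x k - e k)) j a + \<gamma> * coord v j a + coord (\<lambda>i. grad i (x i)) j a"
    by (simp add: coord_def modal_add modal_scale)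
  finally show ?thesis using \<gamma>
    by (simp add: coord_lap[OF a j e] coord_shifted[OF a x v] coord_deviation[OF a] distrib_left)
qed

lemma sqnorm_deviation_le:
  assumes x: "\<forall>i<n. x i \<in> carrier_vec d"
  shows "sqnorm (deviation x) \<le> l\<^sup>2 * sqE x"
  using sqnorm_grad_diff_le[of x "\<lambda>i. mean_vec d n x"] x sqE_eq[OF x]
  by (simp add: deviation_def[abs_def])

lemma deviation_carrier: "i < n \<Longrightarrow> x i \<in> carrier_vec d \<Longrightarrow> deviation x i \<in> carrier_vec d"
  using grad_carrier[of i "x i"] grad_carrier[of i "mean_vec d n x"] by (auto simp: deviation_def)

text \<open>The polynomial with \<open>- \<rho> * \<beta> * \<gamma>\<close> comes from the mode
  estimate, and \<open>phi2\<close> and \<open>phi8\<close> dominate it because the smallest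
  positive eigenvalue is at most \<rho>. Positivity of the denominators turns the bounds on \<alpha>
  by quotients into bounds on products.\<close>

lemma step_constants:
  shows "0 < 3 * \<rho>\<^sup>2 * \<beta>\<^sup>2 - \<rho> * \<beta> * \<gamma> + (\<rho> + 2) * \<gamma>\<^sup>2 + 1" (is "0 < ?P")
    and "3 * \<rho>\<^sup>2 * \<beta>\<^sup>2 - \<rho> * \<beta> * \<gamma> + (\<rho> + 2) * \<gamma>\<^sup>2 + 1 + 5/2 * l\<^sup>2 \<le> phi2 l \<rho> \<rho>\<^sub>2 \<beta> \<gamma>"
    and "3 * \<rho>\<^sup>2 * \<beta>\<^sup>2 - \<rho> * \<beta> * \<gamma> + (\<rho> + 2) * \<gamma>\<^sup>2 + 1 \<le> phi8 \<rho> \<rho>\<^sub>2 \<beta> \<gamma>"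
    and "0 < phi2 l \<rho> \<rho>\<^sub>2 \<beta> \<gamma>" and "0 < phi4 \<rho> \<gamma>" and "0 < phi6 l \<rho>\<^sub>2 \<beta> \<gamma>" and "0 < phi8 \<rho> \<rho>\<^sub>2 \<beta> \<gamma>"
proof -
  have "4 * \<gamma> \<le> \<rho> * \<beta>" using \<beta> mult_right_mono[OF \<rho>\<^sub>2_le_\<rho>, of \<beta>] \<beta>_pos by linarith
  then have "0 \<le> \<rho> * \<beta> * (3 * (\<rho> * \<beta>) - \<gamma>)"
    using \<gamma> \<rho>_pos \<beta>_pos by (intro mult_nonneg_nonneg) auto
  moreover have "0 \<le> (\<rho> + 2) * \<gamma>\<^sup>2" using \<rho>_pos by simp
  ultimately show P: "0 < ?P" by (simp add: power2_eq_square algebra_simps)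
  have "\<rho>\<^sub>2 * \<beta> * \<gamma> \<le> \<rho> * \<beta> * \<gamma>" using \<rho>\<^sub>2_le_\<rho> \<beta>_pos \<gamma> by (intro mult_right_mono) auto
  then show 2: "?P + 5/2 * l\<^sup>2 \<le> phi2 l \<rho> \<rho>\<^sub>2 \<beta> \<gamma>" and 8: "?P \<le> phi8 \<rho> \<rho>\<^sub>2 \<beta> \<gamma>"
    by (simp_all add: phi2_def phi8_def algebra_simps)
  have "0 \<le> 5/2 * l\<^sup>2" by simp
  then show "0 < phi2 l \<rho> \<rho>\<^sub>2 \<beta> \<gamma>" "0 < phi8 \<rho> \<rho>\<^sub>2 \<beta> \<gamma>" using P 2 8 by linarith+
  show "0 < phi4 \<rho> \<gamma>" using \<rho>_pos by (simp add: phi4_def add_nonneg_pos)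
  show "0 < phi6 l \<rho>\<^sub>2 \<beta> \<gamma>"
    using l \<gamma> \<beta>_pos \<rho>\<^sub>2_pos unfolding phi6_def by (intro add_nonneg_pos add_nonneg_nonneg) auto
qed

text \<open>The decrease contains \<open>\<gamma> / 4 * sqE x\<close> on top of the multiple \<open>phi1 - \<alpha> * phi2\<close> of \<^term>\<open>sqE x\<close>,
  which may vanish: without this surplus the rate would not be uniform for step sizes close to their
  upper bound.\<close>

lemma lyap_decrease:
  fixes x v e xn vn :: "nat \<Rightarrow> real vec" and \<alpha> :: real
  assumes x: "\<forall>i<n. x i \<in> carrier_vec d"
    and v: "\<forall>i<n. v i \<in> carrier_vec d" and e: "\<forall>i<n. e i \<in> carrier_vec d"
    and v0: "\<And>a. a < d \<Longrightarrow> (\<Sum>i<n. v i $ a) = 0"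
    and \<alpha>: "0 < \<alpha>" "\<alpha> * phi2 l \<rho> \<rho>\<^sub>2 \<beta> \<gamma> \<le> phi1 l \<rho>\<^sub>2 \<beta> \<gamma>"
      "\<alpha> * phi4 \<rho> \<gamma> \<le> phi3 \<rho>\<^sub>2 \<gamma>" "\<alpha> * phi6 l \<rho>\<^sub>2 \<beta> \<gamma> \<le> phi5 l \<rho>\<^sub>2 \<beta> \<gamma>"
    and xn: "\<And>i. i < n \<Longrightarrow> xn i = x i - \<alpha> \<cdot>\<^sub>v direction x v e i"
    and vn: "\<And>i. i < n \<Longrightarrow> vn i = v i + (\<alpha> * \<gamma>) \<cdot>\<^sub>v lap (\<lambda>k. x k - e k) i"
  shows "lyap xn vn \<le> lyap x v
     - \<alpha> * (\<gamma> / 4 * sqE x + 1/4 * (real n * (norm2 (gradient d (mean_fun n f) (mean_vec d n x)))\<^sup>2))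
     + \<alpha> * psi2 \<rho> \<rho>\<^sub>2 \<beta> \<gamma> \<alpha> * sqnorm e"
proof -
  define G G0 G1 where "G = (\<lambda>i. grad i (x i))" and "G0 = (\<lambda>i. grad i (mean_vec d n x))"
    and "G1 = (\<lambda>i. grad i (mean_vec d n xn))"
  define W where "W = shifted x v"
  define H where "H = deviation x"
  \<comment> \<open>Division by \<alpha> puts the dual increment into the form \<alpha> times a
    direction; \<open>D_le\<close> shows that D stays bounded independently of \<alpha>.\<close>
  define D where "D = (\<lambda>i. (1 / \<alpha>) \<cdot>\<^sub>v (G1 i - G0 i))"
  have Gc: "G i \<in> carrier_vec d" "G0 i \<in> carrier_vec d" "G1 i \<in> carrier_vec d" if "i < n" for i
    using grad_carrier[OF that] x[rule_format, OF that] by (auto simp: G_def G0_def G1_def)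
  have dc: "\<forall>i<n. direction x v e i \<in> carrier_vec d"
    using direction_carrier[OF _ x v] by blast
  have xnc: "\<forall>i<n. xn i \<in> carrier_vec d" and vnc: "\<forall>i<n. vn i \<in> carrier_vec d"
    using xn vn x v dc by auto
  have Dc: "\<forall>i<n. D i \<in> carrier_vec d" using Gc by (auto simp: D_def)
  have Hc: "\<forall>i<n. H i \<in> carrier_vec d"
    using deviation_carrier[of _ x] x by (simp add: H_def)
  have coord_xn: "coord xn j a = coord x j a - \<alpha> * (\<beta> * (eig j * (coord x j a - coord e j a)) + \<gamma> * coord W j a + coord H j a)"
    if a: "a < d" and j: "j < n" for a j
  proof -
    have "coord xn j a = modal n U (\<lambda>i. x i $ a - \<alpha> * direction x v e i $ a) j"
      unfolding coord_def
    proof (rule modal_cong)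
      fix i assume i: "i < n"
      show "xn i $ a = x i $ a - \<alpha> * direction x v e i $ a"
        using xn[OF i] a x[rule_format, OF i] dc[rule_format, OF i] by simp
    qed
    then show ?thesis
      using coord_direction[OF a j x v e] by (simp add: coord_def modal_diff modal_scale W_def H_def)
  qed
  have coord_D: "coord D j a = 1 / \<alpha> * (coord G1 j a - coord G0 j a)" if a: "a < d" for a j
    unfolding coord_def modal_diff[symmetric] modal_scale[symmetric]
  proof (rule modal_cong)
    fix i assume i: "i < n"
    show "D i $ a = 1 / \<alpha> * (G1 i $ a - G0 i $ a)"
      using a Gc[OF i] by (simp add: D_def)
  qed
  have coord_Wn: "coord (shifted xn vn) j a = coord W j a + \<alpha> * (\<gamma> * (eig j * (coord x j a - coord e j a)) + coord D j a / \<gamma>)"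
    if a: "a < d" and j: "j < n" for a j
  proof -
    have "coord vn j a = modal n U (\<lambda>i. v i $ a + (\<alpha> * \<gamma>) * lap (\<lambda>k. x k - e k) i $ a) j"
      unfolding coord_def
    proof (rule modal_cong)
      fix i assume i: "i < n"
      show "vn i $ a = v i $ a + (\<alpha> * \<gamma>) * lap (\<lambda>k. x k - e k) i $ a"
        using vn[OF i] a v[rule_format, OF i] by simp
    qed
    also have "\<dots> = coord v j a + \<alpha> * \<gamma> * (eig j * (coord x j a - coord e j a))"
      using coord_lap[OF a j e, where x = x] by (simp add: coord_def modal_add modal_scale)
    finally have "coord vn j a = coord v j a + \<alpha> * \<gamma> * (eig j * (coord x j a - coord e j a))" .
    moreover have "\<alpha> * (coord D j a / \<gamma>) = 1 / \<gamma> * coord G1 j a - 1 / \<gamma> * coord G0 j a"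
      using \<alpha>(1) \<gamma> unfolding coord_D[OF a] by (simp add: field_simps)
    ultimately show ?thesis
      unfolding coord_shifted[OF a xnc vnc] W_def coord_shifted[OF a x v]
      by (simp add: G0_def G1_def distrib_left mult.assoc)
  qed
  have coord_v0: "coord v 0 a = 0" if "a < d" for a
    using n v0[OF that] by (simp add: coord_def modal_mean[OF U(1,4)])
  \<comment> \<open>This is where the zero sum of the dual variables enters: the growth permitted by
    \<open>mode0_growth\<close> is thereby a multiple of the squared averaged gradient.\<close>
  have W0: "\<gamma> * coord W 0 a = coord G0 0 a" if "a < d" for a
    using \<gamma> coord_v0[OF that] by (simp add: W_def coord_shifted[OF that x v] G0_def)
  have H_coord: "coord H j a = coord G j a - coord G0 j a" if "a < d" for j a
    using coord_deviation[OF that] by (simp add: H_def G_def G0_def)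
  \<comment> \<open>The Laplacian term and the dual variables average out, so the mean performs a
    gradient step with the averaged local gradients, whatever the compression error is.\<close>
  have mean_xn: "mean_vec d n xn = mean_vec d n x + (- \<alpha>) \<cdot>\<^sub>v mean_vec d n G"
  proof (rule eq_vecI)
    fix a assume "a < dim_vec (mean_vec d n x + (- \<alpha>) \<cdot>\<^sub>v mean_vec d n G)"
    then have a: "a < d" by (simp add: mean_vec_def lincomb_vec_def)
    have "coord xn 0 a = coord x 0 a - \<alpha> * coord G 0 a"
      using coord_xn[OF a, of 0] n W0[OF a] H_coord[OF a, of 0] by (simp add: eig_def)
    then have "sqrt (real n) * mean_vec d n xn $ a = sqrt (real n) * (mean_vec d n x $ a - \<alpha> * mean_vec d n G $ a)"
      using a by (simp add: coord_0 algebra_simps)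
    then show "mean_vec d n xn $ a = (mean_vec d n x + (- \<alpha>) \<cdot>\<^sub>v mean_vec d n G) $ a"
      using a n by simp
  qed (simp add: mean_vec_def lincomb_vec_def)
  define S0 SG SH0 where "S0 = (\<Sum>a<d. (coord G0 0 a)\<^sup>2)" and "SG = (\<Sum>a<d. (coord G 0 a)\<^sup>2)"
    and "SH0 = (\<Sum>a<d. (coord H 0 a)\<^sup>2)"
  have S0_eq: "S0 = real n * (norm2 (gradient d (mean_fun n f) (mean_vec d n x)))\<^sup>2"
    by (simp add: S0_def sum_coord_0_sq gradient_mean_fun(2) G0_def)
  have SG_eq: "SG = real n * (norm2 (mean_vec d n G))\<^sup>2"
    by (simp add: SG_def sum_coord_0_sq)
  have f_step: "real n * mean_fun n f (mean_vec d n xn) \<le> real n * mean_fun n f (mean_vec d n x)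
      + \<alpha> * (- 1/2 * S0 - 1/2 * SG + 1/2 * SH0 + l * \<alpha> / 2 * SG)"
  proof -
    have "mean_fun n f (mean_vec d n xn) \<le> mean_fun n f (mean_vec d n x)
        + mean_vec d n G0 \<bullet> ((- \<alpha>) \<cdot>\<^sub>v mean_vec d n G) + l / 2 * (norm2 ((- \<alpha>) \<cdot>\<^sub>v mean_vec d n G))\<^sup>2"
      unfolding mean_xn G0_def
      by (rule descent_lemma[where g = "\<lambda>z. mean_vec d n (\<lambda>i. grad i z)"])
         (auto intro: gradient_mean_fun mean_gradient_lipschitz)
    also have "mean_vec d n G0 \<bullet> ((- \<alpha>) \<cdot>\<^sub>v mean_vec d n G) = - \<alpha> * (mean_vec d n G0 \<bullet> mean_vec d n G)"
      by (rule scalar_prod_smult_distrib[of _ d]) auto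
    finally have "mean_fun n f (mean_vec d n xn) \<le> mean_fun n f (mean_vec d n x)
        - \<alpha> * (mean_vec d n G0 \<bullet> mean_vec d n G) + l / 2 * \<alpha>\<^sup>2 * (norm2 (mean_vec d n G))\<^sup>2"
      by (simp add: norm2_scale power_mult_distrib)
    then have "real n * mean_fun n f (mean_vec d n xn) \<le> real n * (mean_fun n f (mean_vec d n x)
        - \<alpha> * (mean_vec d n G0 \<bullet> mean_vec d n G) + l / 2 * \<alpha>\<^sup>2 * (norm2 (mean_vec d n G))\<^sup>2)"
      by (rule mult_left_mono) simp
    also have "\<dots> = real n * mean_fun n f (mean_vec d n x)
        - \<alpha> * (\<Sum>a<d. coord G0 0 a * coord G 0 a) + l / 2 * \<alpha>\<^sup>2 * SG"
      by (simp add: SG_eq sum_coord_0 algebra_simps)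
    \<comment> \<open>Polarization: the inner product of the two averaged gradients is half the sum
      of their squares minus half the square of their difference, which is the mean of H.\<close>
    also have "(\<Sum>a<d. coord G0 0 a * coord G 0 a) = (\<Sum>a<d. (coord G0 0 a)\<^sup>2 / 2 + (coord G 0 a)\<^sup>2 / 2 - (coord H 0 a)\<^sup>2 / 2)"
      by (intro sum.cong refl) (simp add: H_coord power2_eq_square field_simps)
    also have "\<dots> = S0 / 2 + SG / 2 - SH0 / 2"
      by (simp add: S0_def SG_def SH0_def sum.distrib sum_subtractf sum_divide_distrib)
    finally show ?thesis by (simp add: algebra_simps power2_eq_square)
  qed
  have H_le: "SH0 + sqE H \<le> l\<^sup>2 * sqE x"
    using sqnorm_deviation_le[OF x] sqnorm_split[OF Hc] by (simp add: SH0_def H_def)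
  \<comment> \<open>Consecutive means differ by \<alpha> times the averaged gradient, which cancels
    the division by \<alpha> in D.\<close>
  have D_le: "sqnorm D \<le> l\<^sup>2 * SG"
  proof -
    have "sqnorm D = (1 / \<alpha>)\<^sup>2 * sqnorm (\<lambda>i. G1 i - G0 i)"
      by (simp add: sqnorm_def D_def norm2_scale power_mult_distrib sum_distrib_left power_divide)
    also have "\<dots> \<le> (1 / \<alpha>)\<^sup>2 * (l\<^sup>2 * sqnorm (\<lambda>i. mean_vec d n xn - mean_vec d n x))"
      unfolding G1_def G0_def by (intro mult_left_mono sqnorm_grad_diff_le) auto
    also have "mean_vec d n xn - mean_vec d n x = (- \<alpha>) \<cdot>\<^sub>v mean_vec d n G"
      unfolding mean_xn by (intro eq_vecI) (auto simp: mean_vec_def lincomb_vec_def)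
    also have "(1 / \<alpha>)\<^sup>2 * (l\<^sup>2 * sqnorm (\<lambda>i::nat. (- \<alpha>) \<cdot>\<^sub>v mean_vec d n G)) = l\<^sup>2 * SG"
      using \<alpha>(1) by (simp add: sqnorm_def SG_eq norm2_scale power_mult_distrib power_divide)
    finally show ?thesis .
  qed
  define Q1 where "Q1 = (\<beta> + \<gamma>)\<^sup>2 / \<gamma>^5 * inverse \<rho>\<^sub>2 + 1 / (2 * \<gamma>\<^sup>2) * (inverse \<rho>\<^sub>2)\<^sup>2"
  define Q2 where "Q2 = (\<beta> + \<gamma>) / (2 * \<gamma>^3) * inverse \<rho>\<^sub>2 + 1 / (2 * \<gamma>\<^sup>2) * (inverse \<rho>\<^sub>2)\<^sup>2
              + 1/2 * (inverse \<rho>\<^sub>2)\<^sup>2 + 1/2"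
  define P where "P = 3 * \<rho>\<^sup>2 * \<beta>\<^sup>2 - \<rho> * \<beta> * \<gamma> + (\<rho> + 2) * \<gamma>\<^sup>2 + 1"
  define cx ce ch cd where "cx = - (\<rho>\<^sub>2 * \<beta> / 2 - 5/4 * \<gamma> - 1) + \<alpha> * P"
    and "ce = phi7 \<rho> \<beta> \<gamma> + \<alpha> * P" and "ch = 1 + 5/2 * \<alpha>" and "cd = Q1 + \<alpha> * Q2"
  have energy_step: "energy xn (shifted xn vn) \<le> energy x W
      + \<alpha> * (S0 / 4 + cx * sqE x + ce * sqE e + ch * sqE H + cd * sqnorm D)"
  proof -
    have "energy xn (shifted xn vn) \<le> (\<Sum>a<d.
        ((\<beta> + \<gamma>) / \<gamma> * (coord W 0 a)\<^sup>2 / (2 * eigF 0) + \<alpha> * ((coord G0 0 a)\<^sup>2 / 4 + cd * (coord D 0 a)\<^sup>2))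
        + (\<Sum>j=1..<n. mode_energy ((\<beta> + \<gamma>) / \<gamma>) (eig j) (coord x j a) (coord W j a)
           + \<alpha> * (cx * (coord x j a)\<^sup>2 + ce * (coord e j a)\<^sup>2 + ch * (coord H j a)\<^sup>2 + cd * (coord D j a)\<^sup>2)))"
      unfolding energy_def
    proof (intro sum_mono add_mono)
      fix a assume "a \<in> {..<d}"
      then have a: "a < d" by simp
      have "coord (shifted xn vn) 0 a = coord W 0 a + \<alpha> * (coord D 0 a / \<gamma>)"
        using coord_Wn[OF a, of 0] n by (simp add: eig_def)
      then show "(\<beta> + \<gamma>) / \<gamma> * (coord (shifted xn vn) 0 a)\<^sup>2 / (2 * eigF 0)
          \<le> (\<beta> + \<gamma>) / \<gamma> * (coord W 0 a)\<^sup>2 / (2 * eigF 0) + \<alpha> * ((coord G0 0 a)\<^sup>2 / 4 + cd * (coord D 0 a)\<^sup>2)"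
        unfolding W0[OF a, symmetric] cd_def Q1_def Q2_def
        using mode0_growth[OF \<alpha>(1) \<gamma> \<beta>_pos \<rho>\<^sub>2_pos _ \<gamma>\<rho>\<^sub>2] eigF_bounds[of 0] n by simp
      fix j assume j: "j \<in> {1..<n}"
      then have jn: "j < n" by simp
      show "mode_energy ((\<beta> + \<gamma>) / \<gamma>) (eig j) (coord xn j a) (coord (shifted xn vn) j a)
          \<le> mode_energy ((\<beta> + \<gamma>) / \<gamma>) (eig j) (coord x j a) (coord W j a)
           + \<alpha> * (cx * (coord x j a)\<^sup>2 + ce * (coord e j a)\<^sup>2 + ch * (coord H j a)\<^sup>2 + cd * (coord D j a)\<^sup>2)"
        unfolding coord_xn[OF a jn] coord_Wn[OF a jn] cx_def ce_def ch_def cd_def P_def Q1_def Q2_def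
        using eig_bounds[OF j] by (intro mode_descent[OF \<alpha>(1) \<gamma> \<rho>\<^sub>2_pos _ _ \<beta> \<alpha>(3)]) auto
    qed
    also have "\<dots> = energy x W
      + \<alpha> * (S0 / 4 + cx * sqE x + ce * sqE e + ch * sqE H + cd * ((\<Sum>a<d. (coord D 0 a)\<^sup>2) + sqE D))"
      unfolding energy_def sqE_def S0_def sum.distrib distrib_left sum_distrib_left sum_divide_distrib
      by (simp only: ac_simps)
    finally show ?thesis by (simp add: sqnorm_split[OF Dc])
  qed
  have P_le: "P + 5/2 * l\<^sup>2 \<le> phi2 l \<rho> \<rho>\<^sub>2 \<beta> \<gamma>" "P \<le> phi8 \<rho> \<rho>\<^sub>2 \<beta> \<gamma>"
    using step_constants(2,3) by (simp_all add: P_def)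
  have SG: "0 \<le> SG" "0 \<le> SH0" by (simp_all add: SG_def SH0_def sum_nonneg)
  have Q: "0 \<le> Q1" "0 \<le> Q2" using \<beta>_pos \<gamma> \<rho>\<^sub>2_pos by (simp_all add: Q1_def Q2_def)
  \<comment> \<open>The gradient deviations cost the multiple \<open>l\<^sup>2\<close> of the
    consensus error that is reserved in \<open>phi1\<close> and \<open>phi2\<close>; the gap between
    3/2 and 5/4 in the coefficient of \<gamma> is what remains.\<close>
  have x_part: "cx * sqE x + ch * sqE H + 1/2 * SH0 \<le> - (\<gamma> / 4) * sqE x"
  proof -
    have "ch * sqE H + 1/2 * SH0 \<le> ch * (sqE H + SH0)"
      using \<alpha>(1) SG mult_right_mono[of "1/2" ch SH0] by (simp add: ch_def distrib_left)
    also have "\<dots> \<le> ch * (l\<^sup>2 * sqE x)"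
      using H_le \<alpha>(1) by (intro mult_left_mono) (auto simp: ch_def)
    finally have "cx * sqE x + ch * sqE H + 1/2 * SH0 \<le> (cx + ch * l\<^sup>2) * sqE x"
      by (simp add: algebra_simps)
    also have "\<dots> \<le> - (\<gamma> / 4) * sqE x"
    proof (rule mult_right_mono[OF _ sqE_nonneg])
      have "\<alpha> * (P + 5/2 * l\<^sup>2) \<le> phi1 l \<rho>\<^sub>2 \<beta> \<gamma>"
        by (rule order.trans[OF mult_left_mono[OF P_le(1)]]) (use \<alpha> in auto)
      then show "cx + ch * l\<^sup>2 \<le> - (\<gamma> / 4)"
        by (simp add: cx_def ch_def phi1_def field_simps)
    qed
    finally show ?thesis .
  qed
  have g_part: "cd * sqnorm D - 1/2 * SG + l * \<alpha> / 2 * SG \<le> 0"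
  proof -
    have "cd * sqnorm D \<le> cd * (l\<^sup>2 * SG)"
      using D_le Q \<alpha>(1) by (intro mult_left_mono) (auto simp: cd_def)
    then have "cd * sqnorm D - 1/2 * SG + l * \<alpha> / 2 * SG \<le> (cd * l\<^sup>2 - 1/2 + l * \<alpha> / 2) * SG"
      by (simp add: algebra_simps)
    also have "\<dots> \<le> 0"
    proof (rule mult_nonpos_nonneg[OF _ SG(1)])
      \<comment> \<open>With these forms the condition on \<alpha> says that
        \<open>cd * l\<^sup>2 + l * \<alpha> / 2\<close> is at most 1/8, which is below the 1/2
        supplied by the descent of the objective.\<close>
      have "phi5 l \<rho>\<^sub>2 \<beta> \<gamma> = 1/8 - l\<^sup>2 * Q1" "phi6 l \<rho>\<^sub>2 \<beta> \<gamma> = l\<^sup>2 * Q2 + l / 2"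
        by (simp_all add: phi5_def phi6_def Q1_def Q2_def algebra_simps)
      then show "cd * l\<^sup>2 - 1/2 + l * \<alpha> / 2 \<le> 0"
        using \<alpha>(4) by (simp add: cd_def algebra_simps)
    qed
    finally show ?thesis .
  qed
  have e_part: "ce * sqE e \<le> psi2 \<rho> \<rho>\<^sub>2 \<beta> \<gamma> \<alpha> * sqnorm e"
  proof -
    have "0 \<le> P" using step_constants(1) by (simp add: P_def)
    then have "0 \<le> ce" using \<alpha>(1) \<gamma> \<beta>_pos \<rho>_pos by (simp add: ce_def phi7_def)
    moreover have "ce \<le> psi2 \<rho> \<rho>\<^sub>2 \<beta> \<gamma> \<alpha>"
      using P_le(2) \<alpha>(1) by (simp add: ce_def psi2_def)
    moreover have "sqE e \<le> sqnorm e" using sqnorm_split[OF e] by (simp add: sum_nonneg)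
    ultimately show ?thesis using sqE_nonneg by (intro mult_mono) auto
  qed
  define u1 u2 where "u1 = S0 / 4 + cx * sqE x + ce * sqE e + ch * sqE H + cd * sqnorm D"
    and "u2 = - 1/2 * S0 - 1/2 * SG + 1/2 * SH0 + l * \<alpha> / 2 * SG"
  \<comment> \<open>The growth S0/4 in the consensus direction meets -S0/2 from the objective, which
    leaves the -S0/4 of the claim.\<close>
  have "u1 + u2 \<le> - (\<gamma> / 4 * sqE x + 1/4 * S0) + psi2 \<rho> \<rho>\<^sub>2 \<beta> \<gamma> \<alpha> * sqnorm e"
    using x_part g_part e_part by (simp add: u1_def u2_def)
  then have "\<alpha> * (u1 + u2) \<le> \<alpha> * (- (\<gamma> / 4 * sqE x + 1/4 * S0) + psi2 \<rho> \<rho>\<^sub>2 \<beta> \<gamma> \<alpha> * sqnorm e)"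
    using \<alpha>(1) by (intro mult_left_mono) auto
  also have "\<dots> = - (\<alpha> * (\<gamma> / 4 * sqE x + 1/4 * S0)) + \<alpha> * psi2 \<rho> \<rho>\<^sub>2 \<beta> \<gamma> \<alpha> * sqnorm e"
    by (simp only: distrib_left mult_minus_right mult.assoc)
  finally have "\<alpha> * u1 + \<alpha> * u2 \<le> \<dots>" by (simp only: distrib_left)
  then show ?thesis using energy_step f_step
    unfolding lyap_def S0_eq[symmetric] W_def u1_def[symmetric] u2_def[symmetric] right_diff_distrib
    by linarith
qed

text \<open>Coercivity, the means by which a bound on the Lyapunov function limits the length of the
  next step. There is no cross term in the consensus direction, so \<open>eps1\<close> \<le> 1/2
  suffices for it.\<close>

lemma lyap_lower:
  assumes \<tau>: "\<beta> = \<tau> * \<gamma>" "1 < \<tau> * \<rho>\<^sub>2"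
  shows "eps1 \<rho>\<^sub>2 \<tau> * (sqE x + sqF (shifted x v)) + real n * (mean_fun n f (mean_vec d n x) - fstar) \<le> lyap x v"
proof -
  have \<tau>_pos: "0 < \<tau>" using \<tau> \<beta>_pos \<gamma> by (simp add: zero_less_mult_iff)
  have c: "(\<beta> + \<gamma>) / \<gamma> = \<tau> + 1" using \<gamma> by (simp add: \<tau>(1) field_simps)
  let ?w = "shifted x v"
  have "eps1 \<rho>\<^sub>2 \<tau> * (sqE x + sqF ?w) = (\<Sum>a<d. eps1 \<rho>\<^sub>2 \<tau> * ((coord ?w 0 a)\<^sup>2 / eigF 0)
      + (\<Sum>j=1..<n. eps1 \<rho>\<^sub>2 \<tau> * ((coord x j a)\<^sup>2 + (coord ?w j a)\<^sup>2 / eig j)))"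
    using n by (simp add: sqE_def sqF_def sum_lessThan_split0 eigF_eq_eig sum.distrib distrib_left sum_distrib_left)
  also have "\<dots> \<le> energy x ?w"
    unfolding energy_def c
  proof (intro sum_mono add_mono)
    fix a
    have "eps1 \<rho>\<^sub>2 \<tau> \<le> 1/2"
      using \<tau>_pos \<rho>\<^sub>2_pos by (simp add: eps1_def field_simps)
    also have "1/2 \<le> (\<tau> + 1) / 2" using \<tau>_pos by simp
    finally have "eps1 \<rho>\<^sub>2 \<tau> \<le> (\<tau> + 1) / 2" .
    moreover have "0 < eigF 0" using eigF_bounds[of 0] \<rho>\<^sub>2_pos n by simp
    ultimately have "eps1 \<rho>\<^sub>2 \<tau> * ((coord ?w 0 a)\<^sup>2 / eigF 0) \<le> (\<tau> + 1) / 2 * ((coord ?w 0 a)\<^sup>2 / eigF 0)"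
      by (intro mult_right_mono) auto
    then show "eps1 \<rho>\<^sub>2 \<tau> * ((coord ?w 0 a)\<^sup>2 / eigF 0) \<le> (\<tau> + 1) * (coord ?w 0 a)\<^sup>2 / (2 * eigF 0)"
      by simp
    fix j assume j: "j \<in> {1..<n}"
    show "eps1 \<rho>\<^sub>2 \<tau> * ((coord x j a)\<^sup>2 + (coord ?w j a)\<^sup>2 / eig j) \<le> mode_energy (\<tau> + 1) (eig j) (coord x j a) (coord ?w j a)"
      using eig_bounds[OF j] by (intro mode_energy_lower \<rho>\<^sub>2_pos \<tau>_pos \<tau>(2)) auto
  qed
  finally show ?thesis by (simp add: lyap_def)
qed

text \<open>In spectral coordinates the direction has four parts, from x, e, the shifted dual
  variable and the gradient deviation; the factor 4 of \<open>psi3\<close> and \<open>psi4\<close>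
  is the number of parts.\<close>

lemma sqnorm_direction_le:
  assumes x: "\<forall>i<n. x i \<in> carrier_vec d"
    and v: "\<forall>i<n. v i \<in> carrier_vec d" and e: "\<forall>i<n. e i \<in> carrier_vec d"
  shows "sqnorm (direction x v e) \<le> 4 * ((\<beta>\<^sup>2 * \<rho>\<^sup>2 + l\<^sup>2) * sqE x + \<gamma>\<^sup>2 * \<rho> * sqF (shifted x v)
     + \<beta>\<^sup>2 * \<rho>\<^sup>2 * sqnorm e)"
proof -
  let ?w = "shifted x v" and ?h = "deviation x"
  have four: "(p + q + r + s)\<^sup>2 \<le> 4 * (p\<^sup>2 + q\<^sup>2 + r\<^sup>2 + s\<^sup>2)" for p q r s :: real
    using zero_le_power2[of "p - q"] zero_le_power2[of "p - r"] zero_le_power2[of "p - s"]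
      zero_le_power2[of "q - r"] zero_le_power2[of "q - s"] zero_le_power2[of "r - s"]
    by (simp add: power2_eq_square algebra_simps)
  have pointwise: "(coord (direction x v e) j a)\<^sup>2 \<le> 4 * (\<beta>\<^sup>2 * (eig j * coord x j a)\<^sup>2 + \<beta>\<^sup>2 * (eig j * coord e j a)\<^sup>2
      + \<gamma>\<^sup>2 * (coord ?w j a)\<^sup>2 + (coord ?h j a)\<^sup>2)" if "a < d" "j < n" for a j
  proof -
    have "coord (direction x v e) j a = \<beta> * (eig j * coord x j a) + (- (\<beta> * (eig j * coord e j a))) + \<gamma> * coord ?w j a + coord ?h j a"
      using coord_direction[OF that x v e] by (simp add: algebra_simps)
    then show ?thesis
      using four[of "\<beta> * (eig j * coord x j a)" "- (\<beta> * (eig j * coord e j a))" "\<gamma> * coord ?w j a" "coord ?h j a"]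
      by (simp only: power_mult_distrib power2_minus)
  qed
  have eig_le: "(eig j * z)\<^sup>2 \<le> \<rho>\<^sup>2 * z\<^sup>2" if "j < n" for j z
  proof -
    have "0 \<le> eig j \<and> eig j \<le> \<rho>"
      using eig_bounds[of j] that \<rho>\<^sub>2_pos \<rho>_pos by (cases "j = 0") (auto simp: eig_def)
    then have "(eig j)\<^sup>2 \<le> \<rho>\<^sup>2" by (intro power_mono) auto
    then show ?thesis by (simp add: power_mult_distrib mult_right_mono)
  qed
  have w_le: "(coord ?w j a)\<^sup>2 \<le> \<rho> * ((coord ?w j a)\<^sup>2 / eigF j)" if "j < n" for j a
  proof -
    have "0 < eigF j" "eigF j \<le> \<rho>" using eigF_bounds[OF that] \<rho>\<^sub>2_pos by auto
    then have "eigF j * ((coord ?w j a)\<^sup>2 / eigF j) \<le> \<rho> * ((coord ?w j a)\<^sup>2 / eigF j)"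
      by (intro mult_right_mono) auto
    then show ?thesis using \<open>0 < eigF j\<close> by simp
  qed
  have Ex: "(\<Sum>a<d. \<Sum>j<n. (eig j * coord x j a)\<^sup>2) \<le> \<rho>\<^sup>2 * sqE x"
  proof -
    have "(\<Sum>a<d. \<Sum>j<n. (eig j * coord x j a)\<^sup>2) = (\<Sum>a<d. \<Sum>j=1..<n. (eig j * coord x j a)\<^sup>2)"
      using n by (simp add: sum_lessThan_split0 eig_def)
    also have "\<dots> \<le> (\<Sum>a<d. \<Sum>j=1..<n. \<rho>\<^sup>2 * (coord x j a)\<^sup>2)"
      by (intro sum_mono eig_le) auto
    finally show ?thesis by (simp add: sqE_def sum_distrib_left)
  qed
  have Ee: "(\<Sum>a<d. \<Sum>j<n. (eig j * coord e j a)\<^sup>2) \<le> \<rho>\<^sup>2 * sqnorm e"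
  proof -
    have "sqnorm e = (\<Sum>a<d. \<Sum>j<n. (coord e j a)\<^sup>2)" using e by (rule sqnorm_eq)
    then show ?thesis unfolding sum_distrib_left by (auto simp: sum_distrib_left intro!: sum_mono eig_le)
  qed
  have Ew: "(\<Sum>a<d. \<Sum>j<n. (coord ?w j a)\<^sup>2) \<le> \<rho> * sqF ?w"
    unfolding sqF_def sum_distrib_left by (intro sum_mono w_le) auto
  have Eh: "(\<Sum>a<d. \<Sum>j<n. (coord ?h j a)\<^sup>2) \<le> l\<^sup>2 * sqE x"
    using sqnorm_deviation_le[OF x] sqnorm_eq[of ?h] deviation_carrier x by simp
  have "sqnorm (direction x v e) = (\<Sum>a<d. \<Sum>j<n. (coord (direction x v e) j a)\<^sup>2)"
    using direction_carrier[OF _ x v, of _ e] by (intro sqnorm_eq) blast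
  also have "\<dots> \<le> (\<Sum>a<d. \<Sum>j<n. 4 * (\<beta>\<^sup>2 * (eig j * coord x j a)\<^sup>2 + \<beta>\<^sup>2 * (eig j * coord e j a)\<^sup>2
      + \<gamma>\<^sup>2 * (coord ?w j a)\<^sup>2 + (coord ?h j a)\<^sup>2))"
    by (intro sum_mono pointwise) auto
  also have "\<dots> = 4 * (\<beta>\<^sup>2 * (\<Sum>a<d. \<Sum>j<n. (eig j * coord x j a)\<^sup>2) + \<beta>\<^sup>2 * (\<Sum>a<d. \<Sum>j<n. (eig j * coord e j a)\<^sup>2)
      + \<gamma>\<^sup>2 * (\<Sum>a<d. \<Sum>j<n. (coord ?w j a)\<^sup>2) + (\<Sum>a<d. \<Sum>j<n. (coord ?h j a)\<^sup>2))"
    by (simp add: sum.distrib sum_distrib_left distrib_left)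
  also have "\<dots> \<le> 4 * (\<beta>\<^sup>2 * (\<rho>\<^sup>2 * sqE x) + \<beta>\<^sup>2 * (\<rho>\<^sup>2 * sqnorm e) + \<gamma>\<^sup>2 * (\<rho> * sqF ?w) + l\<^sup>2 * sqE x)"
    by (intro mult_left_mono add_mono Ex Ee Ew Eh) auto
  finally show ?thesis by (simp add: algebra_simps)
qed

end

section \<open>Compression errors\<close>

text \<open>With b = \<omega> r the remaining error is (1 - b) z plus b s times a scaled compressor
  error, so convexity in b gives the factor 1 - b \<delta>. Its square is at most 1 - 2 b \<delta> +
  b \<open>\<delta>\<^sup>2\<close> because b \<le> 1, and this is
  \<open>1 - 2 * eps5\<close>.\<close>

lemma compressor_contraction:
  assumes cmpr: "locally_bounded_compressor d p r C \<delta> cmpr" and p: "1 \<le> p" and d: "0 < d"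
    and r: "0 < r" and C: "0 < C" and \<delta>: "0 < \<delta>" "\<delta> \<le> 1" and \<omega>: "0 < \<omega>" "\<omega> \<le> 1 / r"
    and s: "0 < s" and z: "z \<in> carrier_vec d" "pnorm p z \<le> C * s"
  shows "(pnorm p (z - (\<omega> * s) \<cdot>\<^sub>v cmpr ((1 / s) \<cdot>\<^sub>v z)))\<^sup>2 \<le> (1 - 2 * eps5 \<omega> r \<delta>) * (C\<^sup>2 * s\<^sup>2)"
proof -
  define w where "w = (1 / s) \<cdot>\<^sub>v z"
  define b where "b = \<omega> * r"
  have b: "0 < b" "b \<le> 1" using r \<omega> by (auto simp: b_def field_simps)
  have w: "w \<in> carrier_vec d" using z by (simp add: w_def)
  have cw: "cmpr w \<in> carrier_vec d" using cmpr w by (auto simp: locally_bounded_compressor_def)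
  have "pnorm p w \<le> 1 / s * pnorm p z" using pnorm_scale_le[OF p z(1) d, of "1 / s"] s by (simp add: w_def)
  also have "\<dots> \<le> 1 / s * (C * s)" using z(2) s by (intro mult_left_mono) auto
  finally have "pnorm p w \<le> C" using s by simp
  then have err: "pnorm p ((1 / r) \<cdot>\<^sub>v cmpr w - w) \<le> C * (1 - \<delta>)"
    using cmpr w by (auto simp: locally_bounded_compressor_def)
  have "z - (\<omega> * s) \<cdot>\<^sub>v cmpr w = (1 - b) \<cdot>\<^sub>v z + (- (b * s)) \<cdot>\<^sub>v ((1 / r) \<cdot>\<^sub>v cmpr w - w)"
    using z(1) cw w s r by (intro eq_vecI) (auto simp: w_def b_def field_simps)
  then have "pnorm p (z - (\<omega> * s) \<cdot>\<^sub>v cmpr w)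
      \<le> pnorm p ((1 - b) \<cdot>\<^sub>v z) + pnorm p ((- (b * s)) \<cdot>\<^sub>v ((1 / r) \<cdot>\<^sub>v cmpr w - w))"
    using pnorm_triangle[OF p _ _ d] z(1) cw w by simp
  also have "\<dots> \<le> (1 - b) * pnorm p z + (b * s) * pnorm p ((1 / r) \<cdot>\<^sub>v cmpr w - w)"
    using pnorm_scale_le[OF p z(1) d, of "1 - b"] pnorm_scale_le[OF p _ d, of "(1 / r) \<cdot>\<^sub>v cmpr w - w" "- (b * s)"]
      cw w b s by (intro add_mono) auto
  also have "\<dots> \<le> (1 - b) * (C * s) + (b * s) * (C * (1 - \<delta>))"
    using b s z(2) err by (intro add_mono mult_left_mono) auto
  also have "\<dots> = (1 - b * \<delta>) * (C * s)" by (simp add: algebra_simps)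
  finally have "(pnorm p (z - (\<omega> * s) \<cdot>\<^sub>v cmpr w))\<^sup>2 \<le> ((1 - b * \<delta>) * (C * s))\<^sup>2"
    using z(1) cw pnorm_nonneg[OF p _ d] by (intro power_mono) auto
  also have "\<dots> = (1 - b * \<delta>)\<^sup>2 * (C\<^sup>2 * s\<^sup>2)" by (simp add: power_mult_distrib)
  also have "\<dots> \<le> (1 - 2 * eps5 \<omega> r \<delta>) * (C\<^sup>2 * s\<^sup>2)"
  proof (rule mult_right_mono)
    have "b * (b * \<delta>\<^sup>2) \<le> 1 * (b * \<delta>\<^sup>2)" using b by (intro mult_right_mono) auto
    then show "(1 - b * \<delta>)\<^sup>2 \<le> 1 - 2 * eps5 \<omega> r \<delta>"
      by (simp add: eps5_def b_def power2_eq_square algebra_simps)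
  qed simp
  finally show ?thesis by (simp add: w_def)
qed

lemma eps5_bounds:
  assumes "0 < r" "0 < \<delta>" "\<delta> \<le> 1" "0 < \<omega>" "\<omega> \<le> 1 / r"
  shows "0 < eps5 \<omega> r \<delta>" "eps5 \<omega> r \<delta> \<le> 1/2"
proof -
  have b: "0 < \<omega> * r" "\<omega> * r \<le> 1" using assms by (auto simp: field_simps)
  have "\<delta>\<^sup>2 \<le> \<delta>" using assms by (simp add: power2_eq_square mult_left_le)
  then have pos: "0 < \<delta> - \<delta>\<^sup>2 / 2" using assms by linarith
  have "0 \<le> (1 - \<delta>)\<^sup>2" by simp
  then have half: "\<delta> - \<delta>\<^sup>2 / 2 \<le> 1/2" by (simp add: power2_eq_square algebra_simps)
  show "0 < eps5 \<omega> r \<delta>" using b pos by (simp add: eps5_def)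
  have "\<omega> * r * (\<delta> - \<delta>\<^sup>2 / 2) \<le> 1 * (1/2)" using b pos half by (intro mult_mono) auto
  then show "eps5 \<omega> r \<delta> \<le> 1/2" by (simp add: eps5_def)
qed

text \<open>The identity explains \<open>eps8\<close>: it is half of the contraction left after the
  factor 1 - 2 e has been enlarged by 1 + e through Young's inequality.\<close>

lemma eps8_bounds:
  assumes "0 < e" "e \<le> 1/2"
  shows "0 < eps8 e" "eps8 e \<le> 1" "(1 + e) * (1 - 2 * e) = 1 - 2 * eps8 e"
proof -
  show "0 < eps8 e" using assms by (simp add: eps8_def add_pos_nonneg)
  have "e\<^sup>2 \<le> (1/2)\<^sup>2" using assms by (intro power_mono) auto
  then show "eps8 e \<le> 1" using assms by (simp add: eps8_def power2_eq_square)
  show "(1 + e) * (1 - 2 * e) = 1 - 2 * eps8 e"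
    by (simp add: eps8_def power2_eq_square algebra_simps)
qed

lemma square_add_le:
  fixes a b t :: real
  assumes "0 < t"
  shows "(a + b)\<^sup>2 \<le> (1 + t) * a\<^sup>2 + (1 + inverse t) * b\<^sup>2"
  using young[OF assms, of a b] by (simp add: power2_eq_square field_simps)

context network
begin

section \<open>The run as a perturbed primal-dual iteration\<close>

text \<open>The variables y and xh are updated with the same compressed messages, so y remains the
  Laplacian of the estimates; the uncompressed first round provides the start of this
  induction.\<close>

lemma uca_run_state:
  assumes run: "uca_run n d L f cmpr \<alpha> \<beta> \<gamma> \<omega> s x v xh y q"
    and cmpr: "\<forall>z\<in>carrier_vec d. cmpr z \<in> carrier_vec d"
  shows "\<forall>i<n. x i k \<in> carrier_vec d" and "\<forall>i<n. v i k \<in> carrier_vec d"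
    and "\<forall>i<n. xh i k \<in> carrier_vec d" and "\<forall>i<n. y i k = lap (\<lambda>j. xh j k) i"
proof -
  have "(\<forall>i<n. x i k \<in> carrier_vec d) \<and> (\<forall>i<n. v i k \<in> carrier_vec d) \<and>
     (\<forall>i<n. xh i k \<in> carrier_vec d) \<and> (\<forall>i<n. y i k = lap (\<lambda>j. xh j k) i)"
  proof (induction k)
    case 0
    then show ?case using run by (auto simp: uca_run_def lap_def lincomb_vec_def intro!: eq_vecI)
  next
    case (Suc k)
    have q: "q i k \<in> carrier_vec d" if "i < n" for i
    proof -
      have "q i k = cmpr ((1 / s k) \<cdot>\<^sub>v (x i k - xh i k))" using run that by (auto simp: uca_run_def)
      then show ?thesis using cmpr Suc that by auto
    qed
    have xh: "xh i (Suc k) = xh i k + (\<omega> * s k) \<cdot>\<^sub>v q i k" if "i < n" for i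
      using run that by (auto simp: uca_run_def)
    have xhc: "xh i (Suc k) \<in> carrier_vec d" if "i < n" for i
      using xh[OF that] q[OF that] Suc that by auto
    have y: "y i (Suc k) = lap (\<lambda>j. xh j (Suc k)) i" if i: "i < n" for i
    proof -
      have "y i (Suc k) = lap (\<lambda>j. xh j k) i + (\<omega> * s k) \<cdot>\<^sub>v lap (\<lambda>j. q j k) i"
        using run i Suc by (auto simp: uca_run_def lap_def)
      also have "\<dots> = lap (\<lambda>j. xh j (Suc k)) i"
      proof (rule eq_vecI)
        fix a assume "a < dim_vec (lap (\<lambda>j. xh j (Suc k)) i)"
        then have a: "a < d" by simp
        have "(\<Sum>j<n. L $$ (i, j) * xh j (Suc k) $ a)
            = (\<Sum>j<n. L $$ (i, j) * xh j k $ a + (\<omega> * s k) * (L $$ (i, j) * q j k $ a))"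
          using a xh carrier_vecD[OF q] by (intro sum.cong refl) (simp add: algebra_simps)
        then show "(lap (\<lambda>j. xh j k) i + (\<omega> * s k) \<cdot>\<^sub>v lap (\<lambda>j. q j k) i) $ a = lap (\<lambda>j. xh j (Suc k)) i $ a"
          using a by (simp add: lap_def lincomb_vec_def sum.distrib sum_distrib_left)
      qed simp
      finally show ?thesis .
    qed
    have "x i (Suc k) = x i k - \<alpha> \<cdot>\<^sub>v (\<beta> \<cdot>\<^sub>v y i (Suc k) + \<gamma> \<cdot>\<^sub>v v i k + grad i (x i k))"
      "v i (Suc k) = v i k + (\<alpha> * \<gamma>) \<cdot>\<^sub>v y i (Suc k)" if "i < n" for i
      using run that by (auto simp: uca_run_def grad_def)
    then show ?case using Suc xhc y grad_carrier by auto
  qed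
  then show "\<forall>i<n. x i k \<in> carrier_vec d" and "\<forall>i<n. v i k \<in> carrier_vec d"
    and "\<forall>i<n. xh i k \<in> carrier_vec d" and "\<forall>i<n. y i k = lap (\<lambda>j. xh j k) i" by auto
qed

text \<open>Brings a run into the form required by \<open>lyap_decrease\<close>. The error refers to
  \<open>xh\<close> at \<open>Suc k\<close>, which is the estimate after the communication of round
  k because that sequence is shifted by one.\<close>

lemma uca_run_step:
  fixes x xh :: "nat \<Rightarrow> nat \<Rightarrow> real vec" and k :: nat
  assumes run: "uca_run n d L f cmpr \<alpha> \<beta> \<gamma> \<omega> s x v xh y q"
    and cmpr: "\<forall>z\<in>carrier_vec d. cmpr z \<in> carrier_vec d" and i: "i < n"
  defines "e \<equiv> \<lambda>i. x i k - xh i (Suc k)"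
  shows "x i (Suc k) = x i k - \<alpha> \<cdot>\<^sub>v direction (\<lambda>i. x i k) (\<lambda>i. v i k) e i"
    and "v i (Suc k) = v i k + (\<alpha> * \<gamma>) \<cdot>\<^sub>v lap (\<lambda>j. x j k - e j) i"
    and "e i = (x i k - xh i k) - (\<omega> * s k) \<cdot>\<^sub>v cmpr ((1 / s k) \<cdot>\<^sub>v (x i k - xh i k))"
proof -
  note st = uca_run_state[OF run cmpr]
  have y: "y i (Suc k) = lap (\<lambda>j. x j k - e j) i"
  proof -
    have "(\<Sum>j<n. L $$ (i, j) * xh j (Suc k) $ a) = (\<Sum>j<n. L $$ (i, j) * (x j k - e j) $ a)"
      if a: "a < d" for a
    proof (intro sum.cong refl)
      fix j assume "j \<in> {..<n}"
      then have "x j k \<in> carrier_vec d" "xh j (Suc k) \<in> carrier_vec d"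
        using st(1,3) by auto
      then show "L $$ (i, j) * xh j (Suc k) $ a = L $$ (i, j) * (x j k - e j) $ a"
        using a by (simp add: e_def)
    qed
    then show ?thesis using st(4)[of "Suc k"] i by (auto simp: lap_def lincomb_vec_def intro!: eq_vecI)
  qed
  show "x i (Suc k) = x i k - \<alpha> \<cdot>\<^sub>v direction (\<lambda>i. x i k) (\<lambda>i. v i k) e i"
    using run i unfolding direction_def y[symmetric] grad_def by (auto simp: uca_run_def)
  show "v i (Suc k) = v i k + (\<alpha> * \<gamma>) \<cdot>\<^sub>v lap (\<lambda>j. x j k - e j) i"
    using run i unfolding y[symmetric] by (auto simp: uca_run_def)
  have "x i k \<in> carrier_vec d" "xh i k \<in> carrier_vec d" "xh i (Suc k) \<in> carrier_vec d"
    using st(1,3) i by auto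
  moreover have "xh i (Suc k) = xh i k + (\<omega> * s k) \<cdot>\<^sub>v cmpr ((1 / s k) \<cdot>\<^sub>v (x i k - xh i k))"
    using run i by (auto simp: uca_run_def)
  moreover have "cmpr ((1 / s k) \<cdot>\<^sub>v (x i k - xh i k)) \<in> carrier_vec d"
    using calculation cmpr by auto
  ultimately show "e i = (x i k - xh i k) - (\<omega> * s k) \<cdot>\<^sub>v cmpr ((1 / s k) \<cdot>\<^sub>v (x i k - xh i k))"
    unfolding e_def by (intro eq_vecI) auto
qed

text \<open>The dual variables start at 0, and every increment is a Laplacian image, whose sum over
  the agents vanishes.\<close>

lemma uca_run_sum_v:
  assumes run: "uca_run n d L f cmpr \<alpha> \<beta> \<gamma> \<omega> s x v xh y q"
    and cmpr: "\<forall>z\<in>carrier_vec d. cmpr z \<in> carrier_vec d" and a: "a < d"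
  shows "(\<Sum>i<n. v i k $ a) = 0"
proof (induction k)
  case 0
  have "v i 0 = 0\<^sub>v d" if "i < n" for i using run that by (auto simp: uca_run_def)
  then show ?case using a by simp
next
  case (Suc k)
  have "(\<Sum>i<n. lap z i $ a) = 0" for z
  proof -
    have "coord (lap z) 0 a = 0" using coord_lincomb[OF a, of 0 z] n by (simp add: lap_def[abs_def] eig_def)
    then show ?thesis using n by (simp add: coord_def modal_mean[OF U(1,4)])
  qed
  moreover have "v i (Suc k) $ a = v i k $ a + \<alpha> * \<gamma> * lap (\<lambda>j. xh j (Suc k)) i $ a" if i: "i < n" for i
  proof -
    have "v i (Suc k) = v i k + (\<alpha> * \<gamma>) \<cdot>\<^sub>v lap (\<lambda>j. xh j (Suc k)) i"
      using run i uca_run_state(4)[OF run cmpr, of "Suc k"] by (auto simp: uca_run_def)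
    then show ?thesis using a uca_run_state(2)[OF run cmpr, of k] i by simp
  qed
  ultimately show ?case using Suc by (simp add: sum.distrib flip: sum_distrib_left)
qed

lemma lyap_nonneg_part:
  "0 \<le> real n * (mean_fun n f (mean_vec d n x) - fstar)"
  using fstar[of "mean_vec d n x"] by simp

text \<open>The induction couples two facts: as long as no compressor input leaves the ball of radius C,
  the compression error is controlled by the scaling factor and the Lyapunov function grows at most
  linearly; this growth in turn keeps the next compressor input inside the ball.\<close>

lemma uca_invariant:
  fixes \<alpha> \<tau>\<^sub>1 r C \<delta> \<omega> :: real and s :: "nat \<Rightarrow> real"
  assumes run: "uca_run n d L f cmpr \<alpha> \<beta> \<gamma> \<omega> s x v xh y q"
    and cmpr: "locally_bounded_compressor d p r C \<delta> cmpr" and p: "1 \<le> p"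
    and r: "0 < r" and C: "0 < C" and \<delta>: "0 < \<delta>" "\<delta> \<le> 1" and \<omega>: "0 < \<omega>" "\<omega> \<le> 1 / r"
    and \<alpha>: "0 < \<alpha>" "\<alpha> * phi2 l \<rho> \<rho>\<^sub>2 \<beta> \<gamma> \<le> phi1 l \<rho>\<^sub>2 \<beta> \<gamma>"
      "\<alpha> * phi4 \<rho> \<gamma> \<le> phi3 \<rho>\<^sub>2 \<gamma>" "\<alpha> * phi6 l \<rho>\<^sub>2 \<beta> \<gamma> \<le> phi5 l \<rho>\<^sub>2 \<beta> \<gamma>"
    and \<tau>: "\<beta> = \<tau>\<^sub>1 * \<gamma>" "1 < \<tau>\<^sub>1 * \<rho>\<^sub>2"
    and \<epsilon>\<^sub>5: "\<epsilon>\<^sub>5 = eps5 \<omega> r \<delta>" and \<psi>\<^sub>2: "\<psi>\<^sub>2 = psi2 \<rho> \<rho>\<^sub>2 \<beta> \<gamma> \<alpha>" "0 \<le> \<psi>\<^sub>2"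
    and \<psi>\<^sub>4: "\<psi>\<^sub>4 = psi4 l \<rho> \<beta> \<gamma> (eps1 \<rho>\<^sub>2 \<tau>\<^sub>1) \<epsilon>\<^sub>5 (dhat p d)"
    and small: "(1 - 2 * \<epsilon>\<^sub>5) * psi3 \<rho> \<beta> \<epsilon>\<^sub>5 (dhat p d) * (real n * (dtilde p d)\<^sup>2 * \<alpha>\<^sup>2) \<le> eps8 \<epsilon>\<^sub>5"
    and B: "B = \<alpha> * \<psi>\<^sub>2 * ((1 - 2 * \<epsilon>\<^sub>5) * (real n * (dtilde p d)\<^sup>2 * (C\<^sup>2 * S)))"
    and L10: "L10 = lyap (\<lambda>i. x i 0) (\<lambda>i. v i 0)"
    and s: "\<And>k. 0 < s k" "\<And>k. k \<le> T \<Longrightarrow> (s k)\<^sup>2 \<le> S"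
    and s_step: "\<And>k. k < T \<Longrightarrow>
        (1 - eps8 \<epsilon>\<^sub>5) * (C\<^sup>2 * (s k)\<^sup>2) + \<alpha>\<^sup>2 * (\<psi>\<^sub>4 * (L10 + real T * B)) \<le> C\<^sup>2 * (s (Suc k))\<^sup>2"
  shows "k \<le> T \<Longrightarrow> (\<forall>i<n. pnorm p (x i k - xh i k) \<le> C * s k) \<and>
      lyap (\<lambda>i. x i k) (\<lambda>i. v i k) \<le> L10 + real k * B"
    and "k < T \<Longrightarrow> lyap (\<lambda>i. x i (Suc k)) (\<lambda>i. v i (Suc k)) \<le> lyap (\<lambda>i. x i k) (\<lambda>i. v i k)
      - \<alpha> * (\<gamma> / 4 * sqE (\<lambda>i. x i k)
          + 1/4 * (real n * (norm2 (gradient d (mean_fun n f) (mean_vec d n (\<lambda>i. x i k))))\<^sup>2)) + B"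
proof -
  have cm: "\<forall>z\<in>carrier_vec d. cmpr z \<in> carrier_vec d"
    using cmpr by (auto simp: locally_bounded_compressor_def)
  note st = uca_run_state[OF run cm] and step = uca_run_step[OF run cm]
  have e5: "0 < \<epsilon>\<^sub>5" "\<epsilon>\<^sub>5 \<le> 1/2" using eps5_bounds[OF r \<delta> \<omega>] by (auto simp: \<epsilon>\<^sub>5)
  note e8 = eps8_bounds[OF e5]
  have \<tau>\<^sub>1: "0 < \<tau>\<^sub>1" using \<tau>(1) \<beta>_pos \<gamma> by (simp add: zero_less_mult_iff)
  have e1: "0 < eps1 \<rho>\<^sub>2 \<tau>\<^sub>1" using \<tau>(2) \<tau>\<^sub>1 \<rho>\<^sub>2_pos by (simp add: eps1_def)
  have dpos: "0 < dhat p d" "0 < dtilde p d" using dhat_pos[OF d] dtilde_pos[OF d] by auto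
  have \<psi>\<^sub>4_pos: "0 \<le> \<psi>\<^sub>4"
    using e1 e5 \<rho>_pos by (auto simp: \<psi>\<^sub>4 psi4_def intro!: divide_nonneg_pos mult_nonneg_nonneg max.coboundedI1)
  have \<psi>\<^sub>3_pos: "0 \<le> psi3 \<rho> \<beta> \<epsilon>\<^sub>5 (dhat p d)" using e5 by (simp add: psi3_def)
  have S: "0 \<le> S" using order.trans[OF zero_le_power2 s(2)[of 0]] by simp
  have B_pos: "0 \<le> B" using \<alpha>(1) \<psi>\<^sub>2(2) e5 S by (simp add: B)
  define e where "e = (\<lambda>k i. x i k - xh i (Suc k))"
  have ec: "\<forall>i<n. e k i \<in> carrier_vec d" for k using st(1,3) by (auto simp: e_def)
  have e_le: "(pnorm p (e k i))\<^sup>2 \<le> (1 - 2 * \<epsilon>\<^sub>5) * (C\<^sup>2 * (s k)\<^sup>2)"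
    if "i < n" "pnorm p (x i k - xh i k) \<le> C * s k" for k i
  proof -
    have "x i k - xh i k \<in> carrier_vec d" using st(1,3) that by auto
    then show ?thesis using step(3)[OF that(1), of k] that(2)
      compressor_contraction[OF cmpr p d r C \<delta> \<omega> s(1)[of k]] by (simp add: e_def \<epsilon>\<^sub>5)
  qed
  \<comment> \<open>The factor n times \<open>(dtilde p d)\<^sup>2\<close> is the price of passing
    from a p-norm bound for each agent to the joint Euclidean norm.\<close>
  have sqe_le: "sqnorm (e k) \<le> (1 - 2 * \<epsilon>\<^sub>5) * (real n * (dtilde p d)\<^sup>2 * (C\<^sup>2 * (s k)\<^sup>2))"
    if in_ball: "\<forall>i<n. pnorm p (x i k - xh i k) \<le> C * s k" for k
  proof -
    have "(norm2 (e k i))\<^sup>2 \<le> (dtilde p d)\<^sup>2 * ((1 - 2 * \<epsilon>\<^sub>5) * (C\<^sup>2 * (s k)\<^sup>2))" if i: "i < n" for i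
    proof -
      have "norm2 (e k i) \<le> dtilde p d * pnorm p (e k i)" using norm2_le_dtilde_pnorm[OF p _ d] ec i by blast
      then have "(norm2 (e k i))\<^sup>2 \<le> (dtilde p d * pnorm p (e k i))\<^sup>2"
        by (rule power_mono) (rule norm2_nonneg)
      then have "(norm2 (e k i))\<^sup>2 \<le> (dtilde p d)\<^sup>2 * (pnorm p (e k i))\<^sup>2"
        by (simp add: power_mult_distrib)
      also have "\<dots> \<le> (dtilde p d)\<^sup>2 * ((1 - 2 * \<epsilon>\<^sub>5) * (C\<^sup>2 * (s k)\<^sup>2))"
        using e_le[OF i in_ball[rule_format, OF i]] by (intro mult_left_mono) auto
      finally show ?thesis .
    qed
    then have "sqnorm (e k) \<le> (\<Sum>i<n. (dtilde p d)\<^sup>2 * ((1 - 2 * \<epsilon>\<^sub>5) * (C\<^sup>2 * (s k)\<^sup>2)))"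
      unfolding sqnorm_def by (intro sum_mono) auto
    then show ?thesis by (simp add: mult_ac)
  qed
  have decrease: "lyap (\<lambda>i. x i (Suc k)) (\<lambda>i. v i (Suc k)) \<le> lyap (\<lambda>i. x i k) (\<lambda>i. v i k)
      - \<alpha> * (\<gamma> / 4 * sqE (\<lambda>i. x i k)
          + 1/4 * (real n * (norm2 (gradient d (mean_fun n f) (mean_vec d n (\<lambda>i. x i k))))\<^sup>2)) + B"
    if in_ball: "\<forall>i<n. pnorm p (x i k - xh i k) \<le> C * s k" and k: "k < T" for k
  proof -
    have "lyap (\<lambda>i. x i (Suc k)) (\<lambda>i. v i (Suc k)) \<le> lyap (\<lambda>i. x i k) (\<lambda>i. v i k)
      - \<alpha> * (\<gamma> / 4 * sqE (\<lambda>i. x i k)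
          + 1/4 * (real n * (norm2 (gradient d (mean_fun n f) (mean_vec d n (\<lambda>i. x i k))))\<^sup>2))
      + \<alpha> * psi2 \<rho> \<rho>\<^sub>2 \<beta> \<gamma> \<alpha> * sqnorm (e k)"
      using step(1,2) uca_run_sum_v[OF run cm]
      by (intro lyap_decrease st(1,2) ec \<alpha>) (auto simp: e_def)
    moreover have "\<alpha> * \<psi>\<^sub>2 * sqnorm (e k) \<le> B"
    proof -
      have "sqnorm (e k) \<le> (1 - 2 * \<epsilon>\<^sub>5) * (real n * (dtilde p d)\<^sup>2 * (C\<^sup>2 * (s k)\<^sup>2))"
        by (rule sqe_le[OF in_ball])
      also have "\<dots> \<le> (1 - 2 * \<epsilon>\<^sub>5) * (real n * (dtilde p d)\<^sup>2 * (C\<^sup>2 * S))"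
        using e5 s(2)[of k] k by (intro mult_left_mono) auto
      finally show ?thesis unfolding B using \<alpha>(1) \<psi>\<^sub>2(2) by (intro mult_left_mono) auto
    qed
    ultimately show ?thesis by (simp add: \<psi>\<^sub>2(1))
  qed
  have next_in_ball: "pnorm p (x i (Suc k) - xh i (Suc k)) \<le> C * s (Suc k)"
    if in_ball: "\<forall>i<n. pnorm p (x i k - xh i k) \<le> C * s k" and k: "k < T" and i: "i < n"
      and ly: "lyap (\<lambda>i. x i k) (\<lambda>i. v i k) \<le> L10 + real k * B" for k i
  proof -
    let ?x = "\<lambda>i. x i k" and ?v = "\<lambda>i. v i k"
    let ?dir = "direction ?x ?v (e k)"
    have dirc: "?dir i \<in> carrier_vec d" using i st(1,2) by (intro direction_carrier) auto
    have xi: "x i k \<in> carrier_vec d" "xh i (Suc k) \<in> carrier_vec d" using st(1,3) i by auto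
    \<comment> \<open>The next compressor input is the present compression error plus one step of
      the algorithm.\<close>
    have "x i (Suc k) - xh i (Suc k) = e k i + (- \<alpha>) \<cdot>\<^sub>v ?dir i"
      using step(1)[OF i, of k] xi dirc by (intro eq_vecI) (auto simp: e_def)
    then have "pnorm p (x i (Suc k) - xh i (Suc k)) \<le> pnorm p (e k i) + pnorm p ((- \<alpha>) \<cdot>\<^sub>v ?dir i)"
      using pnorm_triangle[OF p _ _ d] ec i dirc by simp
    also have "pnorm p ((- \<alpha>) \<cdot>\<^sub>v ?dir i) \<le> \<alpha> * (dhat p d * norm2 (?dir i))"
    proof -
      have "pnorm p ((- \<alpha>) \<cdot>\<^sub>v ?dir i) \<le> \<alpha> * pnorm p (?dir i)"
        using pnorm_scale_le[OF p dirc d, of "- \<alpha>"] \<alpha>(1) by simp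
      also have "\<dots> \<le> \<alpha> * (dhat p d * norm2 (?dir i))"
        using pnorm_le_dhat_norm2[OF p dirc d] \<alpha>(1) by (intro mult_left_mono) auto
      finally show ?thesis .
    qed
    finally have "(pnorm p (x i (Suc k) - xh i (Suc k)))\<^sup>2
        \<le> (pnorm p (e k i) + \<alpha> * (dhat p d * norm2 (?dir i)))\<^sup>2"
      using pnorm_nonneg[OF p _ d, of "x i (Suc k) - xh i (Suc k)"] st(1)[of "Suc k"] xi i
      by (intro power_mono) auto
    \<comment> \<open>This Young parameter leaves the contraction factor
      \<open>1 - 2 * eps8 \<epsilon>\<^sub>5\<close> for the error part.\<close>
    also have "\<dots> \<le> (1 + \<epsilon>\<^sub>5) * (pnorm p (e k i))\<^sup>2 + (1 + inverse \<epsilon>\<^sub>5) * (\<alpha> * (dhat p d * norm2 (?dir i)))\<^sup>2"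
      by (rule square_add_le[OF e5(1)])
    also have "\<dots> \<le> (1 + \<epsilon>\<^sub>5) * ((1 - 2 * \<epsilon>\<^sub>5) * (C\<^sup>2 * (s k)\<^sup>2))
        + (1 + inverse \<epsilon>\<^sub>5) * (\<alpha>\<^sup>2 * ((dhat p d)\<^sup>2 * sqnorm ?dir))"
    proof -
      \<comment> \<open>The Lyapunov function controls only the sum over all agents, so a single
        agent's direction is bounded by the joint one.\<close>
      have "(norm2 (?dir i))\<^sup>2 \<le> sqnorm ?dir" unfolding sqnorm_def
        using i by (intro member_le_sum) auto
      then have "(\<alpha> * (dhat p d * norm2 (?dir i)))\<^sup>2 \<le> \<alpha>\<^sup>2 * ((dhat p d)\<^sup>2 * sqnorm ?dir)"
        by (simp add: power_mult_distrib mult_left_mono)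
      then show ?thesis using e_le[OF i] in_ball i e5 by (intro add_mono mult_left_mono) auto
    qed
    also have "(1 + \<epsilon>\<^sub>5) * ((1 - 2 * \<epsilon>\<^sub>5) * (C\<^sup>2 * (s k)\<^sup>2)) = (1 - 2 * eps8 \<epsilon>\<^sub>5) * (C\<^sup>2 * (s k)\<^sup>2)"
      using e8(3) by (simp flip: mult.assoc)
    \<comment> \<open>The direction itself contains the compression error; by \<open>small\<close>
      that part costs one of the two \<open>eps8\<close> gained above, and the other one survives in
      the recursion for the scaling factors.\<close>
    also have "(1 + inverse \<epsilon>\<^sub>5) * (\<alpha>\<^sup>2 * ((dhat p d)\<^sup>2 * sqnorm ?dir))
        \<le> \<alpha>\<^sup>2 * (\<psi>\<^sub>4 * (L10 + real T * B)) + eps8 \<epsilon>\<^sub>5 * (C\<^sup>2 * (s k)\<^sup>2)"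
    proof -
      define K where "K = 4 * (1 + inverse \<epsilon>\<^sub>5) * (dhat p d)\<^sup>2"
      have K: "0 \<le> K" using e5 by (simp add: K_def)
      define m where "m = max (\<beta>\<^sup>2 * \<rho>\<^sup>2 + l\<^sup>2) (\<gamma>\<^sup>2 * \<rho>)"
      have m: "0 \<le> m" by (simp add: m_def max.coboundedI1)
      let ?w = "shifted ?x ?v"
      have "sqnorm ?dir \<le> 4 * ((\<beta>\<^sup>2 * \<rho>\<^sup>2 + l\<^sup>2) * sqE ?x + \<gamma>\<^sup>2 * \<rho> * sqF ?w + \<beta>\<^sup>2 * \<rho>\<^sup>2 * sqnorm (e k))"
        using sqnorm_direction_le[OF st(1,2) ec] .
      also have "\<dots> \<le> 4 * (m * sqE ?x + m * sqF ?w + \<beta>\<^sup>2 * \<rho>\<^sup>2 * sqnorm (e k))"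
        using sqE_nonneg sqF_nonneg by (intro mult_left_mono add_mono mult_right_mono) (auto simp: m_def)
      finally have "(1 + inverse \<epsilon>\<^sub>5) * (\<alpha>\<^sup>2 * ((dhat p d)\<^sup>2 * sqnorm ?dir))
          \<le> (1 + inverse \<epsilon>\<^sub>5) * (\<alpha>\<^sup>2 * ((dhat p d)\<^sup>2 * (4 * (m * sqE ?x + m * sqF ?w + \<beta>\<^sup>2 * \<rho>\<^sup>2 * sqnorm (e k)))))"
        using e5 by (intro mult_left_mono) auto
      also have "\<dots> = \<alpha>\<^sup>2 * (K * m * (sqE ?x + sqF ?w)) + \<alpha>\<^sup>2 * (psi3 \<rho> \<beta> \<epsilon>\<^sub>5 (dhat p d) * sqnorm (e k))"
        by (simp add: K_def psi3_def algebra_simps)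
      also have "\<alpha>\<^sup>2 * (K * m * (sqE ?x + sqF ?w)) \<le> \<alpha>\<^sup>2 * (\<psi>\<^sub>4 * (L10 + real T * B))"
      proof (rule mult_left_mono)
        \<comment> \<open>The division by \<open>eps1\<close> in \<open>psi4\<close> is there to
          match the coercivity constant of \<open>lyap_lower\<close>.\<close>
        have "K * m * (sqE ?x + sqF ?w) = \<psi>\<^sub>4 * (eps1 \<rho>\<^sub>2 \<tau>\<^sub>1 * (sqE ?x + sqF ?w))"
          using e1 by (simp add: \<psi>\<^sub>4 psi4_def K_def m_def)
        also have "\<dots> \<le> \<psi>\<^sub>4 * (L10 + real T * B)"
        proof (rule mult_left_mono[OF _ \<psi>\<^sub>4_pos])
          have "eps1 \<rho>\<^sub>2 \<tau>\<^sub>1 * (sqE ?x + sqF ?w) \<le> L10 + real k * B"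
            using lyap_lower[OF \<tau>, of ?x ?v] lyap_nonneg_part[of ?x] ly by linarith
          \<comment> \<open>Passing to the horizon T makes the bound independent of k, so one
            constant increment serves all scaling factors.\<close>
          also have "\<dots> \<le> L10 + real T * B"
            using B_pos k by (simp add: mult_right_mono)
          finally show "eps1 \<rho>\<^sub>2 \<tau>\<^sub>1 * (sqE ?x + sqF ?w) \<le> L10 + real T * B" .
        qed
        finally show "K * m * (sqE ?x + sqF ?w) \<le> \<psi>\<^sub>4 * (L10 + real T * B)" .
      qed simp
      also have "\<alpha>\<^sup>2 * (psi3 \<rho> \<beta> \<epsilon>\<^sub>5 (dhat p d) * sqnorm (e k)) \<le> eps8 \<epsilon>\<^sub>5 * (C\<^sup>2 * (s k)\<^sup>2)"
      proof -
        have "\<alpha>\<^sup>2 * (psi3 \<rho> \<beta> \<epsilon>\<^sub>5 (dhat p d) * sqnorm (e k))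
            \<le> \<alpha>\<^sup>2 * (psi3 \<rho> \<beta> \<epsilon>\<^sub>5 (dhat p d) * ((1 - 2 * \<epsilon>\<^sub>5) * (real n * (dtilde p d)\<^sup>2 * (C\<^sup>2 * (s k)\<^sup>2))))"
          using sqe_le[OF in_ball] \<psi>\<^sub>3_pos by (intro mult_left_mono) auto
        also have "\<dots> = (1 - 2 * \<epsilon>\<^sub>5) * psi3 \<rho> \<beta> \<epsilon>\<^sub>5 (dhat p d) * (real n * (dtilde p d)\<^sup>2 * \<alpha>\<^sup>2) * (C\<^sup>2 * (s k)\<^sup>2)"
          by (simp add: mult_ac)
        also have "\<dots> \<le> eps8 \<epsilon>\<^sub>5 * (C\<^sup>2 * (s k)\<^sup>2)" by (rule mult_right_mono[OF small]) simp
        finally show ?thesis .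
      qed
      finally show ?thesis by simp
    qed
    finally have "(pnorm p (x i (Suc k) - xh i (Suc k)))\<^sup>2
        \<le> (1 - eps8 \<epsilon>\<^sub>5) * (C\<^sup>2 * (s k)\<^sup>2) + \<alpha>\<^sup>2 * (\<psi>\<^sub>4 * (L10 + real T * B))"
      by (simp add: left_diff_distrib)
    also have "\<dots> \<le> (C * s (Suc k))\<^sup>2" using s_step[OF k] by (simp add: power_mult_distrib)
    finally show ?thesis by (rule power2_le_imp_le) (use C s(1)[of "Suc k"] in simp)
  qed
  show inv: "(\<forall>i<n. pnorm p (x i k - xh i k) \<le> C * s k) \<and>
      lyap (\<lambda>i. x i k) (\<lambda>i. v i k) \<le> L10 + real k * B" if "k \<le> T" for k
    using that
  proof (induction k)
    case 0
    \<comment> \<open>The uncompressed first round makes the first compressor input zero, so the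
      ball condition holds initially for every positive \<open>s 0\<close>.\<close>
    have "pnorm p (x i 0 - xh i 0) \<le> C * s 0" if i: "i < n" for i
    proof -
      have x0: "x i 0 \<in> carrier_vec d" using st(1) i by blast
      have "xh i 0 = x i 0" using run i by (auto simp: uca_run_def)
      then have "x i 0 - xh i 0 = 0 \<cdot>\<^sub>v x i 0" using x0 by (intro eq_vecI) auto
      then have "pnorm p (x i 0 - xh i 0) \<le> 0" using pnorm_scale_le[OF p x0 d, of 0] by simp
      then show ?thesis using C s(1)[of 0] by (simp add: order.trans)
    qed
    then show ?case by (simp add: L10)
  next
    case (Suc k)
    then have k: "k < T" and IH: "\<forall>i<n. pnorm p (x i k - xh i k) \<le> C * s k"
      "lyap (\<lambda>i. x i k) (\<lambda>i. v i k) \<le> L10 + real k * B" by auto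
    have "0 \<le> \<alpha> * (\<gamma> / 4 * sqE (\<lambda>i. x i k)
          + 1/4 * (real n * (norm2 (gradient d (mean_fun n f) (mean_vec d n (\<lambda>i. x i k))))\<^sup>2))"
      using \<alpha>(1) \<gamma> sqE_nonneg by simp
    then have "lyap (\<lambda>i. x i (Suc k)) (\<lambda>i. v i (Suc k)) \<le> L10 + real (Suc k) * B"
      using decrease[OF IH(1) k] IH(2) by (simp add: distrib_right)
    then show ?case using next_in_ball[OF IH(1) k _ IH(2)] by blast
  qed
  show "lyap (\<lambda>i. x i (Suc k)) (\<lambda>i. v i (Suc k)) \<le> lyap (\<lambda>i. x i k) (\<lambda>i. v i k)
      - \<alpha> * (\<gamma> / 4 * sqE (\<lambda>i. x i k)
          + 1/4 * (real n * (norm2 (gradient d (mean_fun n f) (mean_vec d n (\<lambda>i. x i k))))\<^sup>2)) + B"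
    if "k < T" for k
    using decrease[of k] inv[of k] that by simp
qed

end

section \<open>The convergence rate\<close>

lemma powr_third_cubed:
  fixes a :: real
  assumes "0 \<le> a"
  shows "(a powr (1/3)) ^ 3 = a" "(a powr (2/3)) ^ 3 = a\<^sup>2" "(a powr (1/3))\<^sup>2 = a powr (2/3)"
proof -
  have *: "(a powr c) ^ k = a powr (c * real k)" if "0 < k" for c k
    using that assms by (cases "a = 0") (simp_all add: powr_powr flip: powr_realpow)
  show "(a powr (1/3)) ^ 3 = a" "(a powr (1/3))\<^sup>2 = a powr (2/3)" using assms by (simp_all add: *)
  show "(a powr (2/3)) ^ 3 = a\<^sup>2" using assms by (simp add: *)
qed

lemma le_powr_thirdD:
  fixes a b :: real
  assumes "0 \<le> a" "0 \<le> b" "a \<le> b powr (1/3)"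
  shows "a ^ 3 \<le> b"
  using power_mono[OF assms(3,1), of 3] powr_third_cubed(1)[OF assms(2)] by simp

text \<open>Whatever is fixed outside the existential is what the hidden constants may depend on;
  \<open>dh\<close>, the graph constants and the normalized initial value belong there and are tied
  to the individual instance by equations.\<close>

theorem theorem2:
  fixes l \<rho> \<rho>\<^sub>2 \<beta> \<gamma> \<tau>\<^sub>0 \<tau>\<^sub>1 \<tau>\<^sub>4 \<omega> r \<delta> C dh L10_normalized :: real
    and \<epsilon>\<^sub>1 \<epsilon>\<^sub>5 \<epsilon>\<^sub>8 \<psi>\<^sub>3 \<psi>\<^sub>4 \<kappa>\<^sub>7 :: real
  assumes "l > 0" and "r > 0" and "C > 0" and "0 < \<delta>" and "\<delta> \<le> 1"
    and "\<tau>\<^sub>0 > 0" and "\<tau>\<^sub>1 \<ge> kappa1 \<rho>\<^sub>2" and "\<beta> = \<tau>\<^sub>1 * \<gamma>" and "\<gamma> > kappa2 l \<rho>\<^sub>2"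
    and "0 < \<omega>" and "\<omega> \<le> 1 / r"
    and "\<epsilon>\<^sub>1 = eps1 \<rho>\<^sub>2 \<tau>\<^sub>1" and "\<epsilon>\<^sub>5 = eps5 \<omega> r \<delta>" and "\<epsilon>\<^sub>8 = eps8 \<epsilon>\<^sub>5"
    and "\<psi>\<^sub>3 = psi3 \<rho> \<beta> \<epsilon>\<^sub>5 dh" and "\<psi>\<^sub>4 = psi4 l \<rho> \<beta> \<gamma> \<epsilon>\<^sub>1 \<epsilon>\<^sub>5 dh"
    and "\<kappa>\<^sub>7 = kappa7 l \<rho> \<rho>\<^sub>2 \<beta> \<gamma>" and "\<kappa>\<^sub>7 > 0"
  shows "\<exists>K1 K2 :: real.
    \<forall>(n::nat) (d::nat) (p::ereal) (dt::real) (A::real mat) (L::real mat) (U::real mat) (lam::nat \<Rightarrow> real)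
     (f::nat \<Rightarrow> real vec \<Rightarrow> real) (fstar::real) (flow::real) (cmpr::real vec \<Rightarrow> real vec)
     (T::nat) (\<alpha>::real) (\<psi>\<^sub>2::real) (L10::real) (s::nat \<Rightarrow> real)
     (x::nat \<Rightarrow> nat \<Rightarrow> real vec) (v::nat \<Rightarrow> nat \<Rightarrow> real vec) (xh::nat \<Rightarrow> nat \<Rightarrow> real vec)
     (y::nat \<Rightarrow> nat \<Rightarrow> real vec) (q::nat \<Rightarrow> nat \<Rightarrow> real vec) (xbar::nat \<Rightarrow> real vec).
      n \<ge> 2 \<longrightarrow> d \<ge> 1 \<longrightarrow> p \<ge> 1 \<longrightarrow> T \<ge> 1 \<longrightarrow>
      dh = dhat p d \<longrightarrow> dt = dtilde p d \<longrightarrow>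
      undirected_connected n A \<longrightarrow> L = laplacian n A \<longrightarrow> \<rho> = rho L \<longrightarrow> \<rho>\<^sub>2 = rho2 L \<longrightarrow>
      laplacian_eigendecomposition n L U lam \<longrightarrow> lam 2 \<le> lam (n + 1) \<longrightarrow> lam (n + 1) \<le> lam n \<longrightarrow>
      (\<forall>i<n. \<forall>z\<in>carrier_vec d. \<exists>g. has_gradient d (f i) z g) \<longrightarrow>
      (\<forall>i<n. \<forall>z\<in>carrier_vec d. \<forall>w\<in>carrier_vec d.
         norm2 (gradient d (f i) z - gradient d (f i) w) \<le> l * norm2 (z - w)) \<longrightarrow>
      bdd_below (mean_fun n f ` carrier_vec d) \<longrightarrow>
      fstar = (INF z\<in>carrier_vec d. mean_fun n f z) \<longrightarrow> flow \<le> fstar \<longrightarrow>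
      locally_bounded_compressor d p r C \<delta> cmpr \<longrightarrow>
      \<alpha> = \<tau>\<^sub>0 / (real n powr (1/3) * dt powr (2/3) * real T powr (1/3)) \<longrightarrow>
      uca_run n d L f cmpr \<alpha> \<beta> \<gamma> \<omega> s x v xh y q \<longrightarrow>
      L10 = lyapunov n d U lam f fstar \<beta> \<gamma> x v 0 \<longrightarrow> L10_normalized = L10 / real n \<longrightarrow>
      \<psi>\<^sub>2 = psi2 \<rho> \<rho>\<^sub>2 \<beta> \<gamma> \<alpha> \<longrightarrow>
      ereal \<tau>\<^sub>0 \<le> kappa0 \<epsilon>\<^sub>5 \<epsilon>\<^sub>8 \<psi>\<^sub>2 \<psi>\<^sub>4 \<longrightarrow>
      real T > kappa3 \<tau>\<^sub>0 n dt \<kappa>\<^sub>7 \<epsilon>\<^sub>5 \<epsilon>\<^sub>8 \<psi>\<^sub>3 \<longrightarrow>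
      \<tau>\<^sub>4 \<ge> kappa4 n C \<epsilon>\<^sub>8 \<psi>\<^sub>4 L10 \<longrightarrow>
      (\<forall>k. s k > 0) \<longrightarrow> (s 0)^2 = \<tau>\<^sub>4 * real n * \<alpha>^2 \<longrightarrow>
      (\<forall>k\<in>{1..T}. (s k)^2 =
         (1 - \<epsilon>\<^sub>8) * (s (k - 1))^2 + kappa4_tilde n dt C \<alpha> \<epsilon>\<^sub>5 \<psi>\<^sub>2 \<psi>\<^sub>4 L10 (s 0) T) \<longrightarrow>
      (\<forall>k. xbar k = mean_vec d n (\<lambda>i. x i k)) \<longrightarrow>
      (1 / real T) * (\<Sum>k<T. (norm2 (gradient d (mean_fun n f) (xbar k)))^2
           + (1 / real n) * (\<Sum>i<n. (norm2 (x i k - xbar k))^2))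
        \<le> K1 * (real n powr (1/3) * dt powr (2/3) / real T powr (2/3)) \<and>
      mean_fun n f (xbar T) - fstar \<le> K2"
proof -
  define c where "c = min (\<gamma> / 4) (1 / 4)"
  \<comment> \<open>The constant \<open>\<psi>\<^sub>2\<close> varies with \<alpha>, hence with n
    and T; inserting the upper bound \<open>\<kappa>\<^sub>7\<close> for \<alpha> makes it
    uniform.\<close>
  define \<Psi> where "\<Psi> = phi7 \<rho> \<beta> \<gamma> + \<kappa>\<^sub>7 * phi8 \<rho> \<rho>\<^sub>2 \<beta> \<gamma>"
  define M where "M = \<Psi> * (1 - 2 * \<epsilon>\<^sub>5) * C\<^sup>2 * \<tau>\<^sub>4"
  show ?thesis
  \<comment> \<open>Both witnesses come from telescoping: the initial value plus the accumulated
    errors, divided by n \<alpha> T and the decrease coefficient c for the average, and by n alone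
    for the final gap.\<close>
  proof (rule exI[of _ "(L10_normalized / \<tau>\<^sub>0 + M * \<tau>\<^sub>0\<^sup>2) / c"], rule exI[of _ "L10_normalized + M * \<tau>\<^sub>0 ^ 3"],
      intro allI impI)
    fix n d T :: nat and p :: ereal and dt fstar flow \<alpha> \<psi>\<^sub>2 L10 :: real and A L U :: "real mat"
      and lam s :: "nat \<Rightarrow> real" and f :: "nat \<Rightarrow> real vec \<Rightarrow> real" and cmpr :: "real vec \<Rightarrow> real vec"
      and x v xh y q :: "nat \<Rightarrow> nat \<Rightarrow> real vec" and xbar :: "nat \<Rightarrow> real vec"
    assume n: "n \<ge> 2" and d: "d \<ge> 1" and p: "p \<ge> 1" and T: "T \<ge> 1"
      and dh: "dh = dhat p d" and dt: "dt = dtilde p d"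
      and "undirected_connected n A" "L = laplacian n A"
      and \<rho>: "\<rho> = rho L" and \<rho>\<^sub>2: "\<rho>\<^sub>2 = rho2 L"
      and dec: "laplacian_eigendecomposition n L U lam" and lam: "lam 2 \<le> lam (n + 1)" "lam (n + 1) \<le> lam n"
      and grads: "\<forall>i<n. \<forall>z\<in>carrier_vec d. \<exists>g. has_gradient d (f i) z g"
      and lip: "\<forall>i<n. \<forall>z\<in>carrier_vec d. \<forall>w\<in>carrier_vec d.
         norm2 (gradient d (f i) z - gradient d (f i) w) \<le> l * norm2 (z - w)"
      and bdd: "bdd_below (mean_fun n f ` carrier_vec d)"
      and fstar: "fstar = (INF z\<in>carrier_vec d. mean_fun n f z)" and "flow \<le> fstar"
      and cmpr: "locally_bounded_compressor d p r C \<delta> cmpr"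
      and \<alpha>: "\<alpha> = \<tau>\<^sub>0 / (real n powr (1/3) * dt powr (2/3) * real T powr (1/3))"
      and run: "uca_run n d L f cmpr \<alpha> \<beta> \<gamma> \<omega> s x v xh y q"
      and L10: "L10 = lyapunov n d U lam f fstar \<beta> \<gamma> x v 0" and L10n: "L10_normalized = L10 / real n"
      and \<psi>\<^sub>2: "\<psi>\<^sub>2 = psi2 \<rho> \<rho>\<^sub>2 \<beta> \<gamma> \<alpha>"
      and \<tau>\<^sub>0_le: "ereal \<tau>\<^sub>0 \<le> kappa0 \<epsilon>\<^sub>5 \<epsilon>\<^sub>8 \<psi>\<^sub>2 \<psi>\<^sub>4"
      and T_gt: "real T > kappa3 \<tau>\<^sub>0 n dt \<kappa>\<^sub>7 \<epsilon>\<^sub>5 \<epsilon>\<^sub>8 \<psi>\<^sub>3"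
      and \<tau>\<^sub>4_ge: "\<tau>\<^sub>4 \<ge> kappa4 n C \<epsilon>\<^sub>8 \<psi>\<^sub>4 L10"
      and s_pos: "\<forall>k. s k > 0" and s0: "(s 0)\<^sup>2 = \<tau>\<^sub>4 * real n * \<alpha>\<^sup>2"
      and s_rec: "\<forall>k\<in>{1..T}. (s k)\<^sup>2 =
         (1 - \<epsilon>\<^sub>8) * (s (k - 1))\<^sup>2 + kappa4_tilde n dt C \<alpha> \<epsilon>\<^sub>5 \<psi>\<^sub>2 \<psi>\<^sub>4 L10 (s 0) T"
      and xbar: "\<forall>k. xbar k = mean_vec d n (\<lambda>i. x i k)"
    have \<rho>\<^sub>2_pos: "0 < \<rho>\<^sub>2" using laplacian_eigendecomposition_bounds(1)[OF dec n] by (simp add: \<rho>\<^sub>2)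
    have "5 / \<rho>\<^sub>2 \<le> kappa2 l \<rho>\<^sub>2" unfolding kappa2_def by (rule Max_ge) auto
    then have "5 / \<rho>\<^sub>2 < \<gamma>" using assms(9) by linarith
    then have \<gamma>: "0 < \<gamma>" "5 \<le> \<gamma> * \<rho>\<^sub>2"
      using \<rho>\<^sub>2_pos by (auto simp: field_simps intro: less_trans[of 0 "5 / \<rho>\<^sub>2"])
    have \<tau>\<^sub>1: "4 \<le> \<tau>\<^sub>1 * \<rho>\<^sub>2" using assms(7) \<rho>\<^sub>2_pos by (simp add: kappa1_def field_simps)
    have \<beta>: "4 * \<gamma> \<le> \<rho>\<^sub>2 * \<beta>" using mult_right_mono[OF \<tau>\<^sub>1, of \<gamma>] \<gamma> assms(8) by (simp add: mult_ac)
    interpret network n d L U lam f fstar l \<beta> \<gamma> \<rho> \<rho>\<^sub>2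
    proof
      show "fstar \<le> mean_fun n f z" if "z \<in> carrier_vec d" for z
        unfolding fstar by (rule cINF_lower[OF bdd that])
    qed (use n d dec lam \<rho> \<rho>\<^sub>2 grads lip assms(1) \<gamma> \<beta> in auto)
    have dpos: "0 < d" using d by simp
    note st = uca_run_state[OF run]
    have cm: "\<forall>z\<in>carrier_vec d. cmpr z \<in> carrier_vec d" using cmpr by (auto simp: locally_bounded_compressor_def)
    have dt_pos: "0 < dt" using dtilde_pos[OF dpos] by (simp add: dt)
    \<comment> \<open>Naming the roots turns the scaling relations below into polynomial
      identities.\<close>
    define N D t where "N = real n powr (1/3)" and "D = dt powr (2/3)" and "t = real T powr (1/3)"
    have NDt: "0 < N" "0 < D" "0 < t" "N ^ 3 = real n" "D ^ 3 = dt\<^sup>2" "t ^ 3 = real T" "t\<^sup>2 = real T powr (2/3)"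
      using n dt_pos T by (simp_all add: N_def D_def t_def powr_third_cubed)
    have \<alpha>_eq: "\<alpha> = \<tau>\<^sub>0 / (N * D * t)" by (simp add: \<alpha> N_def D_def t_def)
    have \<alpha>_pos: "0 < \<alpha>" using NDt assms(6) by (simp add: \<alpha>_eq)
    define R where "R = N * D / t\<^sup>2"
    have R: "R = real n powr (1/3) * dt powr (2/3) / real T powr (2/3)"
      unfolding R_def NDt(7) by (simp add: N_def D_def)
    have R_pos: "0 < R" using NDt(1-3) by (simp add: R_def)
    \<comment> \<open>The three scaling relations behind the step size: \<open>\<alpha>2\<close>
      gives the order of the error per unit step, \<open>\<alpha>3\<close> bounds the total error
      over the horizon, and \<open>\<alpha>1\<close> gives the order of the initial value's
      contribution. The first and the last share the target rate R.\<close>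
    have \<alpha>2: "real n * dt\<^sup>2 * \<alpha>\<^sup>2 = \<tau>\<^sub>0\<^sup>2 * R"
      using NDt(1-3) unfolding NDt(4,5)[symmetric] \<alpha>_eq R_def
      by (simp add: field_simps power2_eq_square power3_eq_cube)
    have \<alpha>3: "real n * dt\<^sup>2 * \<alpha> ^ 3 * real T = \<tau>\<^sub>0 ^ 3"
      using NDt(1-3) unfolding NDt(4-6)[symmetric] \<alpha>_eq
      by (simp add: field_simps)
    have \<alpha>1: "1 / (\<alpha> * real T) = R / \<tau>\<^sub>0"
      using NDt(1-3) assms(6) unfolding NDt(6)[symmetric] \<alpha>_eq R_def
      by (simp add: field_simps power2_eq_square power3_eq_cube)
    have e5: "0 < \<epsilon>\<^sub>5" "\<epsilon>\<^sub>5 \<le> 1/2" using eps5_bounds[OF assms(2,4,5,10,11)] by (auto simp: assms(13))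
    have e8: "0 < \<epsilon>\<^sub>8" "\<epsilon>\<^sub>8 \<le> 1" using eps8_bounds[OF e5] by (auto simp: assms(14))
    \<comment> \<open>The first entry of \<open>kappa3\<close> is this inequality in cubed
      form.\<close>
    have \<alpha>_lt: "\<alpha> < \<kappa>\<^sub>7"
    proof -
      have "\<tau>\<^sub>0 ^ 3 / (real n * dt\<^sup>2 * \<kappa>\<^sub>7 ^ 3) < real T" using T_gt by (simp add: kappa3_def)
      then have "\<tau>\<^sub>0 ^ 3 < real n * dt\<^sup>2 * real T * \<kappa>\<^sub>7 ^ 3"
        using n dt_pos assms(18) by (simp add: field_simps)
      then have "real n * dt\<^sup>2 * real T * \<alpha> ^ 3 < real n * dt\<^sup>2 * real T * \<kappa>\<^sub>7 ^ 3"
        unfolding \<alpha>3[symmetric] by (simp add: mult_ac)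
      then have "\<alpha> ^ 3 < \<kappa>\<^sub>7 ^ 3" using n dt_pos T by simp
      then show ?thesis by (rule power_less_imp_less_base) (use assms(18) in simp)
    qed
    have step_size: "\<alpha> * phi2 l \<rho> \<rho>\<^sub>2 \<beta> \<gamma> \<le> phi1 l \<rho>\<^sub>2 \<beta> \<gamma>" "\<alpha> * phi4 \<rho> \<gamma> \<le> phi3 \<rho>\<^sub>2 \<gamma>"
      "\<alpha> * phi6 l \<rho>\<^sub>2 \<beta> \<gamma> \<le> phi5 l \<rho>\<^sub>2 \<beta> \<gamma>"
    proof -
      have "\<alpha> \<le> kappa0_hat l \<rho> \<rho>\<^sub>2 \<beta> \<gamma>" using \<alpha>_lt by (simp add: assms(17) kappa7_def)
      then have "\<alpha> \<le> phi1 l \<rho>\<^sub>2 \<beta> \<gamma> / phi2 l \<rho> \<rho>\<^sub>2 \<beta> \<gamma>" "\<alpha> \<le> phi3 \<rho>\<^sub>2 \<gamma> / phi4 \<rho> \<gamma>"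
        "\<alpha> \<le> phi5 l \<rho>\<^sub>2 \<beta> \<gamma> / phi6 l \<rho>\<^sub>2 \<beta> \<gamma>"
        by (auto simp: kappa0_hat_def)
      then show "\<alpha> * phi2 l \<rho> \<rho>\<^sub>2 \<beta> \<gamma> \<le> phi1 l \<rho>\<^sub>2 \<beta> \<gamma>" "\<alpha> * phi4 \<rho> \<gamma> \<le> phi3 \<rho>\<^sub>2 \<gamma>"
        "\<alpha> * phi6 l \<rho>\<^sub>2 \<beta> \<gamma> \<le> phi5 l \<rho>\<^sub>2 \<beta> \<gamma>"
        using step_constants(4-6) by (auto simp: pos_le_divide_eq)
    qed
    have phi7: "0 < phi7 \<rho> \<beta> \<gamma>" using \<rho>_pos \<gamma>(1) \<beta>_pos by (simp add: phi7_def add_pos_pos)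
    have \<psi>\<^sub>2_pos: "0 < \<psi>\<^sub>2"
      using phi7 mult_pos_pos[OF \<alpha>_pos step_constants(7)] by (simp add: \<psi>\<^sub>2 psi2_def)
    have \<psi>\<^sub>2_le: "\<psi>\<^sub>2 \<le> \<Psi>"
      using mult_right_mono[OF less_imp_le[OF \<alpha>_lt], of "phi8 \<rho> \<rho>\<^sub>2 \<beta> \<gamma>"] step_constants(7)
      by (simp add: \<psi>\<^sub>2 psi2_def \<Psi>_def)
    have \<tau>\<^sub>1_pos: "0 < \<tau>\<^sub>1"
    proof -
      have "0 < \<tau>\<^sub>1 * \<rho>\<^sub>2" using \<tau>\<^sub>1 by linarith
      then show ?thesis using \<rho>\<^sub>2_pos by (simp add: zero_less_mult_iff)
    qed
    have e1: "0 < \<epsilon>\<^sub>1" using \<tau>\<^sub>1 \<tau>\<^sub>1_pos \<rho>\<^sub>2_pos by (simp add: assms(12) eps1_def)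
    have \<psi>\<^sub>4_pos: "0 \<le> \<psi>\<^sub>4" unfolding assms(16) psi4_def
      using e1 e5 by (intro divide_nonneg_pos mult_nonneg_nonneg max.coboundedI1) auto
    have \<psi>\<^sub>3_nonneg: "0 \<le> \<psi>\<^sub>3" using e5 by (simp add: assms(15) psi3_def)
    have \<tau>\<^sub>0_cube: "2 * (1 - 2 * \<epsilon>\<^sub>5) * \<psi>\<^sub>2 * \<psi>\<^sub>4 * \<tau>\<^sub>0 ^ 3 \<le> \<epsilon>\<^sub>8"
    proof (cases "2 * (1 - 2 * \<epsilon>\<^sub>5) * \<psi>\<^sub>2 * \<psi>\<^sub>4 = 0")
      \<comment> \<open>Here \<open>kappa0\<close> is infinite and gives no bound, but the left-hand
        side vanishes.\<close>
      case True
      show ?thesis unfolding True using e8 by simp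
    next
      case False
      have "0 \<le> 2 * (1 - 2 * \<epsilon>\<^sub>5) * \<psi>\<^sub>2 * \<psi>\<^sub>4"
        using e5 \<psi>\<^sub>2_pos \<psi>\<^sub>4_pos by (intro mult_nonneg_nonneg) auto
      with False have pos: "0 < 2 * (1 - 2 * \<epsilon>\<^sub>5) * \<psi>\<^sub>2 * \<psi>\<^sub>4" by linarith
      have "\<tau>\<^sub>0 \<le> (\<epsilon>\<^sub>8 / (2 * (1 - 2 * \<epsilon>\<^sub>5) * \<psi>\<^sub>2 * \<psi>\<^sub>4)) powr (1/3)"
        using \<tau>\<^sub>0_le False by (simp only: kappa0_def if_False ereal_less_eq)
      then have "\<tau>\<^sub>0 ^ 3 \<le> \<epsilon>\<^sub>8 / (2 * (1 - 2 * \<epsilon>\<^sub>5) * \<psi>\<^sub>2 * \<psi>\<^sub>4)"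
        using assms(6) e8 pos by (intro le_powr_thirdD divide_nonneg_pos) auto
      then show ?thesis using pos by (simp only: pos_le_divide_eq mult.commute)
    qed
    have small: "(1 - 2 * \<epsilon>\<^sub>5) * \<psi>\<^sub>3 * (real n * dt\<^sup>2 * \<alpha>\<^sup>2) \<le> \<epsilon>\<^sub>8"
    proof -
      define a where "a = (1 - 2 * \<epsilon>\<^sub>5) * \<psi>\<^sub>3 * \<tau>\<^sub>0\<^sup>2 / \<epsilon>\<^sub>8"
      have a: "0 \<le> a" using e5 e8 \<psi>\<^sub>3_nonneg by (simp add: a_def)
      have "a powr (3/2) * real n powr (1/2) * dt \<le> real T"
        using T_gt by (simp add: kappa3_def a_def)
      \<comment> \<open>The second entry of \<open>kappa3\<close>, raised to the power 2/3, states
        that a R \<le> 1.\<close>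
      then have "(a powr (3/2) * real n powr (1/2) * dt) powr (2/3) \<le> real T powr (2/3)"
        using dt_pos by (intro powr_mono2) auto
      then have "a * N * D \<le> t\<^sup>2"
        using a dt_pos by (simp add: powr_mult powr_powr NDt(7) N_def D_def)
      then have "a * R \<le> 1" using NDt(3) by (simp add: R_def mult.assoc)
      then have "\<epsilon>\<^sub>8 * (a * R) \<le> \<epsilon>\<^sub>8 * 1" using e8 by (intro mult_left_mono) auto
      then show ?thesis unfolding \<alpha>2 using e8 by (simp add: a_def mult_ac)
    qed
    have L10_lyap: "L10 = lyap (\<lambda>i. x i 0) (\<lambda>i. v i 0)"
      unfolding L10 lyap_def using st(1,2)[OF cm] by (intro lyapunov_eq_energy)
    define B where "B = \<alpha> * \<psi>\<^sub>2 * ((1 - 2 * \<epsilon>\<^sub>5) * (real n * dt\<^sup>2 * (C\<^sup>2 * (s 0)\<^sup>2)))"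
    define \<kappa> where "\<kappa> = kappa4_tilde n dt C \<alpha> \<epsilon>\<^sub>5 \<psi>\<^sub>2 \<psi>\<^sub>4 L10 (s 0) T"
    \<comment> \<open>The increment of the scaling recursion is exactly the growth of the compressor
      input that the invariant has to accommodate, so its step condition holds with
      equality.\<close>
    have \<kappa>_eq: "C\<^sup>2 * \<kappa> = \<alpha>\<^sup>2 * (\<psi>\<^sub>4 * (L10 + real T * B))"
      using assms(3) by (simp add: \<kappa>_def kappa4_tilde_def B_def field_simps power2_eq_square power3_eq_cube)
    have s_Suc: "(s (Suc k))\<^sup>2 = (1 - \<epsilon>\<^sub>8) * (s k)\<^sup>2 + \<kappa>" if "k < T" for k
      using s_rec[rule_format, of "Suc k"] that by (simp add: \<kappa>_def)
    \<comment> \<open>The increment has two summands, each at most half of the bound: the condition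
      on \<open>\<tau>\<^sub>4\<close> handles the initial Lyapunov value and the condition on
      \<open>\<tau>\<^sub>0\<close> the accumulated errors. Consequently no scaling factor up to T
      exceeds the first one.\<close>
    have \<kappa>_le: "\<kappa> \<le> \<epsilon>\<^sub>8 * (s 0)\<^sup>2"
    proof -
      have "2 * \<psi>\<^sub>4 * L10 / (C\<^sup>2 * \<epsilon>\<^sub>8 * real n) * (\<epsilon>\<^sub>8 * real n * \<alpha>\<^sup>2) \<le> \<tau>\<^sub>4 * (\<epsilon>\<^sub>8 * real n * \<alpha>\<^sup>2)"
        using \<tau>\<^sub>4_ge e8 unfolding kappa4_def by (intro mult_right_mono) auto
      then have 1: "2 * (\<psi>\<^sub>4 * L10 * \<alpha>\<^sup>2 / C\<^sup>2) \<le> \<epsilon>\<^sub>8 * (s 0)\<^sup>2"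
        using e8 n assms(3) by (simp add: s0 mult_ac)
      have "2 * (1 - 2 * \<epsilon>\<^sub>5) * \<psi>\<^sub>2 * \<psi>\<^sub>4 * (real n * dt\<^sup>2 * \<alpha> ^ 3 * real T) * (s 0)\<^sup>2 \<le> \<epsilon>\<^sub>8 * (s 0)\<^sup>2"
        unfolding \<alpha>3 by (rule mult_right_mono[OF \<tau>\<^sub>0_cube]) simp
      then have 2: "2 * ((1 - 2 * \<epsilon>\<^sub>5) * \<psi>\<^sub>2 * \<psi>\<^sub>4 * real n * dt\<^sup>2 * (s 0)\<^sup>2 * \<alpha> ^ 3 * real T) \<le> \<epsilon>\<^sub>8 * (s 0)\<^sup>2"
        by (simp only: mult_ac)
      show ?thesis using 1 2 unfolding \<kappa>_def kappa4_tilde_def by linarith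
    qed
    have s_le: "(s k)\<^sup>2 \<le> (s 0)\<^sup>2" if "k \<le> T" for k
      using that
    proof (induction k)
      case (Suc k)
      have "(1 - \<epsilon>\<^sub>8) * (s k)\<^sup>2 \<le> (1 - \<epsilon>\<^sub>8) * (s 0)\<^sup>2" using Suc e8 by (intro mult_left_mono) auto
      then show ?case using s_Suc[of k] Suc \<kappa>_le by (simp add: left_diff_distrib)
    qed simp
    have s_step: "(1 - eps8 \<epsilon>\<^sub>5) * (C\<^sup>2 * (s k)\<^sup>2) + \<alpha>\<^sup>2 * (\<psi>\<^sub>4 * (L10 + real T * B)) \<le> C\<^sup>2 * (s (Suc k))\<^sup>2"
      if "k < T" for k
      unfolding s_Suc[OF that] \<kappa>_eq[symmetric] assms(14)[symmetric] by (simp add: distrib_left mult_ac)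
    have \<tau>\<^sub>1': "1 < \<tau>\<^sub>1 * \<rho>\<^sub>2" using \<tau>\<^sub>1 by simp
    note inv = uca_invariant[OF run cmpr p assms(2,3,4,5,10,11) \<alpha>_pos step_size assms(8) \<tau>\<^sub>1' assms(13) \<psi>\<^sub>2
      less_imp_le[OF \<psi>\<^sub>2_pos] assms(16)[unfolded assms(12) dh] small[unfolded assms(14,15) dh dt] B_def[unfolded dt] L10_lyap
      s_pos[rule_format] s_le s_step]
    define E where "E k = lyap (\<lambda>i. x i k) (\<lambda>i. v i k)" for k
    define g where "g k = (norm2 (gradient d (mean_fun n f) (xbar k)))\<^sup>2" for k
    define h where "h k = 1 / real n * (\<Sum>i<n. (norm2 (x i k - xbar k))\<^sup>2)" for k
    have h_eq: "real n * h k = sqE (\<lambda>i. x i k)" for k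
      using sqE_eq[of "\<lambda>i. x i k"] st(1)[OF cm, of k] n by (simp add: h_def sqnorm_def xbar)
    have E_lower: "real n * (mean_fun n f (xbar k) - fstar) \<le> E k" for k
    proof -
      have "0 \<le> eps1 \<rho>\<^sub>2 \<tau>\<^sub>1 * (sqE (\<lambda>i. x i k) + sqF (shifted (\<lambda>i. x i k) (\<lambda>i. v i k)))"
        using e1 sqE_nonneg sqF_nonneg by (simp add: assms(12))
      then show ?thesis
        using lyap_lower[OF assms(8) \<tau>\<^sub>1', of "\<lambda>i. x i k" "\<lambda>i. v i k"] by (simp add: E_def xbar)
    qed
    have E_nonneg: "0 \<le> E k" for k
      using lyap_nonneg_part[of "\<lambda>i. x i k"] E_lower[of k] by (simp add: xbar)
    have c_pos: "0 < c" using \<gamma> by (simp add: c_def)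
    have E_step: "E (Suc k) \<le> E k - \<alpha> * (c * real n * (g k + h k)) + B" if "k < T" for k
    proof -
      have "c * (real n * h k) \<le> \<gamma> / 4 * (real n * h k)"
        by (rule mult_right_mono) (simp_all only: h_eq sqE_nonneg, simp add: c_def)
      moreover have "c * (real n * g k) \<le> 1/4 * (real n * g k)"
        by (rule mult_right_mono) (simp_all add: c_def g_def)
      ultimately have "c * real n * (g k + h k) \<le> \<gamma> / 4 * (real n * h k) + 1/4 * (real n * g k)"
        by (simp add: distrib_left mult.assoc)
      then have "\<alpha> * (c * real n * (g k + h k)) \<le> \<alpha> * (\<gamma> / 4 * (real n * h k) + 1/4 * (real n * g k))"
        using \<alpha>_pos by (intro mult_left_mono) auto
      moreover have "E (Suc k) \<le> E k - \<alpha> * (\<gamma> / 4 * (real n * h k) + 1/4 * (real n * g k)) + B"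
        unfolding E_def h_eq g_def xbar[rule_format] by (rule inv(2)) (use that in auto)
      ultimately show ?thesis by linarith
    qed
    have tele: "E k + \<alpha> * (c * real n * (\<Sum>j<k. g j + h j)) \<le> L10 + real k * B" if "k \<le> T" for k
      using that
    proof (induction k)
      case 0
      then show ?case by (simp add: E_def L10_lyap)
    next
      case (Suc k)
      then show ?case using E_step[of k] by (simp add: distrib_left distrib_right)
    qed
    have B_eq: "real T * B / real n = \<psi>\<^sub>2 * (1 - 2 * \<epsilon>\<^sub>5) * C\<^sup>2 * \<tau>\<^sub>4 * \<tau>\<^sub>0 ^ 3"
      "B / real n = \<alpha> * (\<psi>\<^sub>2 * (1 - 2 * \<epsilon>\<^sub>5) * C\<^sup>2 * \<tau>\<^sub>4 * (\<tau>\<^sub>0\<^sup>2 * R))"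
      using n unfolding \<alpha>3[symmetric] \<alpha>2[symmetric] B_def s0
      by (simp_all add: field_simps power2_eq_square power3_eq_cube)
    \<comment> \<open>The sign is forced by the positive scaling factor \<open>s 0\<close>.\<close>
    have \<tau>\<^sub>4_pos: "0 < \<tau>\<^sub>4"
    proof -
      have "0 < (s 0)\<^sup>2" using s_pos[rule_format, of 0] by simp
      then have "0 < \<tau>\<^sub>4 * (real n * \<alpha>\<^sup>2)" unfolding s0 by (simp only: mult.assoc)
      then show ?thesis by (rule zero_less_mult_pos2) (use n \<alpha>_pos in simp)
    qed
    have M_le: "\<psi>\<^sub>2 * (1 - 2 * \<epsilon>\<^sub>5) * C\<^sup>2 * \<tau>\<^sub>4 \<le> M"
      unfolding M_def using \<psi>\<^sub>2_le e5 \<tau>\<^sub>4_pos by (intro mult_right_mono) auto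
    have avg: "(1 / real T) * (\<Sum>k<T. g k + h k) \<le> (L10_normalized / \<tau>\<^sub>0 + M * \<tau>\<^sub>0\<^sup>2) / c * R"
    proof -
      \<comment> \<open>The Lyapunov value at time T is nonnegative and can be discarded; the final
        gap below instead discards the accumulated decrease.\<close>
      have "\<alpha> * (c * real n * (\<Sum>j<T. g j + h j)) \<le> L10 + real T * B"
        using tele[of T] E_nonneg[of T] by simp
      then have "\<alpha> * (c * real n * (\<Sum>j<T. g j + h j)) / (c * real n * \<alpha> * real T)
          \<le> (L10 + real T * B) / (c * real n * \<alpha> * real T)"
        using c_pos \<alpha>_pos by (intro divide_right_mono) auto
      then have "(1 / real T) * (\<Sum>j<T. g j + h j) \<le> (L10 + real T * B) / (c * real n * \<alpha> * real T)"
        using c_pos \<alpha>_pos n T by simp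
      also have "\<dots> = (L10 / real n * (1 / (\<alpha> * real T)) + B / real n / \<alpha>) / c"
        using c_pos \<alpha>_pos n T by (simp add: field_simps)
      also have "\<dots> = (L10_normalized / \<tau>\<^sub>0 + \<psi>\<^sub>2 * (1 - 2 * \<epsilon>\<^sub>5) * C\<^sup>2 * \<tau>\<^sub>4 * \<tau>\<^sub>0\<^sup>2) / c * R"
      proof -
        have "(a * (R / \<tau>\<^sub>0) + \<alpha> * (m * (\<tau>\<^sub>0\<^sup>2 * R)) / \<alpha>) / c = (a / \<tau>\<^sub>0 + m * \<tau>\<^sub>0\<^sup>2) / c * R" for a m
          using \<alpha>_pos by (simp add: algebra_simps add_divide_distrib)
        then show ?thesis unfolding \<alpha>1 B_eq(2) L10n .
      qed
      also have "\<dots> \<le> (L10_normalized / \<tau>\<^sub>0 + M * \<tau>\<^sub>0\<^sup>2) / c * R"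
        using M_le c_pos R_pos by (intro mult_right_mono divide_right_mono add_left_mono) auto
      finally show ?thesis .
    qed
    have final: "mean_fun n f (xbar T) - fstar \<le> L10_normalized + M * \<tau>\<^sub>0 ^ 3"
    proof -
      have "0 \<le> (\<Sum>j<T. g j + h j)" unfolding g_def h_def by (intro sum_nonneg add_nonneg_nonneg mult_nonneg_nonneg) auto
      then have "0 \<le> \<alpha> * (c * real n * (\<Sum>j<T. g j + h j))" using \<alpha>_pos c_pos by simp
      then have "real n * (mean_fun n f (xbar T) - fstar) \<le> L10 + real T * B"
        using tele[of T] E_lower[of T] by simp
      then have "mean_fun n f (xbar T) - fstar \<le> L10 / real n + real T * B / real n"
        using n by (simp add: field_simps)
      also have "\<dots> \<le> L10_normalized + M * \<tau>\<^sub>0 ^ 3"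
        unfolding B_eq(1) L10n using M_le assms(6) by (intro add_left_mono mult_right_mono) auto
      finally show ?thesis .
    qed
    show "(1 / real T) * (\<Sum>k<T. (norm2 (gradient d (mean_fun n f) (xbar k)))^2
           + (1 / real n) * (\<Sum>i<n. (norm2 (x i k - xbar k))^2))
        \<le> (L10_normalized / \<tau>\<^sub>0 + M * \<tau>\<^sub>0\<^sup>2) / c * (real n powr (1/3) * dt powr (2/3) / real T powr (2/3)) \<and>
      mean_fun n f (xbar T) - fstar \<le> L10_normalized + M * \<tau>\<^sub>0 ^ 3"
      using avg final unfolding g_def h_def R by blast
  qed
qed

end
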